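(* Let $n\ge4$, $N\ge2n$, $\epsilon>0$, and let $(f,\phi)$ be a sufficiently regular solution of the Vlasov-Poisson system on a time interval $[0,T]$ such that $$\mathcal{E}_N[f(t)]:=\sum_{|\alpha|\le N,\ Z^\alpha\in\gamma^{|\alpha|}}\|Z^\alpha f(t)\|_{L^1(\mathbb{R}^n_x\times\mathbb{R}^n_v)}\le2\epsilon\qquad\text{for all }t\in[0,T].$$ Then there is a constant $C$ depending only on $n$ and $N$ such that, for all multi-indices $\gamma,\beta$ with $|\gamma|\le N$, $|\beta|\le N$, $|\gamma|+|\beta|\le N+1$, and all $t\in[0,T]$, $$\|\nabla_xZ^\gamma(\phi)\,Z^\beta(f)\|_{L^1(\mathbb{R}^n_x\times\mathbb{R}^n_v)}\le C\sum_{|\beta'|\le N}\frac{\epsilon}{(1+t)^{n-1}}\|Z^{\beta'}f\|_{L^1(\mathbb{R}^n_x\times\mathbb{R}^n_v)} .$$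
   Context: Vlasov-Poisson system: for fixed $\mu\in\{1,-1\}$, $\partial_tf+v\cdot\nabla_xf+\mu\nabla_x\phi\cdot\nabla_vf=0$, $\triangle\phi=\rho(f)$, $x,v\in\mathbb{R}^n$, where $\rho(f)(t,x)=\int_{\mathbb{R}^n}f(t,x,v)\,dv$ and $\phi=G_0*_x\rho(f)$ with $G_0(x)=c_n|x|^{-(n-2)}$ the Green's function of $\triangle$. The set $\gamma$ (not to be confused with the multi-index $\gamma$) consists of the $M=2n+n(n-1)/2+1$ operators $\partial_{x^i}$, $t\partial_{x^i}+\partial_{v^i}$ ($1\le i\le n$), $\Omega^x_{ij}+\Omega^v_{ij}$ ($1\le i<j\le n$), $S^x+S^v$, where $\Omega^x_{ij}=x^i\partial_{x^j}-x^j\partial_{x^i}$, $\Omega^v_{ij}=v^i\partial_{v^j}-v^j\partial_{v^i}$, $S^x=\sum_ix^i\partial_{x^i}$, $S^v=\sum_iv^i\partial_{v^i}$. Let $Z^1,\dots,Z^M$ be an ordering of it. For $\alpha=(\alpha^1,\dots,\alpha^k)$ with $\alpha^j\in\{1,\dots,M\}$, $|\alpha|=k$, $Z^\alpha=Z^{\alpha^1}\cdots Z^{\alpha^k}$ (identity if $k=0$). On functions of $(t,x)$ only, such as $\phi$, each $Z$ acts through its $x$-part ($\partial_{x^i}$, $t\partial_{x^i}$, $\Omega^x_{ij}$, $S^x$). All norms are taken at fixed time $t$. "Sufficiently regular" means smooth enough and decaying fast enough that all expressions make sense. *)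

theory Defs
  imports "HOL-Analysis.Analysis"
begin

section \<open>Calculus on Euclidean spaces\<close>

text \<open>Position and velocity space is \<open>real ^ 'n\<close> with \<open>n = CARD('n)\<close>; phase space is the
  product, a point being \<open>z = (x, v)\<close>. The order on \<open>'n\<close> only serves to speak of pairs \<open>i < j\<close>.\<close>

type_synonym 'n phase = "(real ^ 'n) \<times> (real ^ 'n)"

definition pd :: "'a::euclidean_space \<Rightarrow> ('a \<Rightarrow> real) \<Rightarrow> 'a \<Rightarrow> real" where
  "pd b g z = deriv (\<lambda>s. g (z + s *\<^sub>R b)) 0"

abbreviation dx :: "'n::finite \<Rightarrow> ('n phase \<Rightarrow> real) \<Rightarrow> 'n phase \<Rightarrow> real" where
  "dx i \<equiv> pd (axis i 1, 0)"

abbreviation dv :: "'n::finite \<Rightarrow> ('n phase \<Rightarrow> real) \<Rightarrow> 'n phase \<Rightarrow> real" where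
  "dv i \<equiv> pd (0, axis i 1)"

abbreviation ds :: "'n::finite \<Rightarrow> (real ^ 'n \<Rightarrow> real) \<Rightarrow> real ^ 'n \<Rightarrow> real" where
  "ds i \<equiv> pd (axis i 1)"

definition grad :: "(real ^ 'n::finite \<Rightarrow> real) \<Rightarrow> real ^ 'n \<Rightarrow> real ^ 'n" where
  "grad g x = (\<chi> i. ds i g x)"

definition laplacian :: "(real ^ 'n::finite \<Rightarrow> real) \<Rightarrow> real ^ 'n \<Rightarrow> real" where
  "laplacian g x = (\<Sum>i\<in>UNIV. ds i (ds i g) x)"

text \<open>Functions of class \<open>C\<^sup>k\<close> on the whole space.\<close>

fun Ck :: "nat \<Rightarrow> ('a::euclidean_space \<Rightarrow> real) \<Rightarrow> bool" where
  "Ck 0 g \<longleftrightarrow> continuous_on UNIV g"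
| "Ck (Suc k) g \<longleftrightarrow> (\<forall>z. g differentiable (at z)) \<and> (\<forall>b\<in>Basis. Ck k (pd b g))"

text \<open>The \<open>L\<^sup>1\<close> norm takes values in \<open>[0, \<infinity>]\<close>; it is infinite, rather than a junk value, for
  measurable functions that are not integrable.\<close>

definition L1norm :: "('a::euclidean_space \<Rightarrow> 'b::real_normed_vector) \<Rightarrow> ennreal" where
  "L1norm g = (\<integral>\<^sup>+ z. ennreal (norm (g z)) \<partial>lborel)"


section \<open>The commutation vector fields\<close>

datatype 'n vfield =
    Translation 'n   \<comment> \<open>\<open>\<partial>\<^sub>x\<^sub>i\<close>\<close>
  | Galilean 'n      \<comment> \<open>\<open>t \<partial>\<^sub>x\<^sub>i + \<partial>\<^sub>v\<^sub>i\<close>\<close>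
  | Rotation 'n 'n   \<comment> \<open>\<open>\<Omega>\<^sup>x\<^sub>i\<^sub>j + \<Omega>\<^sup>v\<^sub>i\<^sub>j\<close>\<close>
  | Scaling          \<comment> \<open>\<open>S\<^sup>x + S\<^sup>v\<close>\<close>

definition vfields :: "'n::{finite,linorder} vfield set" where
  "vfields = range Translation \<union> range Galilean \<union> {Rotation i j | i j. i < j} \<union> {Scaling}"

text \<open>Action at time \<open>t\<close> on functions of \<open>(x, v)\<close>.\<close>

fun Zf :: "real \<Rightarrow> 'n::finite vfield \<Rightarrow> ('n phase \<Rightarrow> real) \<Rightarrow> 'n phase \<Rightarrow> real" where
  "Zf t (Translation i) g z = dx i g z"
| "Zf t (Galilean i) g z = t * dx i g z + dv i g z"
| "Zf t (Rotation i j) g z =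
     (fst z $ i * dx j g z - fst z $ j * dx i g z) + (snd z $ i * dv j g z - snd z $ j * dv i g z)"
| "Zf t Scaling g z =
     (\<Sum>i\<in>UNIV. fst z $ i * dx i g z) + (\<Sum>i\<in>UNIV. snd z $ i * dv i g z)"

text \<open>Action at time \<open>t\<close>, through the \<open>x\<close>-part, on functions of \<open>x\<close>.\<close>

fun Zs :: "real \<Rightarrow> 'n::finite vfield \<Rightarrow> (real ^ 'n \<Rightarrow> real) \<Rightarrow> real ^ 'n \<Rightarrow> real" where
  "Zs t (Translation i) g x = ds i g x"
| "Zs t (Galilean i) g x = t * ds i g x"
| "Zs t (Rotation i j) g x = x $ i * ds j g x - x $ j * ds i g x"
| "Zs t Scaling g x = (\<Sum>i\<in>UNIV. x $ i * ds i g x)"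

text \<open>A multi-index \<open>\<alpha> = (\<alpha>\<^sup>1, \<dots>, \<alpha>\<^sup>k)\<close> is a list over \<open>vfields\<close>, with \<open>|\<alpha>| = length \<alpha>\<close>: the
  vector fields label themselves instead of being numbered from \<open>1\<close> to \<open>M\<close>
  (\<open>card_vfields\<close> below gives the value of \<open>M\<close>).\<close>

definition multi_indices :: "nat \<Rightarrow> 'n::{finite,linorder} vfield list set" where
  "multi_indices N = {\<alpha>. set \<alpha> \<subseteq> vfields \<and> length \<alpha> \<le> N}"

definition Zf_pow :: "real \<Rightarrow> 'n::finite vfield list \<Rightarrow> ('n phase \<Rightarrow> real) \<Rightarrow> 'n phase \<Rightarrow> real" where
  "Zf_pow t \<alpha> g = foldr (Zf t) \<alpha> g"

definition Zs_pow :: "real \<Rightarrow> 'n::finite vfield list \<Rightarrow> (real ^ 'n \<Rightarrow> real) \<Rightarrow> real ^ 'n \<Rightarrow> real" where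
  "Zs_pow t \<alpha> g = foldr (Zs t) \<alpha> g"

definition energy :: "nat \<Rightarrow> real \<Rightarrow> ('n::{finite,linorder} phase \<Rightarrow> real) \<Rightarrow> ennreal" where
  "energy N t g = (\<Sum>\<alpha>\<in>multi_indices N. L1norm (Zf_pow t \<alpha> g))"

lemma finite_vfields: "finite (vfields :: 'n::{finite,linorder} vfield set)"
proof -
  have "{Rotation i j | i j. i < j} \<subseteq> (\<lambda>(i, j). Rotation i j) ` (UNIV :: ('n \<times> 'n) set)"
    by auto
  then have "finite {Rotation i j | i j. i < (j::'n)}"
    by (rule finite_subset) simp
  then show ?thesis by (simp add: vfields_def)
qed

lemma finite_multi_indices: "finite (multi_indices N :: 'n::{finite,linorder} vfield list set)"
  unfolding multi_indices_def by (rule finite_lists_length_le[OF finite_vfields])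

lemma card_vfields:
  "card (vfields :: 'n::{finite,linorder} vfield set) =
     2 * CARD('n) + CARD('n) * (CARD('n) - 1) div 2 + 1"
proof -
  let ?L = "{(i, j). i < (j::'n)}" and ?G = "{(i, j). j < (i::'n)}" and ?D = "range (\<lambda>i::'n. (i, i))"
  let ?R = "{Rotation i j | i j. i < (j::'n)}"
  have G: "card ?G = card ?L"
    by (rule bij_betw_same_card[of prod.swap], rule bij_betwI[where g = prod.swap]) auto
  have D: "card ?D = CARD('n)"
    by (rule card_image) (auto intro: injI)
  have "CARD('n) * CARD('n) = card (?D \<union> (?L \<union> ?G))"
  proof -
    have "?D \<union> (?L \<union> ?G) = UNIV" by (auto simp: image_iff)
    then show ?thesis by simp
  qed
  also have "\<dots> = card ?D + (card ?L + card ?G)"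
  proof -
    have "card (?L \<union> ?G) = card ?L + card ?G"
      by (rule card_Un_disjoint) auto
    moreover have "card (?D \<union> (?L \<union> ?G)) = card ?D + card (?L \<union> ?G)"
      by (rule card_Un_disjoint) auto
    ultimately show ?thesis by simp
  qed
  finally have sq: "CARD('n) * CARD('n) = CARD('n) + 2 * card ?L" using G D by simp
  have R: "?R = (\<lambda>(i, j). Rotation i j) ` ?L" by auto
  have "card ?R = card ?L"
    unfolding R by (rule card_image) (auto simp: inj_on_def)
  then have cR: "card ?R = CARD('n) * (CARD('n) - 1) div 2"
    using sq by (simp add: diff_mult_distrib2)
  have fR: "finite ?R" unfolding R by simp
  have T: "card (range (Translation :: 'n \<Rightarrow> _)) = CARD('n)"
    and V: "card (range (Galilean :: 'n \<Rightarrow> _)) = CARD('n)"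
    by (rule card_image, auto intro: injI)+
  have "card (vfields :: 'n vfield set)
      = card (range (Translation :: 'n \<Rightarrow> _) \<union> range Galilean \<union> ?R) + card {Scaling :: 'n vfield}"
    unfolding vfields_def using fR by (intro card_Un_disjoint) auto
  also have "card (range (Translation :: 'n \<Rightarrow> _) \<union> range Galilean \<union> ?R)
      = card (range (Translation :: 'n \<Rightarrow> _) \<union> range Galilean) + card ?R"
    using fR by (intro card_Un_disjoint) auto
  also have "card (range (Translation :: 'n \<Rightarrow> _) \<union> range Galilean)
      = card (range (Translation :: 'n \<Rightarrow> _)) + card (range (Galilean :: 'n \<Rightarrow> _))"
    by (intro card_Un_disjoint) auto
  finally show ?thesis using cR T V by simp
qed


section \<open>The Vlasov-Poisson system\<close>

definition rho :: "('n::finite phase \<Rightarrow> real) \<Rightarrow> real ^ 'n \<Rightarrow> real" where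
  "rho g x = (\<integral>v. g (x, v) \<partial>lborel)"

text \<open>\<open>c\<^sub>n = - 1 / ((n - 2) |S\<^sup>n\<^sup>-\<^sup>1|)\<close>, with \<open>|S\<^sup>n\<^sup>-\<^sup>1| = n vol(B\<^sup>n)\<close>, so that the Laplacian of \<open>green\<close>
  is the Dirac mass at the origin (for \<open>n \<ge> 3\<close>).\<close>

definition green :: "real ^ 'n::finite \<Rightarrow> real" where
  "green x = (- 1 / ((real CARD('n) - 2) * (real CARD('n) * unit_ball_vol (real CARD('n)))))
     / norm x ^ (CARD('n) - 2)"

definition vp_solution ::
  "real \<Rightarrow> real \<Rightarrow> (real \<Rightarrow> 'n::finite phase \<Rightarrow> real) \<Rightarrow> (real \<Rightarrow> real ^ 'n \<Rightarrow> real) \<Rightarrow> bool" where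
  "vp_solution \<mu> T f \<phi> \<longleftrightarrow>
    (\<forall>t\<in>{0..T}. \<forall>x v. \<exists>ft.
       ((\<lambda>s. f s (x, v)) has_real_derivative ft) (at t within {0..T}) \<and>
       ft + (\<Sum>i\<in>UNIV. v $ i * dx i (f t) (x, v))
          + \<mu> * (\<Sum>i\<in>UNIV. grad (\<phi> t) x $ i * dv i (f t) (x, v)) = 0) \<and>
    (\<forall>t\<in>{0..T}. \<forall>x. laplacian (\<phi> t) x = rho (f t) x) \<and>
    (\<forall>t\<in>{0..T}. \<forall>x. \<phi> t x = (\<integral>y. green (x - y) * rho (f t) y \<partial>lborel))"

text \<open>Regularity in \<open>(x, v)\<close> at a fixed time: \<open>N\<close> continuous derivatives, all of size
  \<open>O((1 + |z|) powr -(2 n + N + 1))\<close>. Since \<open>Z\<^sup>\<alpha>\<close> with \<open>|\<alpha>| \<le> N\<close> has polynomial coefficients of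
  degree at most \<open>N\<close>, this makes \<open>Z\<^sup>\<alpha> g = O((1 + |z|) powr -(2 n + 1))\<close>, which is integrable on the
  \<open>2 n\<close>-dimensional phase space. No uniformity in time is asked for.\<close>

definition regular :: "nat \<Rightarrow> ('n::finite phase \<Rightarrow> real) \<Rightarrow> bool" where
  "regular N g \<longleftrightarrow> Ck N g \<and>
    (\<forall>bs. set bs \<subseteq> Basis \<and> length bs \<le> N \<longrightarrow>
       (\<exists>A. \<forall>z. \<bar>foldr pd bs g z\<bar> * (1 + norm z) ^ (2 * CARD('n) + N + 1) \<le> A))"

end

theory Submission
  imports Defs
begin

text \<open>At a fixed time \<open>t\<close> the estimate is a statement about one density \<open>f\<close> and its potential
\<open>\<phi> = G * \<rho>(f)\<close>, where \<open>G\<close> is the Green's function. Write \<open>n\<close> for the dimension and \<open>E\<close> for the energy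
at time \<open>t\<close>. The proof rests on three facts.

\<^bold>\<open>Commutation\<close> (\<open>Zs_pot\<close>, \<open>Zs_pow_pot\<close>). Every vector field passes through the potential,
\<open>Z (G * \<rho>(g)) = G * \<rho>(Z g + c\<^sub>Z g)\<close>, where \<open>c\<^sub>Z\<close> is \<open>n + 2\<close> for the scaling field and \<open>0\<close>
otherwise: \<open>G\<close> is rotation invariant and homogeneous of degree \<open>2 - n\<close>, and the velocity parts of
the fields integrate to zero or to a multiple of \<open>\<rho>(g)\<close>. Hence \<open>Z\<^sup>\<gamma> \<phi> = G * \<rho>(w)\<close>, where \<open>w\<close> is a
combination of the \<open>Z\<^sup>\<alpha> f\<close> with \<open>|\<alpha>| \<le> |\<gamma>|\<close>. The one derivative left in \<open>\<nabla>Z\<^sup>\<gamma> \<phi>\<close> falls on the kernel, so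
that \<open>|\<nabla>Z\<^sup>\<gamma> \<phi>|(x)\<close> is at most a constant times \<open>\<integral> |x - y| powr (1 - n) \<rho>(|w|)(y) dy\<close>, with
no loss of derivatives.

\<^bold>\<open>Dispersion\<close> (\<open>velocity_average_decay\<close>). The fields \<open>t \<partial>\<^sub>x\<^sub>i + \<partial>\<^sub>v\<^sub>i\<close> commute and have the
flows \<open>(x, v) \<mapsto> (x + t w, v + w)\<close>. The fundamental theorem of calculus in \<open>n\<close> directions bounds
\<open>|g (x, v)|\<close> by \<open>\<integral> |Z\<^sup>\<delta> g| (x + t w, v + w) dw\<close> with \<open>|\<delta>| = n\<close>. Integrating in \<open>v\<close> and substituting
\<open>x + t w\<close> gives \<open>\<rho>(|g|)(x) \<le> t powr (- n) \<parallel>Z\<^sup>\<delta> g\<parallel>\<close> in \<open>L\<^sup>1\<close>; for small \<open>t\<close> the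
translations give the same bound without the factor. Absolute values stay inside the integrals, so \<open>|g|\<close> is never differentiated.

\<^bold>\<open>Riesz potentials\<close> (\<open>riesz_potential_le\<close>). If \<open>B \<ge> 0\<close> has integral at most \<open>a\<close> and is bounded by
\<open>a / R ^ n\<close>, then splitting at \<open>|x - y| = R\<close> gives
\<open>\<integral> |x - y| powr (1 - n) B(y) dy \<le> C a / R ^ (n - 1)\<close>. This is used with \<open>R = 1 + t\<close>.

By Tonelli the left-hand side is bounded by the symmetric expression
\<open>\<integral>\<integral> A(x) |x - y| powr (1 - n) B(y) dx dy\<close> with \<open>A = \<rho>(|Z\<^sup>\<beta> f|)\<close> and \<open>B = \<rho>(|w|)\<close>. Since
\<open>|\<gamma>| + |\<beta>| \<le> N + 1\<close> and \<open>2 n \<le> N\<close>, one of the two orders is at most \<open>N - n\<close>, so dispersion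
applies to that factor; the other is only integrated. This yields a multiple of
\<open>E\<^sup>2 / (1 + t) ^ (n - 1)\<close> (\<open>L1norm_product_le_energy_squared\<close>), and one factor \<open>E\<close> is at most
\<open>2 \<epsilon>\<close>.\<close>

section \<open>Differentiation of parameter integrals\<close>

text \<open>Dominated differentiation is too weak for translates of a singular kernel, whose difference
quotients have no common integrable majorant. Instead \<open>F s - F (-1)\<close> is written as the integral
of \<open>F'\<close> over \<open>{-1..s}\<close> for almost every \<open>y\<close> and the two integrations are exchanged; this needs only
a uniform \<open>L\<^sup>1\<close> bound on \<open>F'\<close> and the continuity of its integral in the parameter.\<close>

lemma has_real_derivative_parameter_integral:
  fixes F F' :: "real \<Rightarrow> 'b::euclidean_space \<Rightarrow> real"
  assumes F: "\<And>s. s \<in> {-1..1} \<Longrightarrow> integrable lborel (F s)"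
    and meas: "(\<lambda>(r, y). F' r y) \<in> borel_measurable borel"
    and bound: "\<And>r. r \<in> {-1..1} \<Longrightarrow> (\<integral>\<^sup>+y. ennreal \<bar>F' r y\<bar> \<partial>lborel) \<le> ennreal B"
    and deriv: "AE y in lborel. \<forall>r\<in>{-1..1}. ((\<lambda>r. F r y) has_real_derivative F' r y) (at r within {-1..1})"
    and cF': "AE y in lborel. continuous_on {-1..1} (\<lambda>r. F' r y)"
    and cont: "continuous_on {-1..1} (\<lambda>r. \<integral>y. F' r y \<partial>lborel)"
  shows "((\<lambda>s. \<integral>y. F s y \<partial>lborel) has_real_derivative (\<integral>y. F' 0 y \<partial>lborel)) (at 0)"
proof -
  define H where "H = (\<lambda>r. \<integral>y. F' r y \<partial>lborel)"
  have meas': "(\<lambda>(r, y). F' r y) \<in> borel_measurable (lborel \<Otimes>\<^sub>M lborel)"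
    unfolding lborel_prod using meas by simp
  have eq: "(\<integral>y. F s y \<partial>lborel) = (\<integral>y. F (-1) y \<partial>lborel) + integral {-1..s} H" if s: "s \<in> {-1..1}" for s
  proof -
    have cH: "continuous_on {-1..s} H"
      using cont s unfolding H_def by (auto intro: continuous_on_subset)
    let ?f = "\<lambda>r y. indicator {-1..s} r * F' r y"
    have fm: "(\<lambda>(r, y). ?f r y) \<in> borel_measurable (lborel \<Otimes>\<^sub>M lborel)"
      unfolding split_beta'
      using meas'[unfolded split_beta'] by measurable
    have "(\<integral>\<^sup>+p. ennreal (norm ((\<lambda>(r, y). ?f r y) p)) \<partial>(lborel \<Otimes>\<^sub>M lborel)) =
        (\<integral>\<^sup>+r. \<integral>\<^sup>+y. ennreal (norm (?f r y)) \<partial>lborel \<partial>lborel)"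
      using fm by (subst lborel.nn_integral_fst[symmetric]) auto
    also have "\<dots> \<le> (\<integral>\<^sup>+r. ennreal B * indicator {-1..s} r \<partial>lborel)"
    proof (rule nn_integral_mono)
      fix r :: real
      show "(\<integral>\<^sup>+y. ennreal (norm (?f r y)) \<partial>lborel) \<le> ennreal B * indicator {-1..s} r"
        using bound[of r] s by (cases "r \<in> {-1..s}") auto
    qed
    also have "\<dots> < \<infinity>"
      using s by (subst nn_integral_cmult) (auto simp: ennreal_mult_less_top)
    finally have fin: "(\<integral>\<^sup>+p. ennreal (norm ((\<lambda>(r, y). ?f r y) p)) \<partial>(lborel \<Otimes>\<^sub>M lborel)) < \<infinity>" .
    have int: "integrable (lborel \<Otimes>\<^sub>M lborel) (\<lambda>(r, y). ?f r y)"
      by (rule integrableI_bounded[OF fm fin])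
    have "(\<integral>y. F s y - F (-1) y \<partial>lborel) = (\<integral>y. \<integral>r. ?f r y \<partial>lborel \<partial>lborel)"
    proof (rule integral_cong_AE)
      show "(\<lambda>y. F s y - F (-1) y) \<in> borel_measurable lborel"
        using F[OF s] F[of "-1"] by auto
      have "(\<lambda>(y, r). ?f r y) \<in> borel_measurable (lborel \<Otimes>\<^sub>M lborel)"
        using measurable_compose[OF measurable_pair_swap' fm]
        by (simp add: split_beta')
      then show "(\<lambda>y. \<integral>r. ?f r y \<partial>lborel) \<in> borel_measurable lborel"
        by (rule lborel.borel_measurable_lebesgue_integral)
      show "AE y in lborel. F s y - F (-1) y = (\<integral>r. ?f r y \<partial>lborel)"
        using deriv cF'
      proof eventually_elim
        case (elim y)
        have "(\<integral>r. indicator {-1..s} r *\<^sub>R F' r y \<partial>lborel) = F s y - F (-1) y"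
        proof (rule integral_FTC_Icc)
          show "-1 \<le> s" using s by simp
          show "continuous_on {-1..s} (\<lambda>r. F' r y)"
            using elim(2) s by (auto intro: continuous_on_subset)
          fix r assume "-1 \<le> r" "r \<le> s"
          then have "((\<lambda>r. F r y) has_real_derivative F' r y) (at r within {-1..s})"
            using elim(1) s by (auto intro!: DERIV_subset[of _ _ r "{-1..1}" "{-1..s}"])
          then show "((\<lambda>r. F r y) has_vector_derivative F' r y) (at r within {-1..s})"
            by (simp add: has_real_derivative_iff_has_vector_derivative)
        qed
        then show ?case by simp
      qed
    qed
    also have "\<dots> = (\<integral>r. \<integral>y. ?f r y \<partial>lborel \<partial>lborel)"
      by (rule lborel_pair.Fubini_integral[OF int])
    also have "\<dots> = (\<integral>r. indicator {-1..s} r *\<^sub>R H r \<partial>lborel)"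
      by (simp add: H_def)
    also have "\<dots> = integral {-1..s} H"
      using set_borel_integral_eq_integral(2)[OF borel_integrable_atLeastAtMost'[OF cH]]
      by (simp add: set_lebesgue_integral_def)
    finally show ?thesis
      using F[OF s] F[of "-1"] by simp
  qed
  have "((\<lambda>s. (\<integral>y. F (-1) y \<partial>lborel) + integral {-1..s} H) has_real_derivative 0 + H 0) (at 0 within {-1..1})"
    using cont by (intro DERIV_add DERIV_const integral_has_real_derivative) (auto simp: H_def)
  then have "((\<lambda>s. (\<integral>y. F (-1) y \<partial>lborel) + integral {-1..s} H) has_real_derivative H 0) (at 0)"
    by (subst (asm) at_within_interior) auto
  then have "((\<lambda>s. \<integral>y. F s y \<partial>lborel) has_real_derivative H 0) (at 0)"
  proof (rule has_field_derivative_transform_within[where d = 1])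
    fix s :: real assume "dist s 0 < 1"
    then show "(\<integral>y. F (-1) y \<partial>lborel) + integral {-1..s} H = (\<integral>y. F s y \<partial>lborel)"
      by (intro eq[symmetric]) (auto simp: dist_real_def)
  qed auto
  then show ?thesis
    by (simp add: H_def)
qed

lemma continuous_on_parameter_integral:
  fixes F :: "'a::first_countable_topology \<Rightarrow> 'b::euclidean_space \<Rightarrow> real"
  assumes "\<And>x. x \<in> S \<Longrightarrow> F x \<in> borel_measurable borel" "integrable lborel D"
    and "\<And>x y. x \<in> S \<Longrightarrow> \<bar>F x y\<bar> \<le> D y" "\<And>y. continuous_on S (\<lambda>x. F x y)"
  shows "continuous_on S (\<lambda>x. \<integral>y. F x y \<partial>lborel)"
  unfolding continuous_on_def
proof
  fix x assume x: "x \<in> S"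
  show "((\<lambda>x. \<integral>y. F x y \<partial>lborel) \<longlongrightarrow> (\<integral>y. F x y \<partial>lborel)) (at x within S)"
  proof (rule tendsto_at_iff_sequentially[THEN iffD2], intro allI impI, unfold comp_def)
    fix X :: "nat \<Rightarrow> 'a" assume X: "\<forall>i. X i \<in> S - {x}" "X \<longlonglongrightarrow> x"
    show "(\<lambda>i. \<integral>y. F (X i) y \<partial>lborel) \<longlonglongrightarrow> (\<integral>y. F x y \<partial>lborel)"
    proof (rule integral_dominated_convergence[where w = D])
      show "AE y in lborel. (\<lambda>i. F (X i) y) \<longlonglongrightarrow> F x y"
        using X x assms(4) by (intro AE_I2 continuous_on_tendsto_compose[OF assms(4)]) auto
    qed (use X x assms in auto)
  qed
qed

lemma has_real_derivative_parameter_integral_dominated: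
  fixes F F' :: "real \<Rightarrow> 'b::euclidean_space \<Rightarrow> real"
  assumes F: "\<And>s. s \<in> {-1..1} \<Longrightarrow> integrable lborel (F s)"
    and meas: "(\<lambda>(r, y). F' r y) \<in> borel_measurable borel"
    and D: "integrable lborel D" and dom: "\<And>r y. r \<in> {-1..1} \<Longrightarrow> \<bar>F' r y\<bar> \<le> D y"
    and deriv: "\<And>r y. ((\<lambda>r. F r y) has_real_derivative F' r y) (at r)"
    and cF': "\<And>y. continuous_on UNIV (\<lambda>r. F' r y)"
  shows "((\<lambda>s. \<integral>y. F s y \<partial>lborel) has_real_derivative (\<integral>y. F' 0 y \<partial>lborel)) (at 0)"
proof (rule has_real_derivative_parameter_integral[OF F meas])
  have m[measurable]: "F' r \<in> borel_measurable borel" for r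
    using measurable_compose[OF measurable_Pair1' meas[folded borel_prod], of r] by simp
  fix r :: real assume r: "r \<in> {-1..1}"
  have "(\<integral>\<^sup>+y. ennreal \<bar>F' r y\<bar> \<partial>lborel) \<le> (\<integral>\<^sup>+y. ennreal \<bar>D y\<bar> \<partial>lborel)"

    by (intro nn_integral_mono ennreal_leI) (use dom[OF r] abs_ge_self order_trans in blast)
  also have "\<dots> = ennreal (\<integral>y. \<bar>D y\<bar> \<partial>lborel)"
    using D by (intro nn_integral_eq_integral) auto
  finally show "(\<integral>\<^sup>+y. ennreal \<bar>F' r y\<bar> \<partial>lborel) \<le> ennreal (\<integral>y. \<bar>D y\<bar> \<partial>lborel)" .
next
  have m: "F' r \<in> borel_measurable borel" for r
    using measurable_compose[OF measurable_Pair1' meas[folded borel_prod], of r] by simp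
  show "continuous_on {-1..1} (\<lambda>r. \<integral>y. F' r y \<partial>lborel)"
    by (rule continuous_on_parameter_integral[OF m D dom continuous_on_subset[OF cF']]) auto
  show "AE y in lborel. continuous_on {-1..1} (\<lambda>r. F' r y)"
    using cF' by (intro AE_I2 continuous_on_subset[OF cF']) auto
qed (use deriv in \<open>auto intro: has_field_derivative_at_within\<close>)

section \<open>Radial integrals\<close>

text \<open>Radial integrals without polar coordinates: a majorant of \<open>p\<close> of the form
\<open>\<integral> r \<ge> |z|. h r\<close> is integrated over \<open>z\<close> first, which produces the volume of a ball of radius \<open>r\<close>.\<close>

lemma nn_integral_layer_cake:
  fixes p :: "'a::euclidean_space \<Rightarrow> ennreal" and h :: "real \<Rightarrow> ennreal"
  assumes [measurable]: "h \<in> borel_measurable borel"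
    and le: "\<And>z. p z \<le> (\<integral>\<^sup>+r. h r * indicator {norm z..} r \<partial>lborel)"
  shows "(\<integral>\<^sup>+z. p z \<partial>(lborel :: 'a measure)) \<le>
    ennreal (unit_ball_vol (real DIM('a))) * (\<integral>\<^sup>+r. h r * ennreal (r ^ DIM('a)) * indicator {0..} r \<partial>lborel)"
proof -
  have "(\<integral>\<^sup>+z. p z \<partial>(lborel :: 'a measure)) \<le>
      (\<integral>\<^sup>+z. \<integral>\<^sup>+r. h r * indicator {norm z..} r \<partial>lborel \<partial>(lborel :: 'a measure))"
    by (intro nn_integral_mono le)
  also have "\<dots> = (\<integral>\<^sup>+z. \<integral>\<^sup>+r. h r * indicator {q. norm (fst q) \<le> snd q} (z, r) \<partial>lborel \<partial>(lborel :: 'a measure))"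
    by (intro nn_integral_cong) (auto simp: indicator_def)
  also have "\<dots> = (\<integral>\<^sup>+r. \<integral>\<^sup>+z. h r * indicator {q. norm (fst q) \<le> snd q} (z, r) \<partial>(lborel :: 'a measure) \<partial>lborel)"
  proof (rule lborel_pair.Fubini'[symmetric])
    have "closed {q :: 'a \<times> real. norm (fst q) \<le> snd q}"
      by (intro closed_Collect_le continuous_intros)
    then have [measurable]: "{q :: 'a \<times> real. norm (fst q) \<le> snd q} \<in> sets (lborel \<Otimes>\<^sub>M lborel)"
      unfolding lborel_prod by simp
    show "(\<lambda>(z, r). h r * indicator {q. norm (fst q) \<le> snd q} (z, r)) \<in> borel_measurable ((lborel :: 'a measure) \<Otimes>\<^sub>M lborel)"
      by measurable
  qed
  also have "\<dots> = (\<integral>\<^sup>+r. h r * emeasure lborel (cball (0::'a) r) \<partial>lborel)"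
  proof (rule nn_integral_cong)
    fix r :: real
    have "(\<integral>\<^sup>+z. h r * indicator {q. norm (fst q) \<le> snd q} (z, r) \<partial>(lborel :: 'a measure)) =
      (\<integral>\<^sup>+z. h r * indicator (cball 0 r) z \<partial>(lborel :: 'a measure))"
      by (intro nn_integral_cong) (auto simp: indicator_def)
    then show "(\<integral>\<^sup>+z. h r * indicator {q. norm (fst q) \<le> snd q} (z, r) \<partial>(lborel :: 'a measure)) = h r * emeasure lborel (cball (0::'a) r)"
      by (simp add: nn_integral_cmult_indicator)
  qed
  also have "\<dots> = (\<integral>\<^sup>+r. ennreal (unit_ball_vol (real DIM('a))) * (h r * ennreal (r ^ DIM('a)) * indicator {0..} r) \<partial>lborel)"
    by (intro nn_integral_cong)
       (auto simp: emeasure_cball indicator_def ennreal_mult' unit_ball_vol_nonneg mult_ac cball_empty not_le)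
  finally show ?thesis
    by (simp add: nn_integral_cmult)
qed

lemma inverse_le_divide:
  fixes a b c :: real
  assumes "a \<le> c * b" "0 < a" "0 < b"
  shows "1 / b \<le> c / a"
  using assms by (simp add: field_simps)

lemma nn_integral_ge_const_Icc:
  fixes h :: "real \<Rightarrow> ennreal"
  assumes "a \<le> b" "\<And>r. r \<in> {a..b} \<Longrightarrow> ennreal c \<le> h r" "0 \<le> c" "a' \<le> a"
  shows "ennreal (c * (b - a)) \<le> (\<integral>\<^sup>+r. h r * indicator {a'..} r \<partial>lborel)"
proof -
  have "ennreal (c * (b - a)) = (\<integral>\<^sup>+r. ennreal c * indicator {a..b} r \<partial>lborel)"
    using assms by (simp add: nn_integral_cmult_indicator ennreal_mult)
  also have "\<dots> \<le> (\<integral>\<^sup>+r. h r * indicator {a'..} r \<partial>lborel)"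
    using assms by (intro nn_integral_mono) (auto simp: indicator_def)
  finally show ?thesis .
qed

text \<open>The layer-cake majorant comes from averaging \<open>r ^ -n\<close> over \<open>|z| \<le> r \<le> 2 |z|\<close>, which is at least
\<open>2 ^ -n |z| ^ (1 - n)\<close>; the resulting integrand \<open>r ^ -n r ^ n\<close> is constant on \<open>{0<..2 R}\<close>.\<close>

lemma nn_integral_riesz_kernel_cball:
  assumes n: "2 \<le> DIM('a::euclidean_space)" and R: "0 \<le> R"
  shows "(\<integral>\<^sup>+z. ennreal (1 / norm z ^ (DIM('a) - 1)) * indicator (cball 0 R) z \<partial>(lborel :: 'a measure))
    \<le> ennreal (2 ^ (DIM('a) + 1) * unit_ball_vol (real DIM('a)) * R)"
proof -
  let ?n = "DIM('a)"
  let ?h = "\<lambda>r::real. ennreal (2 ^ ?n / r ^ ?n) * indicator {0<..2 * R} r"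
  have "ennreal (1 / norm z ^ (?n - 1)) * indicator (cball 0 R) z \<le> (\<integral>\<^sup>+r. ?h r * indicator {norm z..} r \<partial>lborel)"
    for z :: 'a
  proof (cases "z = 0 \<or> R < norm z")
    case True
    then show ?thesis using n by (auto simp: power_0_left)
  next
    case False
    have "ennreal (1 / norm z ^ ?n * (2 * norm z - norm z)) \<le> (\<integral>\<^sup>+r. ?h r * indicator {norm z..} r \<partial>lborel)"
    proof (rule nn_integral_ge_const_Icc)
      fix r assume r: "r \<in> {norm z..2 * norm z}"
      have rp: "0 < r"
        using r False by (auto intro: less_le_trans[of 0 "norm z"])
      have "r ^ ?n \<le> (2 * norm z) ^ ?n"
        using r rp by (intro power_mono) auto
      then have "1 / norm z ^ ?n \<le> 2 ^ ?n / r ^ ?n"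
        using rp False by (simp add: field_simps power_mult_distrib)
      then show "ennreal (1 / norm z ^ ?n) \<le> ?h r"
        using r False rp by (auto simp: indicator_def intro!: ennreal_leI)
    qed auto
    also have "1 / norm z ^ ?n * (2 * norm z - norm z) = 1 / norm z ^ (?n - 1)"
      using False n by (simp add: power_eq_if)
    finally show ?thesis
      using False by simp
  qed
  then have "(\<integral>\<^sup>+z. ennreal (1 / norm z ^ (?n - 1)) * indicator (cball 0 R) z \<partial>(lborel :: 'a measure))
    \<le> ennreal (unit_ball_vol (real ?n)) * (\<integral>\<^sup>+r. ?h r * ennreal (r ^ ?n) * indicator {0..} r \<partial>lborel)"
    by (intro nn_integral_layer_cake) auto
  also have "(\<integral>\<^sup>+r. ?h r * ennreal (r ^ ?n) * indicator {0..} r \<partial>lborel) =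
     (\<integral>\<^sup>+r. ennreal (2 ^ ?n) * indicator {0<..2 * R} r \<partial>lborel)"
    by (intro nn_integral_cong) (auto simp: indicator_def ennreal_mult[symmetric])
  also have "\<dots> = ennreal (2 ^ ?n * (2 * R))"
    using R by (subst nn_integral_cmult_indicator) (auto simp: ennreal_mult)
  also have "ennreal (unit_ball_vol (real ?n)) * ennreal (2 ^ ?n * (2 * R)) =
     ennreal (2 ^ (?n + 1) * unit_ball_vol (real ?n) * R)"
    using R by (subst ennreal_mult[symmetric]) (auto simp: mult_ac)
  finally show ?thesis .
qed

text \<open>The same averaging, now over \<open>|z| \<le> r \<le> 1 + 2 |z|\<close>.\<close>

lemma integrable_inverse_power_norm:
  "integrable lborel (\<lambda>z :: 'a::euclidean_space. 1 / (1 + norm z) ^ (DIM('a) + 1))"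
proof (rule integrableI_bounded)
  let ?n = "DIM('a)"
  let ?h = "\<lambda>r::real. ennreal (2 ^ (?n + 2) / (1 + r) ^ (?n + 2))"
  have "ennreal (1 / (1 + norm z) ^ (?n + 1)) \<le> (\<integral>\<^sup>+r. ?h r * indicator {norm z..} r \<partial>lborel)"
    for z :: 'a
  proof -
    have "ennreal (1 / (1 + norm z) ^ (?n + 2) * (1 + 2 * norm z - norm z)) \<le> (\<integral>\<^sup>+r. ?h r * indicator {norm z..} r \<partial>lborel)"
    proof (rule nn_integral_ge_const_Icc)
      fix r assume r: "r \<in> {norm z..1 + 2 * norm z}"
      have rp: "0 \<le> r"
        using r by (auto intro: order_trans[of 0 "norm z"])
      have "(1 + r) ^ (?n + 2) \<le> (2 * (1 + norm z)) ^ (?n + 2)"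
        using r rp by (intro power_mono) auto
      then have "(1 + r) ^ (?n + 2) \<le> 2 ^ (?n + 2) * (1 + norm z) ^ (?n + 2)"
        by (simp only: power_mult_distrib)
      moreover have "0 < (1 + norm z) ^ (?n + 2)" "0 < (1 + r) ^ (?n + 2)"
        using rp by (auto intro!: zero_less_power simp: add_pos_nonneg simp del: power_Suc)
      ultimately have "1 / (1 + norm z) ^ (?n + 2) \<le> 2 ^ (?n + 2) / (1 + r) ^ (?n + 2)"
        by (intro inverse_le_divide) auto
      then show "ennreal (1 / (1 + norm z) ^ (?n + 2)) \<le> ?h r"
        by (rule ennreal_leI)
    qed auto
    also have "1 / (1 + norm z) ^ (?n + 2) * (1 + 2 * norm z - norm z) = 1 / (1 + norm z) ^ (?n + 1)"
    proof -
      have "1 + norm z \<noteq> 0" by (smt (verit) norm_ge_zero)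
      then have "1 / (1 + norm z) ^ (?n + 2) * (1 + norm z) = 1 / (1 + norm z) ^ (?n + 1)"
        by simp
      moreover have "1 + 2 * norm z - norm z = 1 + norm z" by simp
      ultimately show ?thesis by (simp only:)
    qed
    finally show ?thesis .
  qed
  then have "(\<integral>\<^sup>+z. ennreal (1 / (1 + norm z) ^ (?n + 1)) \<partial>(lborel :: 'a measure))
    \<le> ennreal (unit_ball_vol (real ?n)) * (\<integral>\<^sup>+r. ?h r * ennreal (r ^ ?n) * indicator {0..} r \<partial>lborel)"
    by (intro nn_integral_layer_cake) auto
  also have "(\<integral>\<^sup>+r. ?h r * ennreal (r ^ ?n) * indicator {0..} r \<partial>lborel) \<le>
     (\<integral>\<^sup>+r. ennreal (2 ^ (?n + 2) / (1 + r)\<^sup>2) * indicator {0..} r \<partial>lborel)"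
  proof (intro nn_integral_mono)
    fix r :: real
    have "2 ^ (?n + 2) / (1 + r) ^ (?n + 2) * r ^ ?n \<le> 2 ^ (?n + 2) / (1 + r)\<^sup>2" if "0 \<le> r"
    proof -
      have "r ^ ?n \<le> (1 + r) ^ ?n"
        using that by (intro power_mono) auto
      then have "r ^ ?n / (1 + r) ^ ?n \<le> 1"
        using that by (auto simp: divide_le_eq_1)
      moreover have "2 ^ (?n + 2) / (1 + r) ^ (?n + 2) * r ^ ?n = 2 ^ (?n + 2) / (1 + r)\<^sup>2 * (r ^ ?n / (1 + r) ^ ?n)"
        by (simp add: power_add power2_eq_square)
      ultimately show ?thesis
        using that by (simp only:) (intro mult_left_le, auto)
    qed
    then show "?h r * ennreal (r ^ ?n) * indicator {0..} r \<le> ennreal (2 ^ (?n + 2) / (1 + r)\<^sup>2) * indicator {0..} r"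
      by (auto simp: indicator_def ennreal_mult[symmetric] intro!: ennreal_leI)
  qed
  also have "\<dots> = ennreal (0 - (- (2 ^ (?n + 2)) / (1 + 0)))"
  proof (rule nn_integral_FTC_atLeast)
    show "((\<lambda>r::real. - (2 ^ (?n + 2)) / (1 + r)) \<longlongrightarrow> 0) at_top"
      by (intro tendsto_divide_0[OF tendsto_const] filterlim_at_top_imp_at_infinity
          filterlim_tendsto_add_at_top[OF tendsto_const] filterlim_ident)
    fix r :: real assume "0 \<le> r"
    then show "((\<lambda>r::real. - (2 ^ (?n + 2)) / (1 + r)) has_real_derivative 2 ^ (?n + 2) / (1 + r)\<^sup>2) (at r)"
      by (auto intro!: derivative_eq_intros simp: power2_eq_square)
  qed auto
  finally have "(\<integral>\<^sup>+z. ennreal (1 / (1 + norm z) ^ (?n + 1)) \<partial>(lborel :: 'a measure))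
    \<le> ennreal (unit_ball_vol (real ?n)) * ennreal (0 - (- (2 ^ (?n + 2)) / (1 + 0)))"
    by (simp add: mult_left_mono)
  also have "\<dots> < \<infinity>"
    by (simp add: ennreal_mult_less_top)
  also have "(\<integral>\<^sup>+z. ennreal (1 / (1 + norm z) ^ (?n + 1)) \<partial>(lborel :: 'a measure)) =
     (\<integral>\<^sup>+z. ennreal (norm (1 / (1 + norm z) ^ (?n + 1))) \<partial>(lborel :: 'a measure))"
    by (intro nn_integral_cong arg_cong[of _ _ ennreal]) (simp add: add_nonneg_nonneg)
  finally show "(\<integral>\<^sup>+z. ennreal (norm (1 / (1 + norm z) ^ (?n + 1))) \<partial>(lborel :: 'a measure)) < \<infinity>" .
qed auto

text \<open>The product of the kernel bound \<open>(1 + |z|)\<^sup>2 / |z| ^ (n - 1)\<close> with the decay \<open>(1 + |z|) ^ -n\<close> of a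
velocity average. At infinity it is of order \<open>|z| ^ (3 - 2 n)\<close>, which is integrable because
\<open>2 n - 3 \<ge> n + 1\<close> exactly when \<open>n \<ge> 4\<close>.\<close>

lemma integrable_riesz_weight:
  assumes n: "4 \<le> DIM('a::euclidean_space)"
  shows "integrable lborel (\<lambda>z :: 'a. 1 / (norm z ^ (DIM('a) - 1) * (1 + norm z) ^ (DIM('a) - 2)))"
proof (rule Bochner_Integration.integrable_bound)
  let ?n = "DIM('a)"
  let ?k = "\<lambda>z :: 'a. 1 / norm z ^ (?n - 1)"
  have "(\<integral>\<^sup>+z. ennreal (?k z) * indicator (cball 0 1) z \<partial>(lborel :: 'a measure)) < \<infinity>"
    using nn_integral_riesz_kernel_cball[of 1, where 'a = 'a] n by (auto intro: le_less_trans)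
  also have "(\<integral>\<^sup>+z. ennreal (?k z) * indicator (cball 0 1) z \<partial>(lborel :: 'a measure)) =
    (\<integral>\<^sup>+z. ennreal (norm (?k z * indicator (cball 0 1) z)) \<partial>(lborel :: 'a measure))"
    by (intro nn_integral_cong) (auto simp: indicator_def)
  finally have "integrable lborel (\<lambda>z :: 'a. ?k z * indicator (cball 0 1) z)"
    by (intro integrableI_bounded borel_measurable_times borel_measurable_indicator) auto
  then show "integrable lborel (\<lambda>z :: 'a. ?k z * indicator (cball 0 1) z + 2 ^ (?n - 1) * (1 / (1 + norm z) ^ (?n + 1)))"
    by (intro Bochner_Integration.integrable_add integrable_mult_right integrable_inverse_power_norm)
  show "AE z in lborel. norm (1 / (norm z ^ (?n - 1) * (1 + norm z) ^ (?n - 2))) \<le>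
      norm (?k z * indicator (cball 0 1) z + 2 ^ (?n - 1) * (1 / (1 + norm z) ^ (?n + 1)))"
  proof (intro AE_I2)
    fix z :: 'a
    let ?s = "1 + norm z"
    have s: "1 \<le> ?s" by simp
    have "1 / (norm z ^ (?n - 1) * ?s ^ (?n - 2)) \<le> ?k z * indicator (cball 0 1) z + 2 ^ (?n - 1) * (1 / ?s ^ (?n + 1))"
    proof (cases "norm z \<le> 1")
      case True
      have "1 \<le> ?s ^ (?n - 2)" using s by (rule one_le_power)
      then have "?k z / ?s ^ (?n - 2) \<le> ?k z / 1"
        by (intro divide_left_mono mult_pos_pos zero_less_power) (auto simp: add_pos_nonneg)
      then show ?thesis using True s by (simp add: add_nonneg_nonneg add_increasing2)
    next
      case False
      have "?s ^ (?n - 1) \<le> (2 * norm z) ^ (?n - 1)"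
        using False by (intro power_mono) auto
      then have k: "?k z \<le> 2 ^ (?n - 1) / ?s ^ (?n - 1)"
        using False s by (intro inverse_le_divide) (auto simp: power_mult_distrib intro!: zero_less_power)
      have "1 / (norm z ^ (?n - 1) * ?s ^ (?n - 2)) = ?k z * (1 / ?s ^ (?n - 2))" by simp
      also have "\<dots> \<le> 2 ^ (?n - 1) / ?s ^ (?n - 1) * (1 / ?s ^ (?n - 2))"
        using k s by (intro mult_right_mono) auto
      also have "\<dots> = 2 ^ (?n - 1) * (1 / ?s ^ ((?n - 1) + (?n - 2)))"
        by (subst power_add) simp
      also have "\<dots> \<le> 2 ^ (?n - 1) * (1 / ?s ^ (?n + 1))"
        using n by (intro mult_left_mono divide_left_mono power_increasing mult_pos_pos zero_less_power)
          (auto simp: add_pos_nonneg)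
      finally show ?thesis using False by simp
    qed
    then show "norm (1 / (norm z ^ (?n - 1) * ?s ^ (?n - 2))) \<le>
      norm (?k z * indicator (cball 0 1) z + 2 ^ (?n - 1) * (1 / ?s ^ (?n + 1)))"
      using s by (simp add: add_nonneg_nonneg)
  qed
qed auto

section \<open>Differentiable functions with polynomial decay\<close>

definition decay :: "nat \<Rightarrow> ('a::real_normed_vector \<Rightarrow> real) \<Rightarrow> bool" where
  "decay m g \<longleftrightarrow> (\<exists>A. \<forall>z. \<bar>g z\<bar> * (1 + norm z) ^ m \<le> A)"

text \<open>The recursion on the order of differentiability absorbs the quantification over lists of basis
vectors in \<open>regular\<close>. The decay exponent is a separate parameter: multiplication by a coordinate
costs one power of decay, a derivative costs one order.\<close>

fun Ck_decay :: "nat \<Rightarrow> nat \<Rightarrow> ('a::euclidean_space \<Rightarrow> real) \<Rightarrow> bool" where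
  "Ck_decay 0 m g \<longleftrightarrow> continuous_on UNIV g \<and> decay m g"
| "Ck_decay (Suc k) m g \<longleftrightarrow>
    (\<forall>z. g differentiable (at z)) \<and> decay m g \<and> (\<forall>b\<in>Basis. Ck_decay k m (pd b g))"

lemma decay_mono:
  assumes "decay m g" "m' \<le> m"
  shows "decay m' g"
proof -
  obtain A where A: "\<And>z. \<bar>g z\<bar> * (1 + norm z) ^ m \<le> A"
    using assms(1) by (auto simp: decay_def)
  have "\<bar>g z\<bar> * (1 + norm z) ^ m' \<le> A" for z
    by (rule order_trans[OF mult_left_mono[OF power_increasing[OF assms(2)]] A]) auto
  then show ?thesis by (auto simp: decay_def)
qed

lemma decay_add:
  assumes "decay m g" "decay m h"
  shows "decay m (\<lambda>z. g z + h z)"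
proof -
  obtain A B where A: "\<And>z. \<bar>g z\<bar> * (1 + norm z) ^ m \<le> A" and B: "\<And>z. \<bar>h z\<bar> * (1 + norm z) ^ m \<le> B"
    using assms by (auto simp: decay_def)
  have "\<bar>g z + h z\<bar> * (1 + norm z) ^ m \<le> A + B" for z
  proof -
    have "\<bar>g z + h z\<bar> * (1 + norm z) ^ m \<le> (\<bar>g z\<bar> + \<bar>h z\<bar>) * (1 + norm z) ^ m"
      by (intro mult_right_mono) (auto simp: add_nonneg_nonneg)
    then show ?thesis using A[of z] B[of z] by (simp add: distrib_right)
  qed
  then show ?thesis by (auto simp: decay_def)
qed

lemma decay_cmult:
  assumes "decay m g"
  shows "decay m (\<lambda>z. c * g z)"
proof -
  obtain A where A: "\<And>z. \<bar>g z\<bar> * (1 + norm z) ^ m \<le> A"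
    using assms by (auto simp: decay_def)
  have "\<bar>c * g z\<bar> * (1 + norm z) ^ m \<le> \<bar>c\<bar> * A" for z
    using mult_left_mono[OF A[of z], of "\<bar>c\<bar>"] by (simp add: abs_mult mult_ac)
  then show ?thesis by (auto simp: decay_def)
qed

lemma decay_inner_mult:
  fixes b :: "'a::euclidean_space"
  assumes "decay (Suc m) g" "norm b = 1"
  shows "decay m (\<lambda>z. (z \<bullet> b) * g z)"
proof -
  obtain A where A: "\<And>z. \<bar>g z\<bar> * (1 + norm z) ^ Suc m \<le> A"
    using assms by (auto simp: decay_def)
  have "\<bar>(z \<bullet> b) * g z\<bar> * (1 + norm z) ^ m \<le> A" for z
  proof -
    have "\<bar>z \<bullet> b\<bar> \<le> 1 + norm z"
      using Cauchy_Schwarz_ineq2[of z b] assms(2) by simp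
    then have "\<bar>z \<bullet> b\<bar> * (\<bar>g z\<bar> * (1 + norm z) ^ m) \<le> (1 + norm z) * (\<bar>g z\<bar> * (1 + norm z) ^ m)"
      by (intro mult_right_mono) auto
    then show ?thesis using A[of z] by (simp add: abs_mult mult_ac)
  qed
  then show ?thesis by (auto simp: decay_def)
qed

lemma pd_line_derivative:
  fixes g :: "'a::euclidean_space \<Rightarrow> real"
  assumes "\<And>z. g differentiable (at z)"
  shows "((\<lambda>s. g (z + s *\<^sub>R b)) has_real_derivative pd b g (z + s *\<^sub>R b)) (at s)"
    and "pd b g z = frechet_derivative g (at z) b"
proof -
  have *: "((\<lambda>r. g (w + r *\<^sub>R b)) has_real_derivative frechet_derivative g (at (w + s *\<^sub>R b)) b) (at s)" for w s
  proof -
    have d: "(g has_derivative frechet_derivative g (at (w + s *\<^sub>R b))) (at (w + s *\<^sub>R b))"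
      using assms frechet_derivative_works by blast
    have "((\<lambda>r. w + r *\<^sub>R b) has_derivative (\<lambda>r. r *\<^sub>R b)) (at s)"
      by (auto intro!: derivative_eq_intros)
    from diff_chain_at[OF this d]
    have "((\<lambda>r. g (w + r *\<^sub>R b)) has_derivative (\<lambda>r. frechet_derivative g (at (w + s *\<^sub>R b)) (r *\<^sub>R b))) (at s)"
      by (simp add: o_def)
    moreover have "(\<lambda>r. frechet_derivative g (at (w + s *\<^sub>R b)) (r *\<^sub>R b)) = (*) (frechet_derivative g (at (w + s *\<^sub>R b)) b)"
      using linear_frechet_derivative[OF assms] by (auto simp: linear_cmul)
    ultimately show ?thesis by (simp add: has_field_derivative_def)
  qed
  show 2: "pd b g z = frechet_derivative g (at z) b" for z
    using DERIV_imp_deriv[OF *[of z 0]] by (simp add: pd_def)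
  show "((\<lambda>s. g (z + s *\<^sub>R b)) has_real_derivative pd b g (z + s *\<^sub>R b)) (at s)"
    using *[of z s] by (simp add: 2)
qed

lemma pd_linear_direction:
  fixes g :: "'a::euclidean_space \<Rightarrow> real"
  assumes "\<And>z. g differentiable (at z)"
  shows "pd (a *\<^sub>R b + c) g z = a * pd b g z + pd c g z"
  using linear_frechet_derivative[OF assms]
  by (simp add: pd_line_derivative(2)[OF assms] linear_add linear_cmul)

lemma pd_add:
  fixes g h :: "'a::euclidean_space \<Rightarrow> real"
  assumes "\<And>z. g differentiable (at z)" "\<And>z. h differentiable (at z)"
  shows "pd b (\<lambda>z. g z + h z) z = pd b g z + pd b h z"
proof -
  have "((\<lambda>s. g (z + s *\<^sub>R b) + h (z + s *\<^sub>R b)) has_real_derivative pd b g (z + 0 *\<^sub>R b) + pd b h (z + 0 *\<^sub>R b)) (at 0)"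
    by (intro DERIV_add pd_line_derivative assms)
  then show ?thesis using DERIV_imp_deriv by (fastforce simp: pd_def)
qed

lemma pd_cmult:
  fixes g :: "'a::euclidean_space \<Rightarrow> real"
  assumes "\<And>z. g differentiable (at z)"
  shows "pd b (\<lambda>z. c * g z) z = c * pd b g z"
proof -
  have "((\<lambda>s. c * g (z + s *\<^sub>R b)) has_real_derivative c * pd b g (z + 0 *\<^sub>R b)) (at 0)"
    by (intro DERIV_cmult pd_line_derivative assms)
  then show ?thesis using DERIV_imp_deriv by (fastforce simp: pd_def)
qed

lemma pd_inner_mult:
  fixes g :: "'a::euclidean_space \<Rightarrow> real"
  assumes "\<And>z. g differentiable (at z)"
  shows "pd b (\<lambda>z. (z \<bullet> c) * g z) z = (b \<bullet> c) * g z + (z \<bullet> c) * pd b g z"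
proof -
  have "((\<lambda>s. ((z + s *\<^sub>R b) \<bullet> c) * g (z + s *\<^sub>R b)) has_real_derivative
      (b \<bullet> c) * g (z + 0 *\<^sub>R b) + pd b g (z + 0 *\<^sub>R b) * ((z + 0 *\<^sub>R b) \<bullet> c)) (at 0)"
    by (intro DERIV_mult pd_line_derivative assms) (auto intro!: derivative_eq_intros simp: inner_add_left)
  then show ?thesis using DERIV_imp_deriv by (fastforce simp: pd_def mult.commute)
qed

lemma Ck_decay_differentiable: "Ck_decay (Suc k) m g \<Longrightarrow> g differentiable (at z)"
  by simp

lemma Ck_decay_imp_decay: "Ck_decay k m g \<Longrightarrow> decay m g"
  by (cases k) auto

lemma Ck_decay_continuous: "Ck_decay k m g \<Longrightarrow> continuous_on UNIV g"
  by (cases k) (auto intro!: differentiable_imp_continuous_on simp: differentiable_on_def)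

lemma Ck_decay_pd: "Ck_decay (Suc k) m g \<Longrightarrow> b \<in> Basis \<Longrightarrow> Ck_decay k m (pd b g)"
  by simp

lemma Ck_decay_mono: "Ck_decay k m g \<Longrightarrow> k' \<le> k \<Longrightarrow> m' \<le> m \<Longrightarrow> Ck_decay k' m' g"
proof (induction k' arbitrary: k g)
  case 0
  then show ?case by (auto intro: decay_mono dest: Ck_decay_imp_decay Ck_decay_continuous)
next
  case (Suc k')
  then show ?case by (cases k) (auto intro: decay_mono)
qed

lemma Ck_decay_add: "Ck_decay k m g \<Longrightarrow> Ck_decay k m h \<Longrightarrow> Ck_decay k m (\<lambda>z. g z + h z)"
proof (induction k arbitrary: g h)
  case 0
  then show ?case by (auto intro: decay_add continuous_on_add)
next
  case (Suc k)
  have "pd b (\<lambda>z. g z + h z) = (\<lambda>z. pd b g z + pd b h z)" for b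
    using Suc.prems by (intro ext pd_add) auto
  with Suc show ?case by (auto intro: decay_add)
qed

lemma Ck_decay_cmult: "Ck_decay k m g \<Longrightarrow> Ck_decay k m (\<lambda>z. c * g z)"
proof (induction k arbitrary: g)
  case 0
  then show ?case by (auto intro: decay_cmult continuous_on_mult_left)
next
  case (Suc k)
  have "pd b (\<lambda>z. c * g z) = (\<lambda>z. c * pd b g z)" for b
    using Suc.prems by (intro ext pd_cmult) auto
  with Suc show ?case by (auto intro: decay_cmult)
qed

lemma Ck_decay_diff: "Ck_decay k m g \<Longrightarrow> Ck_decay k m h \<Longrightarrow> Ck_decay k m (\<lambda>z. g z - h z)"
  using Ck_decay_add[OF _ Ck_decay_cmult[of k m h "-1"]] by simp

lemma Ck_decay_zero: "Ck_decay k m (\<lambda>z. 0)"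
proof (induction k)
  case 0
  then show ?case by (auto simp: decay_def)
next
  case (Suc k)
  moreover have "pd b (\<lambda>z::'a. 0) = (\<lambda>z. 0)" for b
    by (simp add: pd_def fun_eq_iff)
  ultimately show ?case by (auto simp: decay_def)
qed

lemma Ck_decay_sum:
  "(\<And>i. i \<in> I \<Longrightarrow> Ck_decay k m (g i)) \<Longrightarrow> Ck_decay k m (\<lambda>z. \<Sum>i\<in>I. g i z)"
  by (induction I rule: infinite_finite_induct) (auto intro: Ck_decay_add Ck_decay_zero)

lemma Ck_decay_inner_mult:
  assumes "c \<in> Basis"
  shows "Ck_decay k (Suc m) g \<Longrightarrow> Ck_decay k m (\<lambda>z. (z \<bullet> c) * g z)"
proof (induction k arbitrary: g)
  case 0
  then show ?case using assms by (auto intro!: decay_inner_mult continuous_intros)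
next
  case (Suc k)
  have "pd b (\<lambda>z. (z \<bullet> c) * g z) = (\<lambda>z. (b \<bullet> c) * g z + (z \<bullet> c) * pd b g z)" for b
    using Suc.prems by (intro ext pd_inner_mult) auto
  moreover have "Ck_decay k m (\<lambda>z. (b \<bullet> c) * g z + (z \<bullet> c) * pd b g z)" if "b \<in> Basis" for b
  proof (intro Ck_decay_add Ck_decay_cmult Suc.IH)
    show "Ck_decay k m g" by (rule Ck_decay_mono[OF Suc.prems]) auto
    show "Ck_decay k (Suc m) (pd b g)" by (rule Ck_decay_pd[OF Suc.prems that])
  qed
  ultimately show ?case using Suc.prems assms
    by (auto intro!: decay_inner_mult differentiable_mult)
qed

lemma regular_imp_Ck_decay:
  fixes g :: "'n::finite phase \<Rightarrow> real"
  assumes "regular N g"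
  shows "Ck_decay N (2 * CARD('n) + N + 1) g"
proof -
  have "Ck k h \<Longrightarrow> (\<And>bs. set bs \<subseteq> Basis \<Longrightarrow> length bs \<le> k \<Longrightarrow> decay m (foldr pd bs h)) \<Longrightarrow> Ck_decay k m h"
    for k m and h :: "'n phase \<Rightarrow> real"
  proof (induction k arbitrary: h)
    case 0
    show ?case using 0(1) 0(2)[of "[]"] by simp
  next
    case (Suc k)
    have "decay m h" using Suc.prems(2)[of "[]"] by simp
    moreover have "Ck_decay k m (pd b h)" if "b \<in> Basis" for b
    proof (rule Suc.IH)
      show "Ck k (pd b h)" using Suc.prems(1) that by simp
      fix bs :: "'n phase list" assume "set bs \<subseteq> Basis" "length bs \<le> k"
      then show "decay m (foldr pd bs (pd b h))" using Suc.prems(2)[of "bs @ [b]"] that by simp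
    qed
    ultimately show ?case using Suc.prems(1) by simp
  qed
  then show ?thesis using assms by (auto simp: regular_def decay_def)
qed

lemma basis_phase: "(axis i 1, 0) \<in> (Basis :: 'n::finite phase set)" "(0, axis i 1) \<in> (Basis :: 'n phase set)"
  by (auto simp: Basis_prod_def axis_in_Basis_iff)

lemma fst_component: "fst z $ i = z \<bullet> (axis i 1, 0)" and snd_component: "snd z $ i = z \<bullet> (0, axis i 1)"
  for z :: "'n::finite phase"
  by (simp_all add: inner_prod_def inner_axis)

text \<open>Each vector field is of first order with coefficients of degree at most one in the phase variable.\<close>

lemma Ck_decay_Zf:
  fixes g :: "'n::finite phase \<Rightarrow> real"
  assumes g: "Ck_decay (Suc k) (Suc m) g"
  shows "Ck_decay k m (Zf t Z g)"
proof -
  have x: "Ck_decay k (Suc m) (dx i g)" and v: "Ck_decay k (Suc m) (dv i g)" for i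
    by (auto intro: Ck_decay_pd[OF g] basis_phase)
  have x': "Ck_decay k m (dx i g)" and v': "Ck_decay k m (dv i g)" for i
    using Ck_decay_mono[OF x] Ck_decay_mono[OF v] by auto
  note intros = Ck_decay_add Ck_decay_cmult Ck_decay_diff Ck_decay_sum Ck_decay_inner_mult basis_phase x v x' v'
  show ?thesis
  proof (cases Z)
    case (Translation i)
    have "Zf t Z g = (\<lambda>z. dx i g z)" by (auto simp: Translation)
    then show ?thesis using x' by simp
  next
    case (Galilean i)
    have "Zf t Z g = (\<lambda>z. t * dx i g z + dv i g z)" by (auto simp: Galilean)
    then show ?thesis by (auto intro!: intros)
  next
    case (Rotation i j)
    have "Zf t Z g = (\<lambda>z. (z \<bullet> (axis i 1, 0) * dx j g z - z \<bullet> (axis j 1, 0) * dx i g z)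
       + (z \<bullet> (0, axis i 1) * dv j g z - z \<bullet> (0, axis j 1) * dv i g z))"
      by (intro ext) (simp only: Rotation Zf.simps fst_component snd_component)
    then show ?thesis by (auto intro!: intros)
  next
    case Scaling
    have "Zf t Z g = (\<lambda>z. (\<Sum>i\<in>UNIV. z \<bullet> (axis i 1, 0) * dx i g z) + (\<Sum>i\<in>UNIV. z \<bullet> (0, axis i 1) * dv i g z))"
      by (intro ext) (simp only: Scaling Zf.simps fst_component snd_component)
    then show ?thesis by (auto intro!: intros)
  qed
qed

lemma Zf_linear:
  fixes g h :: "'n::finite phase \<Rightarrow> real"
  assumes g: "\<And>z. g differentiable (at z)" and h: "\<And>z. h differentiable (at z)"
  shows "Zf t Z (\<lambda>z. g z + c * h z) = (\<lambda>z. Zf t Z g z + c * Zf t Z h z)"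
proof -
  have pd: "pd b (\<lambda>z. g z + c * h z) z = pd b g z + c * pd b h z" for b z
    using g h by (subst pd_add) (auto simp: pd_cmult)
  show ?thesis
    by (cases Z) (auto simp: pd algebra_simps sum.distrib sum_distrib_left)
qed

lemma Zf_pow_simps: "Zf_pow t [] g = g" "Zf_pow t (Z # \<alpha>) g = Zf t Z (Zf_pow t \<alpha> g)"
  and Zf_pow_snoc: "Zf_pow t (\<alpha> @ [Z]) g = Zf_pow t \<alpha> (Zf t Z g)"
  by (simp_all add: Zf_pow_def)

lemma Ck_decay_Zf_pow:
  fixes g :: "'n::finite phase \<Rightarrow> real"
  assumes "Ck_decay (k + length \<alpha>) (m + length \<alpha>) g"
  shows "Ck_decay k m (Zf_pow t \<alpha> g)"
  using assms
proof (induction \<alpha> arbitrary: k m)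
  case Nil
  then show ?case by (simp add: Zf_pow_simps)
next
  case (Cons Z \<alpha>)
  have "Ck_decay (Suc k) (Suc m) (Zf_pow t \<alpha> g)"
    using Cons.prems by (intro Cons.IH) simp
  then show ?case by (simp only: Zf_pow_simps Ck_decay_Zf)
qed

lemma Zf_pow_linear:
  fixes g h :: "'n::finite phase \<Rightarrow> real"
  assumes "Ck_decay (length \<alpha>) (length \<alpha>) g" "Ck_decay (length \<alpha>) (length \<alpha>) h"
  shows "Zf_pow t \<alpha> (\<lambda>z. g z + c * h z) = (\<lambda>z. Zf_pow t \<alpha> g z + c * Zf_pow t \<alpha> h z)"
  using assms
proof (induction \<alpha>)
  case Nil
  then show ?case by (simp add: Zf_pow_simps)
next
  case (Cons Z \<alpha>)
  have d: "Ck_decay (Suc 0) (Suc 0) (Zf_pow t \<alpha> g)" "Ck_decay (Suc 0) (Suc 0) (Zf_pow t \<alpha> h)"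
    using Cons.prems by (auto intro!: Ck_decay_Zf_pow simp del: Ck_decay.simps)
  have "Zf_pow t \<alpha> (\<lambda>z. g z + c * h z) = (\<lambda>z. Zf_pow t \<alpha> g z + c * Zf_pow t \<alpha> h z)"
    using Cons.prems by (intro Cons.IH) (auto intro: Ck_decay_mono simp del: Ck_decay.simps)
  then show ?case
    using Zf_linear[OF Ck_decay_differentiable[OF d(1)] Ck_decay_differentiable[OF d(2)]]
    by (simp add: Zf_pow_simps)
qed

section \<open>Velocity averages\<close>

lemma distr_lborel_translate: "distr lborel borel (\<lambda>x. x + c) = (lborel :: 'a::euclidean_space measure)"
  using lborel_distr_plus[of c] by (simp add: add.commute[of _ c])

lemma distr_lborel_reflect: "distr lborel borel (\<lambda>x. c - x) = (lborel :: 'a::euclidean_space measure)"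
  using lborel_affine[of "-1" c] by (simp add: density_1)

lemma integral_lborel_translate:
  fixes f :: "'a::euclidean_space \<Rightarrow> real"
  assumes [measurable]: "f \<in> borel_measurable borel"
  shows "(\<integral>x. f (x + c) \<partial>lborel) = (\<integral>x. f x \<partial>lborel)"
  by (subst (2) distr_lborel_translate[of c, symmetric]) (simp add: integral_distr)

lemma integral_lborel_reflect:
  fixes f :: "'a::euclidean_space \<Rightarrow> real"
  assumes [measurable]: "f \<in> borel_measurable borel"
  shows "(\<integral>x. f (c - x) \<partial>lborel) = (\<integral>x. f x \<partial>lborel)"
  by (subst (2) distr_lborel_reflect[of c, symmetric]) (simp add: integral_distr)

lemma nn_integral_lborel_translate:
  fixes f :: "'a::euclidean_space \<Rightarrow> ennreal"
  assumes [measurable]: "f \<in> borel_measurable borel"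
  shows "(\<integral>\<^sup>+x. f (x + c) \<partial>lborel) = (\<integral>\<^sup>+x. f x \<partial>lborel)"
  by (subst (2) distr_lborel_translate[of c, symmetric]) (simp add: nn_integral_distr)

lemma nn_integral_lborel_reflect:
  fixes f :: "'a::euclidean_space \<Rightarrow> ennreal"
  assumes [measurable]: "f \<in> borel_measurable borel"
  shows "(\<integral>\<^sup>+x. f (c - x) \<partial>lborel) = (\<integral>\<^sup>+x. f x \<partial>lborel)"
  by (subst (2) distr_lborel_reflect[of c, symmetric]) (simp add: nn_integral_distr)

text \<open>The available decay \<open>2 n + 1\<close> is split into \<open>n + 1\<close> powers of \<open>|v|\<close>, enough for integrability in
\<open>v\<close>, and \<open>n\<close> powers of \<open>|x|\<close>, which remain for the velocity average.\<close>

lemma fibre_bound: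
  fixes g :: "'n::finite phase \<Rightarrow> real"
  assumes "decay (2 * CARD('n) + 1) g"
  obtains A where "0 \<le> A" "\<And>x v. \<bar>g (x, v)\<bar> \<le> A / (1 + norm x) ^ CARD('n) * (1 / (1 + norm v) ^ (CARD('n) + 1))"
proof -
  let ?n = "CARD('n)"
  obtain A where A: "\<And>z. \<bar>g z\<bar> * (1 + norm z) ^ (2 * ?n + 1) \<le> A"
    using assms by (auto simp: decay_def)
  have "0 \<le> A" using A[of 0] by (auto intro: order_trans[OF abs_ge_zero])
  moreover have "\<bar>g (x, v)\<bar> \<le> A / (1 + norm x) ^ ?n * (1 / (1 + norm v) ^ (?n + 1))" for x v
  proof -
    have "(1 + norm x) ^ ?n * (1 + norm v) ^ (?n + 1) \<le> (1 + norm (x, v)) ^ ?n * (1 + norm (x, v)) ^ (?n + 1)"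
      using norm_fst_le[of x v] norm_snd_le[of v x] by (intro mult_mono power_mono) auto
    also have "\<dots> = (1 + norm (x, v)) ^ (2 * ?n + 1)"
      by (subst power_add[symmetric]) (simp add: mult_2)
    finally have "\<bar>g (x, v)\<bar> * ((1 + norm x) ^ ?n * (1 + norm v) ^ (?n + 1)) \<le> A"
      by (intro order_trans[OF mult_left_mono A]) auto
    moreover have "0 < (1 + norm x) ^ ?n * (1 + norm v) ^ (?n + 1)"
      by (intro mult_pos_pos zero_less_power) (auto simp: add_pos_nonneg)
    ultimately show ?thesis by (simp add: field_simps)
  qed
  ultimately show ?thesis using that by blast
qed

lemma fibre_dominated:
  fixes g :: "'n::finite phase \<Rightarrow> real"
  assumes "decay (2 * CARD('n) + 1) g"
  obtains D where "integrable lborel D" "\<And>x v. \<bar>g (x, v)\<bar> \<le> D v"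
proof -
  obtain A where A: "0 \<le> A" "\<And>x v. \<bar>g (x, v)\<bar> \<le> A / (1 + norm x) ^ CARD('n) * (1 / (1 + norm v) ^ (CARD('n) + 1))"
    using fibre_bound[OF assms] by blast
  have "\<bar>g (x, v)\<bar> \<le> A * (1 / (1 + norm v) ^ (CARD('n) + 1))" for x v
  proof -
    have "A / (1 + norm x) ^ CARD('n) \<le> A / 1"
      using A(1) by (intro divide_left_mono one_le_power) (auto intro!: zero_less_power simp: add_pos_nonneg)
    then show ?thesis
      by (intro order_trans[OF A(2)] mult_right_mono) auto
  qed
  moreover have "integrable lborel (\<lambda>v :: real^'n. A * (1 / (1 + norm v) ^ (CARD('n) + 1)))"
    using integrable_inverse_power_norm[where 'a = "real^'n"] by (intro integrable_mult_right) simp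
  ultimately show ?thesis using that by blast
qed

lemma fibre_measurable:
  assumes "continuous_on UNIV (g :: 'n::finite phase \<Rightarrow> real)"
  shows "(\<lambda>v. g (x, v)) \<in> borel_measurable borel"
  by (intro borel_measurable_continuous_onI continuous_on_compose2[OF assms]) (auto intro!: continuous_intros)

lemma fibre_integrable:
  fixes g :: "'n::finite phase \<Rightarrow> real"
  assumes "Ck_decay 0 (2 * CARD('n) + 1) g"
  shows "integrable lborel (\<lambda>v. g (x, v))"
proof -
  obtain D where D: "integrable lborel D" "\<And>x v. \<bar>g (x, v)\<bar> \<le> D v"
    using fibre_dominated assms by auto
  show ?thesis
  proof (rule Bochner_Integration.integrable_bound[OF D(1)])
    show "(\<lambda>v. g (x, v)) \<in> borel_measurable lborel"
      using fibre_measurable assms by auto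
    show "AE v in lborel. norm (g (x, v)) \<le> norm (D v)"
      unfolding real_norm_def by (intro AE_I2 order_trans[OF D(2) abs_ge_self])
  qed
qed

lemma Ck_decay_rho:
  fixes g :: "'n::finite phase \<Rightarrow> real"
  assumes g: "Ck_decay 0 (2 * CARD('n) + 1) g"
  shows "Ck_decay 0 CARD('n) (rho g)"
proof -
  have c: "continuous_on UNIV g" and d: "decay (2 * CARD('n) + 1) g" using g by auto
  obtain D where D: "integrable lborel D" "\<And>x v. \<bar>g (x, v)\<bar> \<le> D v"
    using fibre_dominated[OF d] by auto
  have "continuous_on UNIV (rho g)"
    unfolding rho_def
    by (rule continuous_on_parameter_integral[OF _ D(1)])
       (auto intro!: fibre_measurable[OF c] D(2) continuous_on_compose2[OF c] continuous_intros)
  moreover have "decay CARD('n) (rho g)"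
  proof -
    obtain A where A: "0 \<le> A" "\<And>x v. \<bar>g (x, v)\<bar> \<le> A / (1 + norm x) ^ CARD('n) * (1 / (1 + norm v) ^ (CARD('n) + 1))"
      using fibre_bound[OF d] by blast
    define I where "I = (\<integral>v. 1 / (1 + norm (v :: real^'n)) ^ (CARD('n) + 1) \<partial>lborel)"
    have "\<bar>rho g x\<bar> * (1 + norm x) ^ CARD('n) \<le> A * I" for x
    proof -
      have "\<bar>rho g x\<bar> \<le> (\<integral>v. \<bar>g (x, v)\<bar> \<partial>lborel)"
        unfolding rho_def by (rule integral_abs_bound)
      also have "\<dots> \<le> (\<integral>v. A / (1 + norm x) ^ CARD('n) * (1 / (1 + norm (v :: real^'n)) ^ (CARD('n) + 1)) \<partial>lborel)"
      proof (rule integral_mono)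
        show "\<bar>g (x, v)\<bar> \<le> A / (1 + norm x) ^ CARD('n) * (1 / (1 + norm v) ^ (CARD('n) + 1))" for v by (rule A(2))
        show "integrable lborel (\<lambda>v. \<bar>g (x, v)\<bar>)" using fibre_integrable[OF g] by simp
        show "integrable lborel (\<lambda>v :: real^'n. A / (1 + norm x) ^ CARD('n) * (1 / (1 + norm v) ^ (CARD('n) + 1)))"
          using integrable_inverse_power_norm[where 'a = "real^'n"] by (intro integrable_mult_right) simp
      qed
      also have "\<dots> = A / (1 + norm x) ^ CARD('n) * I"
        unfolding I_def by (rule integral_mult_right_zero)
      moreover have "0 < (1 + norm x) ^ CARD('n)"
        by (intro zero_less_power) (auto simp: add_pos_nonneg)
      ultimately show ?thesis by (simp add: field_simps)
    qed
    then show ?thesis by (auto simp: decay_def)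
  qed
  ultimately show ?thesis by simp
qed

lemma continuous_pair_measurable:
  fixes g :: "'c::topological_space \<Rightarrow> real" and f :: "real \<Rightarrow> 'b::euclidean_space \<Rightarrow> 'c"
  assumes "continuous_on UNIV g" "continuous_on UNIV (\<lambda>p. f (fst p) (snd p))"
  shows "(\<lambda>(r, y). g (f r y)) \<in> borel_measurable borel"
  unfolding split_beta'
  by (intro borel_measurable_continuous_onI continuous_on_compose2[OF assms]) auto

lemma rho_line_derivative:
  fixes g :: "'n::finite phase \<Rightarrow> real"
  assumes g: "Ck_decay 1 (2 * CARD('n) + 1) g" and e: "(e, 0) \<in> (Basis :: 'n phase set)"
  shows "((\<lambda>s. rho g (x + s *\<^sub>R e)) has_real_derivative rho (pd (e, 0) g) (x + s *\<^sub>R e)) (at s)"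
proof -
  have g0: "Ck_decay 0 (2 * CARD('n) + 1) g" by (rule Ck_decay_mono[OF g]) auto
  have g': "Ck_decay 0 (2 * CARD('n) + 1) (pd (e, 0) g)" using Ck_decay_pd[of 0] g e by simp
  have c: "continuous_on UNIV (pd (e, 0) g)" and d: "decay (2 * CARD('n) + 1) (pd (e, 0) g)"
    using g' by auto
  obtain D where D: "integrable lborel D" "\<And>x v. \<bar>pd (e, 0) g (x, v)\<bar> \<le> D v"
    using fibre_dominated[OF d] by auto
  have "((\<lambda>s. rho g (x + s *\<^sub>R e)) has_real_derivative rho (pd (e, 0) g) (x + 0 *\<^sub>R e)) (at 0)" for x
    unfolding rho_def
  proof (rule has_real_derivative_parameter_integral_dominated[OF _ _ D(1)])
    show "integrable lborel (\<lambda>v. g (x + s *\<^sub>R e, v))" for s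
      by (rule fibre_integrable[OF g0])
    show "(\<lambda>(r, y). pd (e, 0) g (x + r *\<^sub>R e, y)) \<in> borel_measurable borel"
      by (rule continuous_pair_measurable[OF c]) (intro continuous_intros)
    show "\<bar>pd (e, 0) g (x + r *\<^sub>R e, y)\<bar> \<le> D y" for r y by (rule D)
    show "((\<lambda>r. g (x + r *\<^sub>R e, v)) has_real_derivative pd (e, 0) g (x + r *\<^sub>R e, v)) (at r)" for r v
      using pd_line_derivative(1)[OF Ck_decay_differentiable[OF g[unfolded One_nat_def]], of "(x, v)" "(e, 0)" r] by simp
    show "continuous_on UNIV (\<lambda>r. pd (e, 0) g (x + r *\<^sub>R e, v))" for v
      by (rule continuous_on_compose2[OF c]) (auto intro!: continuous_intros)
  qed
  from this[of "x + s *\<^sub>R e"]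
  have "((\<lambda>r. rho g (x + (s + r) *\<^sub>R e)) has_real_derivative rho (pd (e, 0) g) (x + s *\<^sub>R e)) (at 0)"
    by (simp add: scaleR_add_left add.assoc)
  then show ?thesis
    using DERIV_shift[of "\<lambda>r. rho g (x + r *\<^sub>R e)" _ 0 s] by (simp add: add.commute)
qed

text \<open>The integral of \<open>g (x, v + s e)\<close> over \<open>v\<close> does not depend on \<open>s\<close>, so its \<open>s\<close>-derivative vanishes.\<close>

lemma rho_velocity_derivative_eq_0:
  fixes g :: "'n::finite phase \<Rightarrow> real"
  assumes g: "Ck_decay 1 (2 * CARD('n) + 1) g" and e: "(0, e) \<in> (Basis :: 'n phase set)"
  shows "rho (pd (0, e) g) x = 0"
proof -
  have g0: "Ck_decay 0 (2 * CARD('n) + 1) g" by (rule Ck_decay_mono[OF g]) auto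
  have g': "Ck_decay 0 (2 * CARD('n) + 1) (pd (0, e) g)" using Ck_decay_pd[of 0] g e by simp
  have c: "continuous_on UNIV (pd (0, e) g)" and d: "decay (2 * CARD('n) + 1) (pd (0, e) g)"
    using g' by auto
  obtain A where A: "0 \<le> A" "\<And>x v. \<bar>pd (0, e) g (x, v)\<bar> \<le> A / (1 + norm x) ^ CARD('n) * (1 / (1 + norm v) ^ (CARD('n) + 1))"
    using fibre_bound[OF d] by blast
  define D where "D = (\<lambda>v :: real^'n. A * 2 ^ (CARD('n) + 1) * (1 / (1 + norm v) ^ (CARD('n) + 1)))"
  have e1: "norm e = 1" using norm_Basis[OF e] by (simp add: norm_Pair)
  have D: "integrable lborel D"
    unfolding D_def using integrable_inverse_power_norm[where 'a = "real^'n"] by (intro integrable_mult_right) simp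
  have dom: "\<bar>pd (0, e) g (x, v + r *\<^sub>R e)\<bar> \<le> D v" if r: "r \<in> {-1..1}" for r v
  proof -
    have "norm v \<le> norm (v + r *\<^sub>R e) + norm (r *\<^sub>R e)"
      using norm_triangle_ineq4[of "v + r *\<^sub>R e" "r *\<^sub>R e"] by simp
    moreover have "norm (r *\<^sub>R e) \<le> 1" using r e1 by auto
    ultimately have "1 + norm v \<le> 2 * (1 + norm (v + r *\<^sub>R e))"
      by (smt (verit) norm_ge_zero)
    then have "(1 + norm v) ^ (CARD('n) + 1) \<le> (2 * (1 + norm (v + r *\<^sub>R e))) ^ (CARD('n) + 1)"
      by (intro power_mono) auto
    then have "(1 + norm v) ^ (CARD('n) + 1) \<le> 2 ^ (CARD('n) + 1) * (1 + norm (v + r *\<^sub>R e)) ^ (CARD('n) + 1)"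
      by (simp only: power_mult_distrib)
    then have "1 / (1 + norm (v + r *\<^sub>R e)) ^ (CARD('n) + 1) \<le> 2 ^ (CARD('n) + 1) / (1 + norm v) ^ (CARD('n) + 1)"
      by (intro inverse_le_divide zero_less_power) (auto simp: add_pos_nonneg)
    then have "A / (1 + norm x) ^ CARD('n) * (1 / (1 + norm (v + r *\<^sub>R e)) ^ (CARD('n) + 1)) \<le>
       A / 1 * (2 ^ (CARD('n) + 1) / (1 + norm v) ^ (CARD('n) + 1))"
      using A(1) by (intro mult_mono divide_left_mono one_le_power) (auto intro!: zero_less_power simp: add_pos_nonneg)
    then show ?thesis
      unfolding D_def by (intro order_trans[OF A(2)]) simp
  qed
  have "((\<lambda>s. \<integral>v. g (x, v + s *\<^sub>R e) \<partial>lborel) has_real_derivative (\<integral>v. pd (0, e) g (x, v + 0 *\<^sub>R e) \<partial>lborel)) (at 0)"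
  proof (rule has_real_derivative_parameter_integral_dominated[OF _ _ D dom])
    show "integrable lborel (\<lambda>v. g (x, v + s *\<^sub>R e))" for s
    proof -
      have "integrable (distr lborel borel (\<lambda>v. v + s *\<^sub>R e)) (\<lambda>v. g (x, v))"
        unfolding distr_lborel_translate by (rule fibre_integrable[OF g0])
      then show ?thesis
        using fibre_measurable[of g x] g0 by (subst (asm) integrable_distr_eq) auto
    qed
    show "(\<lambda>(r, y). pd (0, e) g (x, y + r *\<^sub>R e)) \<in> borel_measurable borel"
      by (rule continuous_pair_measurable[OF c]) (intro continuous_intros)
    show "((\<lambda>r. g (x, v + r *\<^sub>R e)) has_real_derivative pd (0, e) g (x, v + r *\<^sub>R e)) (at r)" for r v
      using pd_line_derivative(1)[OF Ck_decay_differentiable[OF g[unfolded One_nat_def]], of "(x, v)" "(0, e)" r] by simp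
    show "continuous_on UNIV (\<lambda>r. pd (0, e) g (x, v + r *\<^sub>R e))" for v
      by (rule continuous_on_compose2[OF c]) (auto intro!: continuous_intros)
  qed auto
  moreover have "(\<integral>v. g (x, v + s *\<^sub>R e) \<partial>lborel) = rho g x" for s
    unfolding rho_def by (rule integral_lborel_translate[OF fibre_measurable]) (use g0 in auto)
  ultimately have "((\<lambda>s. rho g x) has_real_derivative rho (pd (0, e) g) x) (at (0::real))"
    by (simp add: rho_def)
  then show ?thesis using DERIV_unique[OF _ DERIV_const] by blast
qed

section \<open>Convolution with weakly singular kernels\<close>

definition conv :: "(real ^ 'n::finite \<Rightarrow> real) \<Rightarrow> (real ^ 'n \<Rightarrow> real) \<Rightarrow> real ^ 'n \<Rightarrow> real" where
  "conv K u x = (\<integral>y. K y * u (x - y) \<partial>lborel)"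

text \<open>One class for all the kernels that occur: \<open>G\<close>, \<open>\<partial>\<^sub>i G\<close>, \<open>y\<^sub>i G\<close> and \<open>y\<^sub>i \<partial>\<^sub>j G\<close>. The singularity at the origin
is that of \<open>\<partial>\<^sub>i G\<close>, and the factor \<open>(1 + |y|)\<^sup>2\<close> admits the growth of \<open>y\<^sub>i G\<close> relative to it.\<close>

definition riesz :: "(real ^ 'n::finite \<Rightarrow> real) \<Rightarrow> bool" where
  "riesz K \<longleftrightarrow> K \<in> borel_measurable borel \<and>
     (\<exists>C. \<forall>y. \<bar>K y\<bar> \<le> C * ((1 + norm y)\<^sup>2 / norm y ^ (CARD('n) - 1)))"

lemma riesz_add: "riesz K \<Longrightarrow> riesz L \<Longrightarrow> riesz (\<lambda>y. K y + L y)"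
proof -
  assume K: "riesz K" and L: "riesz L"
  obtain C where C: "\<And>y. \<bar>K y\<bar> \<le> C * ((1 + norm y)\<^sup>2 / norm y ^ (CARD('a) - 1))" using K by (auto simp: riesz_def)
  obtain B where B: "\<And>y. \<bar>L y\<bar> \<le> B * ((1 + norm y)\<^sup>2 / norm y ^ (CARD('a) - 1))" using L by (auto simp: riesz_def)
  have "\<bar>K y + L y\<bar> \<le> (C + B) * ((1 + norm y)\<^sup>2 / norm y ^ (CARD('a) - 1))" for y
    unfolding distrib_right using C[of y] B[of y] by linarith
  then show ?thesis using K L by (auto simp: riesz_def)
qed

lemma conv_commute:
  assumes [measurable]: "K \<in> borel_measurable borel" "u \<in> borel_measurable borel"
  shows "conv K u x = (\<integral>y. K (x - y) * u y \<partial>lborel)"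
  unfolding conv_def
  by (subst integral_lborel_reflect[of "\<lambda>y. K y * u (x - y)" x, symmetric]) simp_all

text \<open>Peetre's inequality \<open>1 + |y| \<le> (1 + |x|) (1 + |x - y|)\<close> moves the decay of \<open>u\<close> from \<open>x - y\<close> to \<open>y\<close>,
uniformly for \<open>x\<close> in a ball.\<close>

lemma conv_dominated:
  fixes K u :: "real ^ 'n::finite \<Rightarrow> real"
  assumes K: "riesz K" and u: "decay CARD('n) u" and n: "4 \<le> CARD('n)"
  obtains D where "integrable lborel D" "\<And>x y. norm x \<le> R \<Longrightarrow> \<bar>K y * u (x - y)\<bar> \<le> D y"
proof -
  let ?n = "CARD('n)"
  obtain C where C: "\<And>y. \<bar>K y\<bar> \<le> C * ((1 + norm y)\<^sup>2 / norm y ^ (?n - 1))" using K by (auto simp: riesz_def)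
  obtain A where A: "\<And>z. \<bar>u z\<bar> * (1 + norm z) ^ ?n \<le> A" using u by (auto simp: decay_def)
  have A0: "0 \<le> A" using A[of 0] by (auto intro: order_trans[OF abs_ge_zero])
  define D where "D = (\<lambda>y :: real^'n. \<bar>C\<bar> * (A * (1 + \<bar>R\<bar>) ^ ?n) * (1 / (norm y ^ (?n - 1) * (1 + norm y) ^ (?n - 2))))"
  have "integrable lborel D"
    unfolding D_def using integrable_riesz_weight[where 'a = "real^'n"] n by (intro integrable_mult_right) simp
  moreover have "\<bar>K y * u (x - y)\<bar> \<le> D y" if x: "norm x \<le> R" for x y
  proof -
    have pos: "0 < 1 + norm z" for z :: "real^'n" by (simp add: add_pos_nonneg)
    have "1 + norm y \<le> (1 + \<bar>R\<bar>) * (1 + norm (x - y))"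
    proof -
      have "norm y \<le> norm x + norm (x - y)" using norm_triangle_ineq4[of x "x - y"] by simp
      moreover have "0 \<le> \<bar>R\<bar> * norm (x - y)" by simp
      moreover have "(1 + \<bar>R\<bar>) * (1 + norm (x - y)) = 1 + \<bar>R\<bar> + norm (x - y) + \<bar>R\<bar> * norm (x - y)"
        by (simp add: algebra_simps)
      ultimately show ?thesis using x by linarith
    qed
    then have "(1 + norm y) ^ ?n \<le> (1 + \<bar>R\<bar>) ^ ?n * (1 + norm (x - y)) ^ ?n"
      by (subst power_mult_distrib[symmetric], intro power_mono) auto
    then have "1 / (1 + norm (x - y)) ^ ?n \<le> (1 + \<bar>R\<bar>) ^ ?n / (1 + norm y) ^ ?n"
      by (intro inverse_le_divide zero_less_power pos)
    then have "A * (1 / (1 + norm (x - y)) ^ ?n) \<le> A * ((1 + \<bar>R\<bar>) ^ ?n / (1 + norm y) ^ ?n)"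
      using A0 by (intro mult_left_mono)
    moreover have "\<bar>u (x - y)\<bar> \<le> A * (1 / (1 + norm (x - y)) ^ ?n)"
      using A[of "x - y"] zero_less_power[OF pos[of "x - y"], of ?n] by (simp add: field_simps)
    ultimately have u': "\<bar>u (x - y)\<bar> \<le> A * (1 + \<bar>R\<bar>) ^ ?n / (1 + norm y) ^ ?n" by simp
    have "\<bar>K y\<bar> \<le> \<bar>C\<bar> * ((1 + norm y)\<^sup>2 / norm y ^ (?n - 1))"
      by (rule order_trans[OF C mult_right_mono]) auto
    with u' have "\<bar>K y * u (x - y)\<bar> \<le> \<bar>C\<bar> * ((1 + norm y)\<^sup>2 / norm y ^ (?n - 1)) * (A * (1 + \<bar>R\<bar>) ^ ?n / (1 + norm y) ^ ?n)"
      unfolding abs_mult by (intro mult_mono) auto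
    also have "\<dots> = D y"
    proof -
      have *: "?n = 2 + (?n - 2)" using n by simp
      have "(1 + norm y) ^ ?n = (1 + norm y)\<^sup>2 * (1 + norm y) ^ (?n - 2)"
        by (rule power_add[of "1 + norm y" 2 "?n - 2", folded *])
      then show ?thesis using pos[of y] by (simp add: D_def)
    qed
    finally show ?thesis .
  qed
  ultimately show ?thesis using that by blast
qed

lemma conv_integrable:
  fixes K u :: "real ^ 'n::finite \<Rightarrow> real"
  assumes K: "riesz K" and u: "Ck_decay 0 CARD('n) u" and n: "4 \<le> CARD('n)"
  shows "integrable lborel (\<lambda>y. K y * u (x - y))"
proof -
  have d: "decay CARD('n) u" and c: "continuous_on UNIV u" using u by auto
  obtain D where D: "integrable lborel D" "\<And>x' y. norm x' \<le> norm x \<Longrightarrow> \<bar>K y * u (x' - y)\<bar> \<le> D y"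
    using conv_dominated[OF K d n, of "norm x"] by blast
  have [measurable]: "K \<in> borel_measurable borel" "u \<in> borel_measurable borel"
    using K borel_measurable_continuous_onI[OF c] by (auto simp: riesz_def)
  show ?thesis
    by (rule Bochner_Integration.integrable_bound[OF D(1)])
       (auto intro!: order_trans[OF D(2) abs_ge_self])
qed

lemma conv_continuous_on_line:
  fixes K u :: "real ^ 'n::finite \<Rightarrow> real"
  assumes K: "riesz K" and u: "Ck_decay 0 CARD('n) u" and n: "4 \<le> CARD('n)"
  shows "continuous_on {-1..1} (\<lambda>r. conv K u (x + r *\<^sub>R e))"
proof -
  have d: "decay CARD('n) u" and c: "continuous_on UNIV u" using u by auto
  obtain D where D: "integrable lborel D" "\<And>x' y. norm x' \<le> norm x + norm e \<Longrightarrow> \<bar>K y * u (x' - y)\<bar> \<le> D y"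
    using conv_dominated[OF K d n, of "norm x + norm e"] by blast
  have [measurable]: "K \<in> borel_measurable borel" "u \<in> borel_measurable borel"
    using K borel_measurable_continuous_onI[OF c] by (auto simp: riesz_def)
  show ?thesis
    unfolding conv_def
  proof (rule continuous_on_parameter_integral[OF _ D(1)])
    fix r :: real and y assume r: "r \<in> {-1..1}"
    have "norm (r *\<^sub>R e) \<le> norm e" using r by (auto intro: mult_left_le_one_le)
    then have "norm (x + r *\<^sub>R e) \<le> norm x + norm e" by (rule norm_triangle_le[OF add_left_mono])
    then show "\<bar>K y * u (x + r *\<^sub>R e - y)\<bar> \<le> D y" by (rule D)
  next
    show "continuous_on {-1..1} (\<lambda>r. K y * u (x + r *\<^sub>R e - y))" for y
      by (intro continuous_intros continuous_on_compose2[OF c]) auto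
  qed auto
qed

lemma measurable_snd_borel: "snd \<in> borel_measurable (borel :: ('a::topological_space \<times> 'b::topological_space) measure)"
  by (intro borel_measurable_continuous_onI continuous_on_snd continuous_on_id)

lemma conv_derivative_right:
  fixes K u :: "real ^ 'n::finite \<Rightarrow> real"
  assumes K: "riesz K" and u: "Ck_decay 0 CARD('n) u" and u': "Ck_decay 0 CARD('n) u'" and n: "4 \<le> CARD('n)"
    and der: "\<And>z s. ((\<lambda>s. u (z + s *\<^sub>R e)) has_real_derivative u' (z + s *\<^sub>R e)) (at s)"
  shows "((\<lambda>s. conv K u (x + s *\<^sub>R e)) has_real_derivative conv K u' x) (at 0)"
proof -
  have c: "continuous_on UNIV u" using u by auto
  have d': "decay CARD('n) u'" and c': "continuous_on UNIV u'" using u' by auto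
  have [measurable]: "K \<in> borel_measurable borel" "u \<in> borel_measurable borel" "u' \<in> borel_measurable borel"
    using K borel_measurable_continuous_onI[OF c] borel_measurable_continuous_onI[OF c'] by (auto simp: riesz_def)
  obtain D where D: "integrable lborel D" "\<And>x' y. norm x' \<le> norm x + norm e \<Longrightarrow> \<bar>K y * u' (x' - y)\<bar> \<le> D y"
    using conv_dominated[OF K d' n, of "norm x + norm e"] by blast
  have "((\<lambda>s. conv K u (x + s *\<^sub>R e)) has_real_derivative conv K u' (x + 0 *\<^sub>R e)) (at 0)"
    unfolding conv_def
  proof (rule has_real_derivative_parameter_integral_dominated[OF _ _ D(1)])
    show "integrable lborel (\<lambda>y. K y * u (x + s *\<^sub>R e - y))" for s
      by (rule conv_integrable[OF K u n])
    have "(\<lambda>(r, y). u' (x + r *\<^sub>R e - y)) \<in> borel_measurable borel"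
      by (rule continuous_pair_measurable[OF c']) (intro continuous_intros)
    moreover have "(\<lambda>p::real \<times> (real^'n). K (snd p)) \<in> borel_measurable borel"
      by (rule measurable_compose[OF measurable_snd_borel]) simp
    ultimately show "(\<lambda>(r, y). K y * u' (x + r *\<^sub>R e - y)) \<in> borel_measurable borel"
      unfolding split_beta' by (intro borel_measurable_times)
    fix r :: real and y
    have "((\<lambda>r. K y * u ((x - y) + r *\<^sub>R e)) has_real_derivative K y * u' ((x - y) + r *\<^sub>R e)) (at r)"
      by (intro DERIV_cmult der)
    then show "((\<lambda>r. K y * u (x + r *\<^sub>R e - y)) has_real_derivative K y * u' (x + r *\<^sub>R e - y)) (at r)"
      by (simp add: algebra_simps)
    show "continuous_on UNIV (\<lambda>r. K y * u' (x + r *\<^sub>R e - y))"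
      by (intro continuous_intros continuous_on_compose2[OF c']) auto
    assume r: "r \<in> {-1..1}"
    have "norm (r *\<^sub>R e) \<le> norm e" using r by (auto intro: mult_left_le_one_le)
    then have "norm (x + r *\<^sub>R e) \<le> norm x + norm e" by (rule norm_triangle_le[OF add_left_mono])
    then show "\<bar>K y * u' (x + r *\<^sub>R e - y)\<bar> \<le> D y" by (rule D)
  qed
  then show ?thesis by simp
qed

text \<open>In dimension at least two, the points \<open>y\<close> for which the line through \<open>x - y\<close> meets the origin lie in
a coordinate hyperplane. Off this null set a kernel that is smooth away from the origin is smooth
along the whole line.\<close>

lemma AE_line_avoids_origin:
  fixes x :: "real ^ 'n::finite"
  assumes n: "2 \<le> CARD('n)"
  shows "AE y in lborel. \<forall>r. (x - y) + r *\<^sub>R axis i 1 \<noteq> 0"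
proof -
  have "\<exists>j. j \<noteq> i"
  proof (rule ccontr)
    assume "\<nexists>j. j \<noteq> i"
    then have "(UNIV :: 'n set) = {i}" by auto
    then have "CARD('n) = card {i}" by (rule arg_cong)
    then show False using n by simp
  qed
  then obtain j where j: "j \<noteq> i" by auto
  let ?N = "{y :: real^'n. y \<bullet> axis j 1 = x $ j}"
  have "negligible ?N" by (rule negligible_standard_hyperplane) (simp add: axis_in_Basis_iff)
  moreover have "?N \<in> sets lborel"
    by (simp add: borel_closed closed_Collect_eq continuous_on_inner)
  ultimately have "?N \<in> null_sets lborel"
    by (simp add: negligible_iff_null_sets null_sets_completion_iff)
  then show ?thesis
  proof (rule AE_I', intro subsetI)
    fix y assume "y \<in> {y \<in> space lborel. \<not> (\<forall>r. x - y + r *\<^sub>R axis i 1 \<noteq> 0)}"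
    then obtain r where r: "x - y + r *\<^sub>R axis i 1 = 0" by auto
    have "(x - y + r *\<^sub>R axis i 1) $ j = 0" by (subst r) simp
    then have "x $ j = y $ j" using j by (simp add: axis_def)
    then show "y \<in> ?N" by (simp add: inner_axis)
  qed
qed

text \<open>The derivative falls on the kernel and costs no regularity of \<open>u\<close>. This is what lets
\<open>\<nabla>Z\<^sup>\<gamma> \<phi>\<close> with \<open>|\<gamma>| = N\<close> be controlled by \<open>N\<close> derivatives of the density.\<close>

lemma conv_derivative_left:
  fixes K K' u :: "real ^ 'n::finite \<Rightarrow> real"
  assumes K: "riesz K" and K': "riesz K'" and u: "Ck_decay 0 CARD('n) u" and n: "4 \<le> CARD('n)"
    and der: "\<And>z. z \<noteq> 0 \<Longrightarrow> ((\<lambda>s. K (z + s *\<^sub>R axis i 1)) has_real_derivative K' z) (at 0)"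
    and cK': "continuous_on (-{0}) K'"
  shows "((\<lambda>s. conv K u (x + s *\<^sub>R axis i 1)) has_real_derivative conv K' u x) (at 0)"
proof -
  let ?e = "axis i 1 :: real^'n"
  have d: "decay CARD('n) u" and c: "continuous_on UNIV u" using u by auto
  have m[measurable]: "K \<in> borel_measurable borel" "K' \<in> borel_measurable borel" "u \<in> borel_measurable borel"
    using K K' borel_measurable_continuous_onI[OF c] by (auto simp: riesz_def)
  obtain D where D: "integrable lborel D" "\<And>x' y. norm x' \<le> norm x + 1 \<Longrightarrow> \<bar>K' y * u (x' - y)\<bar> \<le> D y"
    using conv_dominated[OF K' d n, of "norm x + 1"] by blast
  have avoids: "AE y in lborel. \<forall>r. (x - y) + r *\<^sub>R ?e \<noteq> 0"
    using n by (intro AE_line_avoids_origin) simp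
  have "((\<lambda>s. \<integral>y. K (x + s *\<^sub>R ?e - y) * u y \<partial>lborel) has_real_derivative (\<integral>y. K' (x + 0 *\<^sub>R ?e - y) * u y \<partial>lborel)) (at 0)"
  proof (rule has_real_derivative_parameter_integral)
    show "integrable lborel (\<lambda>y. K (x + s *\<^sub>R ?e - y) * u y)" for s
    proof -
      have "integrable (distr lborel borel (\<lambda>y. x + s *\<^sub>R ?e - y)) (\<lambda>y. K y * u (x + s *\<^sub>R ?e - y))"
        unfolding distr_lborel_reflect by (rule conv_integrable[OF K u n])
      then show ?thesis by (subst (asm) integrable_distr_eq) auto
    qed
    have "(\<lambda>p::real \<times> (real^'n). K' (x + fst p *\<^sub>R ?e - snd p)) \<in> borel_measurable borel"
      by (rule measurable_compose[OF _ m(2)]) (auto intro!: borel_measurable_continuous_onI continuous_intros)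
    moreover have "(\<lambda>p::real \<times> (real^'n). u (snd p)) \<in> borel_measurable borel"
      by (rule measurable_compose[OF measurable_snd_borel]) simp
    ultimately show "(\<lambda>(r, y). K' (x + r *\<^sub>R ?e - y) * u y) \<in> borel_measurable borel"
      unfolding split_beta' by (intro borel_measurable_times)
    show "(\<integral>\<^sup>+y. ennreal \<bar>K' (x + r *\<^sub>R ?e - y) * u y\<bar> \<partial>lborel) \<le> ennreal (\<integral>y. \<bar>D y\<bar> \<partial>lborel)" if r: "r \<in> {-1..1}" for r
    proof -
      have "norm (r *\<^sub>R ?e) \<le> 1" using r by (auto simp: norm_axis_1)
      then have le: "norm (x + r *\<^sub>R ?e) \<le> norm x + 1" by (rule norm_triangle_le[OF add_left_mono])
      have "(\<integral>\<^sup>+y. ennreal \<bar>K' (x + r *\<^sub>R ?e - y) * u y\<bar> \<partial>lborel) =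
         (\<integral>\<^sup>+y. ennreal \<bar>K' y * u (x + r *\<^sub>R ?e - y)\<bar> \<partial>lborel)"
        by (subst nn_integral_lborel_reflect[of _ "x + r *\<^sub>R ?e", symmetric]) auto
      also have "\<dots> \<le> (\<integral>\<^sup>+y. ennreal \<bar>D y\<bar> \<partial>lborel)"
        by (intro nn_integral_mono ennreal_leI order_trans[OF D(2)[OF le] abs_ge_self])
      also have "\<dots> = ennreal (\<integral>y. \<bar>D y\<bar> \<partial>lborel)"
        using D(1) by (intro nn_integral_eq_integral) auto
      finally show ?thesis .
    qed
    show "continuous_on {-1..1} (\<lambda>r. \<integral>y. K' (x + r *\<^sub>R ?e - y) * u y \<partial>lborel)"
      using conv_continuous_on_line[OF K' u n, of x ?e] by (simp add: conv_commute)
    show "AE y in lborel. \<forall>r\<in>{-1..1}. ((\<lambda>r. K (x + r *\<^sub>R ?e - y) * u y) has_real_derivative K' (x + r *\<^sub>R ?e - y) * u y) (at r within {-1..1})"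
      using avoids
    proof (eventually_elim)
      case (elim y)
      show ?case
      proof
        fix r :: real
        have "((\<lambda>s. K ((x - y + r *\<^sub>R ?e) + s *\<^sub>R ?e)) has_real_derivative K' (x - y + r *\<^sub>R ?e)) (at 0)"
          using elim by (intro der) auto
        then have "((\<lambda>s. K ((x - y) + s *\<^sub>R ?e)) has_real_derivative K' (x - y + r *\<^sub>R ?e)) (at r)"
          using DERIV_shift[of "\<lambda>s. K ((x - y) + s *\<^sub>R ?e)" _ 0 r] by (simp add: algebra_simps)
        then have "((\<lambda>r. K (x + r *\<^sub>R ?e - y) * u y) has_real_derivative K' (x + r *\<^sub>R ?e - y) * u y) (at r)"
          by (intro DERIV_cmult_right) (simp add: algebra_simps)
        then show "((\<lambda>r. K (x + r *\<^sub>R ?e - y) * u y) has_real_derivative K' (x + r *\<^sub>R ?e - y) * u y) (at r within {-1..1})"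
          by (rule has_field_derivative_at_within)
      qed
    qed
    show "AE y in lborel. continuous_on {-1..1} (\<lambda>r. K' (x + r *\<^sub>R ?e - y) * u y)"
      using avoids
    proof (eventually_elim)
      case (elim y)
      have "x + r *\<^sub>R ?e - y \<in> -{0}" for r using elim by (auto simp: algebra_simps)
      then show ?case
        by (intro continuous_intros continuous_on_compose2[OF cK']) auto
    qed
  qed
  then show ?thesis by (simp add: conv_commute)
qed

text \<open>Both sides are the derivative of the same function \<open>s \<mapsto> conv K u (x + s e)\<close>; no boundary term
around the singularity has to be discussed.\<close>

lemma conv_integration_by_parts:
  fixes K K' u u' :: "real ^ 'n::finite \<Rightarrow> real"
  assumes K: "riesz K" and K': "riesz K'" and u: "Ck_decay 0 CARD('n) u" and u': "Ck_decay 0 CARD('n) u'"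
    and n: "4 \<le> CARD('n)"
    and derK: "\<And>z. z \<noteq> 0 \<Longrightarrow> ((\<lambda>s. K (z + s *\<^sub>R axis i 1)) has_real_derivative K' z) (at 0)"
    and cK': "continuous_on (-{0}) K'"
    and deru: "\<And>z s. ((\<lambda>s. u (z + s *\<^sub>R axis i 1)) has_real_derivative u' (z + s *\<^sub>R axis i 1)) (at s)"
  shows "conv K u' x = conv K' u x"
  using DERIV_unique[OF conv_derivative_right[OF K u u' n deru] conv_derivative_left[OF K K' u n derK cK']] .

lemma rieszI:
  fixes K :: "real ^ 'n::finite \<Rightarrow> real"
  assumes "K \<in> borel_measurable borel" "K 0 = 0"
    and le: "\<And>y. y \<noteq> 0 \<Longrightarrow> \<bar>K y\<bar> * norm y ^ (CARD('n) - 1) \<le> C * (1 + norm y)\<^sup>2"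
  shows "riesz K"
proof -
  have "\<bar>K y\<bar> \<le> \<bar>C\<bar> * ((1 + norm y)\<^sup>2 / norm y ^ (CARD('n) - 1))" for y
  proof (cases "y = 0")
    case True
    then show ?thesis using assms(2) by simp
  next
    case False
    have "\<bar>K y\<bar> * norm y ^ (CARD('n) - 1) \<le> \<bar>C\<bar> * (1 + norm y)\<^sup>2"
      by (intro order_trans[OF le[OF False]] mult_right_mono) auto
    moreover have "0 < norm y ^ (CARD('n) - 1)" using False by simp
    ultimately show ?thesis by (simp add: pos_le_divide_eq)
  qed
  then show ?thesis using assms(1) by (auto simp: riesz_def)
qed

section \<open>The Green's function\<close>

definition green_coeff :: "'n::finite itself \<Rightarrow> real" where
  "green_coeff _ = - 1 / ((real CARD('n) - 2) * (real CARD('n) * unit_ball_vol (real CARD('n))))"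

text \<open>The partial derivative \<open>\<partial>\<^sub>i G\<close> away from the origin, with the value \<open>0\<close> there.\<close>

definition dgreen :: "'n::finite \<Rightarrow> real ^ 'n \<Rightarrow> real" where
  "dgreen i y = - (green_coeff TYPE('n) * (real CARD('n) - 2)) * y $ i / norm y ^ CARD('n)"

lemma green_eq: "green (x :: real ^ 'n::finite) = green_coeff TYPE('n) / norm x ^ (CARD('n) - 2)"
  by (simp add: green_def green_coeff_def)

lemma one_plus_norm_square:
  "1 \<le> (1 + norm y)\<^sup>2" "norm y \<le> (1 + norm y)\<^sup>2" "norm y * norm y \<le> (1 + norm y)\<^sup>2"
  using zero_le_square[of "norm y"] norm_ge_zero[of y] by (auto simp: power2_eq_square algebra_simps)

lemma power_dim_split:
  fixes s :: real
  assumes "2 \<le> n"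
  shows "s ^ (n - 1) = s ^ (n - 2) * s" "s ^ n = s ^ (n - 1) * s"
proof -
  obtain k where "n = Suc (Suc k)" using assms by (metis add_2_eq_Suc le_Suc_ex)
  then show "s ^ (n - 1) = s ^ (n - 2) * s" "s ^ n = s ^ (n - 1) * s" by simp_all
qed

lemma green_measurable [measurable]: "(green :: real ^ 'n::finite \<Rightarrow> real) \<in> borel_measurable borel"
  unfolding green_eq[abs_def] by measurable

lemma component_measurable [measurable]: "(\<lambda>y :: real ^ 'n::finite. y $ i) \<in> borel_measurable borel"
  by (intro borel_measurable_continuous_onI continuous_intros)

lemma dgreen_measurable [measurable]: "dgreen i \<in> borel_measurable borel"
  unfolding dgreen_def[abs_def] by measurable

context
  assumes n: "4 \<le> CARD('n::finite)"
begin

lemma green_0: "green (0 :: real ^ 'n) = 0"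
  using n by (simp add: green_eq power_0_left)

lemma dgreen_0: "dgreen i (0 :: real ^ 'n) = 0"
  by (simp add: dgreen_def)

lemma green_times_norm_power:
  assumes "y \<noteq> 0"
  shows "\<bar>green y\<bar> * norm y ^ (CARD('n) - 1) = \<bar>green_coeff TYPE('n)\<bar> * norm (y :: real ^ 'n)"
  using assms n power_dim_split(1)[of "CARD('n)" "norm y"] by (simp add: green_eq abs_divide)

lemma dgreen_times_norm_power:
  fixes y :: "real ^ 'n"
  assumes "y \<noteq> 0"
  shows "\<bar>dgreen i y\<bar> * norm y ^ (CARD('n) - 1) \<le> \<bar>green_coeff TYPE('n) * (real CARD('n) - 2)\<bar>"
proof -
  have "\<bar>dgreen i y\<bar> * norm y ^ (CARD('n) - 1) = \<bar>green_coeff TYPE('n) * (real CARD('n) - 2)\<bar> * (\<bar>y $ i\<bar> / norm y)"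
    using assms n power_dim_split(2)[of "CARD('n)" "norm y"] by (simp add: dgreen_def abs_mult)
  also have "\<dots> \<le> \<bar>green_coeff TYPE('n) * (real CARD('n) - 2)\<bar> * 1"
    using assms component_le_norm_cart[of y i] by (intro mult_left_mono) auto
  finally show ?thesis by simp
qed

lemma riesz_green: "riesz (green :: real ^ 'n \<Rightarrow> real)"
proof (rule rieszI)
  fix y :: "real ^ 'n" assume y: "y \<noteq> 0"
  show "\<bar>green y\<bar> * norm y ^ (CARD('n) - 1) \<le> \<bar>green_coeff TYPE('n)\<bar> * (1 + norm y)\<^sup>2"
    unfolding green_times_norm_power[OF y] by (intro mult_left_mono one_plus_norm_square) auto
qed (auto simp: green_0)

lemma riesz_dgreen: "riesz (dgreen i :: real ^ 'n \<Rightarrow> real)"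
proof (rule rieszI)
  fix y :: "real ^ 'n" assume y: "y \<noteq> 0"
  have "\<bar>green_coeff TYPE('n) * (real CARD('n) - 2)\<bar> * 1 \<le> \<bar>green_coeff TYPE('n) * (real CARD('n) - 2)\<bar> * (1 + norm y)\<^sup>2"
    by (intro mult_left_mono one_plus_norm_square) auto
  then show "\<bar>dgreen i y\<bar> * norm y ^ (CARD('n) - 1) \<le> \<bar>green_coeff TYPE('n) * (real CARD('n) - 2)\<bar> * (1 + norm y)\<^sup>2"
    using dgreen_times_norm_power[OF y, of i] by simp
qed (auto simp: dgreen_0)

lemma riesz_component_green: "riesz (\<lambda>y :: real ^ 'n. y $ i * green y)"
proof (rule rieszI)
  fix y :: "real ^ 'n" assume y: "y \<noteq> 0"
  have "\<bar>y $ i * green y\<bar> * norm y ^ (CARD('n) - 1) = \<bar>y $ i\<bar> * (\<bar>green_coeff TYPE('n)\<bar> * norm y)"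
    using green_times_norm_power[OF y] by (simp add: abs_mult mult.assoc)
  also have "\<dots> \<le> norm y * (\<bar>green_coeff TYPE('n)\<bar> * norm y)"
    by (intro mult_right_mono component_le_norm_cart) auto
  also have "\<dots> = \<bar>green_coeff TYPE('n)\<bar> * (norm y * norm y)" by simp
  also have "\<dots> \<le> \<bar>green_coeff TYPE('n)\<bar> * (1 + norm y)\<^sup>2"
    by (intro mult_left_mono one_plus_norm_square) auto
  finally show "\<bar>y $ i * green y\<bar> * norm y ^ (CARD('n) - 1) \<le> \<bar>green_coeff TYPE('n)\<bar> * (1 + norm y)\<^sup>2" .
qed auto

lemma riesz_component_dgreen: "riesz (\<lambda>y :: real ^ 'n. y $ i * dgreen j y)"
proof (rule rieszI)
  let ?c = "\<bar>green_coeff TYPE('n) * (real CARD('n) - 2)\<bar>"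
  fix y :: "real ^ 'n" assume y: "y \<noteq> 0"
  have "\<bar>y $ i * dgreen j y\<bar> * norm y ^ (CARD('n) - 1) = \<bar>y $ i\<bar> * (\<bar>dgreen j y\<bar> * norm y ^ (CARD('n) - 1))"
    by (simp add: abs_mult mult.assoc)
  also have "\<dots> \<le> norm y * ?c"
    by (intro mult_mono component_le_norm_cart dgreen_times_norm_power y) auto
  also have "\<dots> \<le> (1 + norm y)\<^sup>2 * ?c"
    by (intro mult_right_mono one_plus_norm_square) auto
  finally show "\<bar>y $ i * dgreen j y\<bar> * norm y ^ (CARD('n) - 1) \<le> ?c * (1 + norm y)\<^sup>2"
    by (simp add: mult.commute)
qed auto

lemma green_derivative:
  fixes z :: "real ^ 'n"
  assumes "z \<noteq> 0"
  shows "((\<lambda>s. green (z + s *\<^sub>R axis i 1)) has_real_derivative dgreen i z) (at 0)"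
proof -
  have "((\<lambda>s::real. z + s *\<^sub>R axis i 1) has_derivative (\<lambda>s. s *\<^sub>R axis i 1)) (at 0)"
    by (auto intro!: derivative_eq_intros)
  from diff_chain_at[OF this, of norm "\<lambda>h. h \<bullet> sgn z"] has_derivative_norm[OF assms]
  have "((\<lambda>s. norm (z + s *\<^sub>R axis i 1)) has_derivative (\<lambda>s. s *\<^sub>R axis i 1 \<bullet> sgn z)) (at 0)"
    by (simp add: o_def)
  then have N: "((\<lambda>s. norm (z + s *\<^sub>R axis i 1)) has_real_derivative z $ i / norm z) (at 0)"
    unfolding has_field_derivative_def
    by (rule has_derivative_eq_rhs) (auto simp: sgn_div_norm inner_axis' fun_eq_iff divide_inverse mult_ac)
  obtain k where k: "CARD('n) = Suc (Suc (Suc k))"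
  proof
    show "CARD('n) = Suc (Suc (Suc (CARD('n) - 3)))" using n by simp
  qed
  let ?c = "green_coeff TYPE('n)" and ?r = "norm z"
  have "((\<lambda>s. ?c / norm (z + s *\<^sub>R axis i 1) ^ Suc k) has_real_derivative
      (0 * ?r ^ Suc k - ?c * (real (Suc k) * (z $ i / ?r * ?r ^ k))) / (?r ^ Suc k * ?r ^ Suc k)) (at 0)"
    using DERIV_divide[OF DERIV_const DERIV_power[OF N, of "Suc k"], of ?c] assms by simp
  moreover have "(0 * ?r ^ Suc k - ?c * (real (Suc k) * (z $ i / ?r * ?r ^ k))) / (?r ^ Suc k * ?r ^ Suc k) = dgreen i z"
    using assms by (simp add: dgreen_def k field_simps)
  ultimately have "((\<lambda>s. ?c / norm (z + s *\<^sub>R axis i 1) ^ Suc k) has_real_derivative dgreen i z) (at 0)"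
    by simp
  then show ?thesis by (simp add: green_eq k)
qed

lemma continuous_on_dgreen: "continuous_on (- {0}) (dgreen i :: real ^ 'n \<Rightarrow> real)"
  unfolding dgreen_def[abs_def] by (intro continuous_intros) auto

lemma continuous_on_green: "continuous_on (- {0}) (green :: real ^ 'n \<Rightarrow> real)"
  unfolding green_eq[abs_def] by (intro continuous_intros) auto

lemma component_dgreen_commute: "y $ i * dgreen j y = y $ j * dgreen i (y :: real ^ 'n)"
  by (simp add: dgreen_def)

text \<open>Euler's identity for \<open>G\<close>, which is homogeneous of degree \<open>2 - n\<close>.\<close>

lemma sum_component_dgreen: "(\<Sum>i\<in>UNIV. y $ i * dgreen i (y :: real ^ 'n)) = (2 - real CARD('n)) * green y"
proof (cases "y = 0")
  case True
  then show ?thesis by (simp add: green_0)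
next
  case False
  have "(\<Sum>i\<in>UNIV. y $ i * y $ i) = norm y * norm y"
    using power2_norm_eq_inner[of y] by (simp add: inner_vec_def power2_eq_square)
  moreover have "y $ i * dgreen i y = - (green_coeff TYPE('n) * (real CARD('n) - 2)) / norm y ^ CARD('n) * (y $ i * y $ i)" for i
    by (simp add: dgreen_def)
  ultimately have "(\<Sum>i\<in>UNIV. y $ i * dgreen i y) =
      - (green_coeff TYPE('n) * (real CARD('n) - 2)) / norm y ^ CARD('n) * (norm y * norm y)"
    by (simp only: sum_distrib_left[symmetric])
  also have "\<dots> = (2 - real CARD('n)) * green y"
    using False power_dim_split[of "CARD('n)" "norm y"] n
    by (simp add: green_eq field_simps)
  finally show ?thesis .
qed

end

section \<open>Commuting the vector fields with the potential\<close>

lemma rho_add: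
  fixes g h :: "'n::finite phase \<Rightarrow> real"
  assumes "Ck_decay 0 (2 * CARD('n) + 1) g" "Ck_decay 0 (2 * CARD('n) + 1) h"
  shows "rho (\<lambda>z. g z + h z) x = rho g x + rho h x"
  unfolding rho_def by (rule Bochner_Integration.integral_add fibre_integrable assms)+

lemma rho_cmult: "rho (\<lambda>z. c * g z) x = c * rho g x"
  unfolding rho_def by (rule integral_mult_right_zero)

lemma rho_component_mult: "rho (\<lambda>z. fst z $ i * g z) x = x $ i * rho g x"
  unfolding rho_def fst_conv by (rule integral_mult_right_zero)

definition pot :: "('n::finite phase \<Rightarrow> real) \<Rightarrow> real ^ 'n \<Rightarrow> real" where
  "pot g = conv green (rho g)"

text \<open>The value for \<open>Scaling\<close> is the sum of \<open>2\<close>, because convolution with \<open>G\<close> raises the degree of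
homogeneity by two, and of \<open>n\<close>, which compensates that \<open>\<rho>(\<Sum>\<^sub>i v\<^sub>i \<partial>\<^sub>v\<^sub>i g) = - n \<rho>(g)\<close>.\<close>

fun comm_const :: "'n::finite vfield \<Rightarrow> real" where
  "comm_const Scaling = real CARD('n) + 2"
| "comm_const _ = 0"

context
  assumes n: "4 \<le> CARD('n::finite)"
begin

lemma pot_lin:
  fixes g h :: "'n phase \<Rightarrow> real"
  assumes g: "Ck_decay 0 (2 * CARD('n) + 1) g" and h: "Ck_decay 0 (2 * CARD('n) + 1) h"
  shows "pot (\<lambda>z. a * g z + c * h z) x = a * pot g x + c * pot h x"
proof -
  have "rho (\<lambda>z. a * g z + c * h z) y = a * rho g y + c * rho h y" for y
    using rho_add[OF Ck_decay_cmult[OF g, of a] Ck_decay_cmult[OF h, of c]] by (simp add: rho_cmult)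
  then have "pot (\<lambda>z. a * g z + c * h z) x =
      (\<integral>y. a * (green y * rho g (x - y)) + c * (green y * rho h (x - y)) \<partial>lborel)"
    by (simp add: pot_def conv_def algebra_simps)
  also have "\<dots> = a * pot g x + c * pot h x"
    unfolding pot_def conv_def
    by (subst Bochner_Integration.integral_add)
       (auto intro!: integrable_mult_right conv_integrable[OF riesz_green[OF n] Ck_decay_rho n] g h simp del: Ck_decay.simps)
  finally show ?thesis .
qed

lemma pot_sum:
  fixes g :: "'i \<Rightarrow> 'n phase \<Rightarrow> real"
  assumes "\<And>i. i \<in> I \<Longrightarrow> Ck_decay 0 (2 * CARD('n) + 1) (g i)"
  shows "pot (\<lambda>z. \<Sum>i\<in>I. g i z) x = (\<Sum>i\<in>I. pot (g i) x)"
  using assms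
proof (induction I rule: infinite_finite_induct)
  case (insert i I)
  have "Ck_decay 0 (2 * CARD('n) + 1) (\<lambda>z. \<Sum>i\<in>I. g i z)"
    using insert.prems by (intro Ck_decay_sum) auto
  with insert show ?case
    using pot_lin[of "g i" "\<lambda>z. \<Sum>i\<in>I. g i z" 1 1 x] by (simp del: Ck_decay.simps)
qed (simp_all add: pot_def conv_def rho_def)

lemma pot_derivative:
  fixes g :: "'n phase \<Rightarrow> real"
  assumes g: "Ck_decay 0 (2 * CARD('n) + 1) g"
  shows "ds i (pot g) x = conv (dgreen i) (rho g) x"
  unfolding pot_def pd_def
  by (rule DERIV_imp_deriv conv_derivative_left riesz_green riesz_dgreen Ck_decay_rho g n green_derivative continuous_on_dgreen | assumption)+

text \<open>Under the integral, \<open>x\<^sub>i\<close> is split as \<open>(x - y)\<^sub>i + y\<^sub>i\<close>. The first part multiplies the density; in the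
second, \<open>y\<^sub>i G\<close> is a new kernel onto which the derivative is moved by parts. What remains is the kernel
\<open>y\<^sub>i \<partial>\<^sub>j G\<close>, symmetric in \<open>i\<close> and \<open>j\<close>, so it cancels for rotations and is summed by Euler's identity
for the scaling field.\<close>

lemma component_pot_derivative:
  fixes g :: "'n phase \<Rightarrow> real"
  assumes g: "Ck_decay 1 (2 * CARD('n) + 2) g"
  shows "x $ i * ds j (pot g) x =
    pot (\<lambda>z. fst z $ i * dx j g z) x + (if i = j then pot g x else 0) + conv (\<lambda>y. y $ i * dgreen j y) (rho g) x"
proof -
  let ?u = "rho g" and ?u' = "rho (dx j g)"
  have g1: "Ck_decay 1 (2 * CARD('n) + 1) g" and g0: "Ck_decay 0 (2 * CARD('n) + 1) g"
    by (rule Ck_decay_mono[OF g]; simp)+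
  have dg': "Ck_decay 0 (2 * CARD('n) + 2) (dx j g)"
    using Ck_decay_pd[OF g[unfolded One_nat_def]] basis_phase(1) by blast
  have dg: "Ck_decay 0 (2 * CARD('n) + 1) (dx j g)"
    by (rule Ck_decay_mono[OF dg']) auto
  have xdg: "Ck_decay 0 (2 * CARD('n) + 1) (\<lambda>z. fst z $ i * dx j g z)"
    unfolding fst_component by (rule Ck_decay_inner_mult) (use dg' basis_phase in auto)
  have u: "Ck_decay 0 CARD('n) ?u" and u': "Ck_decay 0 CARD('n) ?u'"
    by (rule Ck_decay_rho g0 dg)+
  have du: "((\<lambda>s. ?u (z + s *\<^sub>R axis j 1)) has_real_derivative ?u' (z + s *\<^sub>R axis j 1)) (at s)" for z s
    by (rule rho_line_derivative[OF g1 basis_phase(1)])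
  have "ds j (pot g) x = conv green ?u' x"
    unfolding pot_def pd_def[of "axis j 1"]
    by (rule DERIV_imp_deriv[OF conv_derivative_right[OF riesz_green[OF n] u u' n du]])
  then have "x $ i * ds j (pot g) x = (\<integral>y. x $ i * (green y * ?u' (x - y)) \<partial>lborel)"
    by (simp add: conv_def)
  also have "\<dots> = (\<integral>y. green y * rho (\<lambda>z. fst z $ i * dx j g z) (x - y) + (y $ i * green y) * ?u' (x - y) \<partial>lborel)"
    by (simp add: rho_component_mult algebra_simps)
  also have "\<dots> = pot (\<lambda>z. fst z $ i * dx j g z) x + conv (\<lambda>y. y $ i * green y) ?u' x"
    unfolding pot_def conv_def
    by (rule Bochner_Integration.integral_add conv_integrable riesz_green riesz_component_green Ck_decay_rho n xdg dg)+
  also have "conv (\<lambda>y. y $ i * green y) ?u' x =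
      conv (\<lambda>y. (if i = j then green y else 0) + y $ i * dgreen j y) ?u x"
  proof (rule conv_integration_by_parts[OF _ _ u u' n _ _ du])
    show "riesz (\<lambda>y :: real^'n. y $ i * green y)" by (rule riesz_component_green[OF n])
    show "riesz (\<lambda>y. (if i = j then green y else 0) + y $ i * dgreen j y)"
      using riesz_add[OF riesz_green[OF n] riesz_component_dgreen[OF n]] riesz_component_dgreen[OF n]
      by (cases "i = j") simp_all
    show "continuous_on (- {0}) (\<lambda>y. (if i = j then green y else 0) + y $ i * dgreen j y)"
      using continuous_on_green[OF n] continuous_on_dgreen[OF n] by (cases "i = j") (auto intro!: continuous_intros)
    fix z :: "real^'n" assume z: "z \<noteq> 0"
    have "((\<lambda>s. (z + s *\<^sub>R axis j 1) $ i) has_real_derivative (if i = j then 1 else 0)) (at 0)"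
      by (auto intro!: derivative_eq_intros simp: axis_def)
    from DERIV_mult[OF this green_derivative[OF n z]]
    show "((\<lambda>s. (z + s *\<^sub>R axis j 1) $ i * green (z + s *\<^sub>R axis j 1)) has_real_derivative
        (if i = j then green z else 0) + z $ i * dgreen j z) (at 0)"
      by (rule DERIV_cong) auto
  qed
  also have "\<dots> = (if i = j then pot g x else 0) + conv (\<lambda>y. y $ i * dgreen j y) ?u x"
  proof (cases "i = j")
    case True
    have "conv (\<lambda>y. green y + y $ i * dgreen j y) ?u x = conv green ?u x + conv (\<lambda>y. y $ i * dgreen j y) ?u x"
      unfolding conv_def distrib_right
      by (rule Bochner_Integration.integral_add conv_integrable riesz_green riesz_component_dgreen u n)+
    then show ?thesis using True by (simp add: pot_def)
  qed simp
  finally show ?thesis by simp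
qed

lemma pot_velocity_derivative_eq_0:
  fixes g :: "'n phase \<Rightarrow> real"
  assumes g: "Ck_decay 1 (2 * CARD('n) + 1) g"
  shows "pot (dv i g) x = 0"
  using rho_velocity_derivative_eq_0[OF g basis_phase(2)] by (simp add: pot_def conv_def)

text \<open>The average of \<open>\<partial>\<^sub>v\<^sub>j (v\<^sub>i g)\<close> over the velocities vanishes.\<close>

lemma pot_component_velocity_derivative:
  fixes g :: "'n phase \<Rightarrow> real"
  assumes g: "Ck_decay 1 (2 * CARD('n) + 2) g"
  shows "pot (\<lambda>z. snd z $ i * dv j g z) x = - (if i = j then pot g x else 0)"
proof -
  have g0: "Ck_decay 0 (2 * CARD('n) + 1) g" by (rule Ck_decay_mono[OF g]) auto
  have dg: "Ck_decay 0 (Suc (2 * CARD('n) + 1)) (dv j g)"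
    using Ck_decay_pd[OF g[unfolded One_nat_def] basis_phase(2), of j] by (simp del: Ck_decay.simps)
  have vdg: "Ck_decay 0 (2 * CARD('n) + 1) (\<lambda>z. snd z $ i * dv j g z)"
    unfolding snd_component by (rule Ck_decay_inner_mult[OF basis_phase(2) dg])
  have vg: "Ck_decay 1 (2 * CARD('n) + 1) (\<lambda>z. snd z $ i * g z)"
    unfolding snd_component by (rule Ck_decay_inner_mult[OF basis_phase(2)]) (use g in simp)
  have "dv j (\<lambda>z. snd z $ i * g z) = (\<lambda>z. (if i = j then 1 else 0) * g z + 1 * (snd z $ i * dv j g z))"
    unfolding snd_component
    by (intro ext, subst pd_inner_mult[OF Ck_decay_differentiable[OF g[unfolded One_nat_def]]])
       (simp add: inner_axis_axis)
  then have "0 = (if i = j then 1 else 0) * pot g x + 1 * pot (\<lambda>z. snd z $ i * dv j g z) x"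
    using pot_velocity_derivative_eq_0[OF vg, of j x] by (simp only: pot_lin[OF g0 vdg])
  then show ?thesis by (cases "i = j") auto
qed

lemma Zs_pot:
  fixes g :: "'n phase \<Rightarrow> real"
  assumes g: "Ck_decay 1 (2 * CARD('n) + 2) g"
  shows "Zs t Z (pot g) x = pot (\<lambda>z. Zf t Z g z + comm_const Z * g z) x"
proof -
  have g1: "Ck_decay 1 (2 * CARD('n) + 1) g" and g0: "Ck_decay 0 (2 * CARD('n) + 1) g"
    by (rule Ck_decay_mono[OF g]; simp)+
  have dg': "Ck_decay 0 (Suc (2 * CARD('n) + 1)) (dx j g)" "Ck_decay 0 (Suc (2 * CARD('n) + 1)) (dv j g)" for j
    using Ck_decay_pd[OF g[unfolded One_nat_def] basis_phase(1), of j]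
      Ck_decay_pd[OF g[unfolded One_nat_def] basis_phase(2), of j] by (simp_all del: Ck_decay.simps)
  have dg: "Ck_decay 0 (2 * CARD('n) + 1) (dx j g)" "Ck_decay 0 (2 * CARD('n) + 1) (dv j g)" for j
    using dg'[of j] by (auto intro: Ck_decay_mono simp del: Ck_decay.simps)
  have zdg: "Ck_decay 0 (2 * CARD('n) + 1) (\<lambda>z. fst z $ i * dx j g z)"
      "Ck_decay 0 (2 * CARD('n) + 1) (\<lambda>z. snd z $ i * dv j g z)" for i j
    unfolding fst_component snd_component by (rule Ck_decay_inner_mult basis_phase dg')+
  have ds_pot: "ds i (pot g) x = pot (dx i g) x" for i
    unfolding pot_def pd_def[of "axis i 1"]
    by (rule DERIV_imp_deriv conv_derivative_right riesz_green Ck_decay_rho g0 dg n rho_line_derivative g1 basis_phase)+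
  show ?thesis
  proof (cases Z)
    case (Translation i)
    then show ?thesis by (simp add: ds_pot)
  next
    case (Galilean i)
    then show ?thesis
      using pot_lin[OF dg, of t i 1 i x] by (simp add: ds_pot pot_velocity_derivative_eq_0[OF g1])
  next
    case (Rotation i j)
    let ?a = "\<lambda>i j z. fst z $ i * dx j g z" and ?b = "\<lambda>i j z. snd z $ i * dv j g z"
    have "Zs t Z (pot g) x = pot (?a i j) x - pot (?a j i) x"
      unfolding Rotation Zs.simps component_pot_derivative[OF g]
      by (simp add: component_dgreen_commute[OF n, of _ i j])
    also have "\<dots> = (1 * pot (?a i j) x + (- 1) * pot (?a j i) x) + (1 * pot (?b i j) x + (- 1) * pot (?b j i) x)"
      by (simp add: pot_component_velocity_derivative[OF g])
    also have "\<dots> = 1 * pot (\<lambda>z. 1 * ?a i j z + (- 1) * ?a j i z) x + 1 * pot (\<lambda>z. 1 * ?b i j z + (- 1) * ?b j i z) x"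
      by (simp only: pot_lin zdg) simp
    also have "\<dots> = pot (\<lambda>z. 1 * (1 * ?a i j z + (- 1) * ?a j i z) + 1 * (1 * ?b i j z + (- 1) * ?b j i z)) x"
      by (rule pot_lin[symmetric]; intro Ck_decay_add Ck_decay_cmult zdg)
    finally show ?thesis by (simp add: Rotation)
  next
    case Scaling
    let ?a = "\<lambda>i z. fst z $ i * dx i g z" and ?b = "\<lambda>i z. snd z $ i * dv i g z"
    have s: "(\<Sum>i\<in>UNIV. conv (\<lambda>y. y $ i * dgreen i y) (rho g) x) = (2 - real CARD('n)) * pot g x"
    proof -
      have "(\<Sum>i\<in>UNIV. conv (\<lambda>y. y $ i * dgreen i y) (rho g) x) =
          (\<integral>y. (\<Sum>i\<in>UNIV. y $ i * dgreen i y * rho g (x - y)) \<partial>lborel)"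
        unfolding conv_def
        by (rule Bochner_Integration.integral_sum[symmetric] conv_integrable riesz_component_dgreen Ck_decay_rho g0 n)+
      also have "\<dots> = (\<integral>y. (2 - real CARD('n)) * (green y * rho g (x - y)) \<partial>lborel)"
        unfolding sum_distrib_right[symmetric] sum_component_dgreen[OF n] by (simp add: mult.assoc)
      finally show ?thesis by (simp add: pot_def conv_def)
    qed
    have "Zs t Z (pot g) x = (\<Sum>i\<in>UNIV. pot (?a i) x) + real CARD('n) * pot g x + (2 - real CARD('n)) * pot g x"
      unfolding Scaling Zs.simps component_pot_derivative[OF g] by (simp add: sum.distrib s)
    also have "\<dots> = 1 * (1 * (\<Sum>i\<in>UNIV. pot (?a i) x) + 1 * (\<Sum>i\<in>UNIV. pot (?b i) x)) + (real CARD('n) + 2) * pot g x"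
      by (simp add: pot_component_velocity_derivative[OF g] sum_negf algebra_simps)
    also have "\<dots> = 1 * (1 * pot (\<lambda>z. \<Sum>i\<in>UNIV. ?a i z) x + 1 * pot (\<lambda>z. \<Sum>i\<in>UNIV. ?b i z) x) + (real CARD('n) + 2) * pot g x"
      by (simp only: pot_sum zdg)
    also have "\<dots> = 1 * pot (\<lambda>z. 1 * (\<Sum>i\<in>UNIV. ?a i z) + 1 * (\<Sum>i\<in>UNIV. ?b i z)) x + (real CARD('n) + 2) * pot g x"
      by (subst pot_lin; intro Ck_decay_sum zdg refl)
    also have "\<dots> = pot (\<lambda>z. 1 * (1 * (\<Sum>i\<in>UNIV. ?a i z) + 1 * (\<Sum>i\<in>UNIV. ?b i z)) + (real CARD('n) + 2) * g z) x"
      by (rule pot_lin[symmetric]; intro Ck_decay_add Ck_decay_cmult Ck_decay_sum zdg g0)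
    finally show ?thesis by (simp add: Scaling)
  qed
qed

end

text \<open>The function \<open>w\<close> with \<open>Z\<^sup>\<gamma> (G * \<rho>(g)) = G * \<rho>(w)\<close>. It is kept as an iteration of \<open>Z + c\<^sub>Z\<close> instead of an
expanded linear combination of the \<open>Z\<^sup>\<alpha> g\<close>.\<close>

fun corrected :: "real \<Rightarrow> 'n::finite vfield list \<Rightarrow> ('n phase \<Rightarrow> real) \<Rightarrow> 'n phase \<Rightarrow> real" where
  "corrected t [] g = g"
| "corrected t (Z # \<gamma>) g = (\<lambda>z. Zf t Z (corrected t \<gamma> g) z + comm_const Z * corrected t \<gamma> g z)"

lemma Ck_decay_corrected:
  "Ck_decay (k + length \<gamma>) (m + length \<gamma>) g \<Longrightarrow> Ck_decay k m (corrected t \<gamma> g)"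
proof (induction \<gamma> arbitrary: k m)
  case (Cons Z \<gamma>)
  have w: "Ck_decay (Suc k) (Suc m) (corrected t \<gamma> g)"
    by (rule Cons.IH) (use Cons.prems in \<open>simp del: Ck_decay.simps\<close>)
  show ?case
    unfolding corrected.simps
    by (intro Ck_decay_add Ck_decay_cmult Ck_decay_Zf[OF w]) (rule Ck_decay_mono[OF w]; simp)
qed simp

lemma Zs_pow_pot:
  fixes g :: "'n::finite phase \<Rightarrow> real"
  assumes n: "4 \<le> CARD('n)"
  shows "Ck_decay (length \<gamma>) (2 * CARD('n) + 1 + length \<gamma>) g \<Longrightarrow> Zs_pow t \<gamma> (pot g) = pot (corrected t \<gamma> g)"
proof (induction \<gamma>)
  case Nil
  then show ?case by (simp add: Zs_pow_def)
next
  case (Cons Z \<gamma>)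
  have w: "Ck_decay 1 (2 * CARD('n) + 2) (corrected t \<gamma> g)"
    by (rule Ck_decay_corrected, rule Ck_decay_mono[OF Cons.prems]) auto
  have "Zs_pow t \<gamma> (pot g) = pot (corrected t \<gamma> g)"
    by (rule Cons.IH, rule Ck_decay_mono[OF Cons.prems]) auto
  then have "Zs_pow t (Z # \<gamma>) (pot g) = Zs t Z (pot (corrected t \<gamma> g))"
    by (simp add: Zs_pow_def)
  also have "\<dots> = pot (corrected t (Z # \<gamma>) g)"
    by (intro ext) (simp add: Zs_pot[OF n w])
  finally show ?case .
qed

lemma L1norm_add_cmult_le:
  fixes g h :: "'a::euclidean_space \<Rightarrow> real"
  assumes [measurable]: "g \<in> borel_measurable borel" "h \<in> borel_measurable borel"
  shows "L1norm (\<lambda>z. g z + c * h z) \<le> L1norm g + ennreal \<bar>c\<bar> * L1norm h"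
proof -
  have "L1norm (\<lambda>z. g z + c * h z) \<le> (\<integral>\<^sup>+z. ennreal \<bar>g z\<bar> + ennreal \<bar>c\<bar> * ennreal \<bar>h z\<bar> \<partial>lborel)"
    unfolding L1norm_def
    by (intro nn_integral_mono)
       (auto simp: ennreal_plus[symmetric] ennreal_mult[symmetric] abs_mult[symmetric] simp del: ennreal_plus intro!: ennreal_leI abs_triangle_ineq)
  also have "\<dots> = L1norm g + ennreal \<bar>c\<bar> * L1norm h"
    by (simp add: L1norm_def nn_integral_add nn_integral_cmult)
  finally show ?thesis .
qed

lemma L1norm_le_energy:
  assumes "\<alpha> \<in> multi_indices N"
  shows "L1norm (Zf_pow t \<alpha> g) \<le> energy N t g"
  unfolding energy_def using assms finite_multi_indices by (intro member_le_sum) auto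

lemma energy_mono: "M \<le> N \<Longrightarrow> energy M t g \<le> energy N t g"
  unfolding energy_def by (intro sum_mono2 finite_multi_indices) (auto simp: multi_indices_def)

lemma Zf_pow_append: "Zf_pow t (\<alpha> @ \<beta>) g = Zf_pow t \<alpha> (Zf_pow t \<beta> g)"
  by (simp add: Zf_pow_def)

lemma comm_const_bounds: "0 \<le> comm_const Z" "comm_const (Z :: 'n::finite vfield) \<le> real CARD('n) + 2"
  by (cases Z; simp)+

text \<open>The additional prefix \<open>\<delta>\<close> makes the induction work: peeling off the outermost factor of \<open>\<gamma>\<close> turns
\<open>Z\<^sup>\<delta> (Z w + c\<^sub>Z w)\<close> into \<open>Z\<^sup>\<delta> Z w\<close>, with a longer prefix, and \<open>c\<^sub>Z Z\<^sup>\<delta> w\<close>. Each step costs a factor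
\<open>1 + c\<^sub>Z \<le> n + 3\<close>.\<close>

lemma L1norm_Zf_pow_corrected:
  fixes g :: "'n::{finite,linorder} phase \<Rightarrow> real"
  assumes "Ck_decay (length \<delta> + length \<gamma>) (length \<delta> + length \<gamma>) g"
    and "set \<delta> \<subseteq> vfields" "set \<gamma> \<subseteq> vfields"
  shows "L1norm (Zf_pow t \<delta> (corrected t \<gamma> g)) \<le>
    ennreal ((real CARD('n) + 3) ^ length \<gamma>) * energy (length \<delta> + length \<gamma>) t g"
  using assms
proof (induction \<gamma> arbitrary: \<delta>)
  case Nil
  then show ?case by (auto intro!: L1norm_le_energy simp: multi_indices_def)
next
  case (Cons Z \<gamma>)
  let ?w = "corrected t \<gamma> g" and ?q = "real CARD('n) + 3" and ?E = "energy (length \<delta> + length (Z # \<gamma>)) t g"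
  have w: "Ck_decay (Suc (length \<delta>)) (Suc (length \<delta>)) ?w"
    by (rule Ck_decay_corrected) (use Cons.prems in \<open>simp del: Ck_decay.simps\<close>)
  have w': "Ck_decay (length \<delta>) (length \<delta>) ?w"
    by (rule Ck_decay_mono[OF w]) auto
  have c: "Ck_decay 0 0 (Zf_pow t \<delta> (Zf t Z ?w))" "Ck_decay 0 0 (Zf_pow t \<delta> ?w)"
    by (rule Ck_decay_Zf_pow; simp del: Ck_decay.simps add: Ck_decay_Zf w w')+
  have "L1norm (Zf_pow t (\<delta> @ [Z]) ?w) \<le> ennreal (?q ^ length \<gamma>) * ?E"
    using Cons.IH[of "\<delta> @ [Z]"] Cons.prems by (simp del: Ck_decay.simps)
  moreover have "L1norm (Zf_pow t \<delta> ?w) \<le> ennreal (?q ^ length \<gamma>) * ?E"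
  proof -
    have "L1norm (Zf_pow t \<delta> ?w) \<le> ennreal (?q ^ length \<gamma>) * energy (length \<delta> + length \<gamma>) t g"
      by (rule Cons.IH, rule Ck_decay_mono[OF Cons.prems(1)]) (use Cons.prems in auto)
    also have "\<dots> \<le> ennreal (?q ^ length \<gamma>) * ?E"
      by (intro mult_left_mono energy_mono) auto
    finally show ?thesis .
  qed
  moreover have "L1norm (Zf_pow t \<delta> (corrected t (Z # \<gamma>) g)) \<le>
      L1norm (Zf_pow t (\<delta> @ [Z]) ?w) + ennreal \<bar>comm_const Z\<bar> * L1norm (Zf_pow t \<delta> ?w)"
    using c unfolding corrected.simps Zf_pow_linear[OF Ck_decay_Zf[OF w] w'] Zf_pow_snoc
    by (intro L1norm_add_cmult_le borel_measurable_continuous_onI) auto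
  ultimately have "L1norm (Zf_pow t \<delta> (corrected t (Z # \<gamma>) g)) \<le>
      ennreal (?q ^ length \<gamma>) * ?E + ennreal (?q - 1) * (ennreal (?q ^ length \<gamma>) * ?E)"
    using comm_const_bounds[of Z] by (elim order_trans) (intro add_mono mult_mono ennreal_leI, auto)
  also have "\<dots> = ennreal (?q ^ length (Z # \<gamma>)) * ?E"
  proof -
    have "ennreal (?q ^ length \<gamma>) * ?E + ennreal (?q - 1) * (ennreal (?q ^ length \<gamma>) * ?E) =
        (ennreal 1 + ennreal (?q - 1)) * ennreal (?q ^ length \<gamma>) * ?E"
      by (simp add: distrib_right mult.assoc)
    also have "ennreal 1 + ennreal (?q - 1) = ennreal ?q"
      by (subst ennreal_plus[symmetric]) auto
    also have "ennreal ?q * ennreal (?q ^ length \<gamma>) = ennreal (?q ^ length (Z # \<gamma>))"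
      by (subst ennreal_mult[symmetric]) auto
    finally show ?thesis .
  qed
  finally show ?case .
qed

section \<open>Dispersive decay of velocity averages\<close>

lemma abs_le_nn_integral_derivative:
  fixes h h' :: "real \<Rightarrow> real"
  assumes der: "\<And>s. (h has_real_derivative h' s) (at s)" and c: "continuous_on UNIV h'"
    and lim: "(h \<longlongrightarrow> 0) at_top"
  shows "ennreal \<bar>h 0\<bar> \<le> (\<integral>\<^sup>+s. ennreal \<bar>h' s\<bar> \<partial>lborel)"
proof (cases "(\<integral>\<^sup>+s. ennreal \<bar>h' s\<bar> \<partial>lborel)")
  case (real I)
  have le: "\<bar>h 0\<bar> \<le> \<bar>h R\<bar> + I" if R: "0 \<le> R" for R
  proof -
    have cR: "continuous_on {0..R} h'" using c by (rule continuous_on_subset) simp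
    have i: "integrable lborel (\<lambda>s. indicator {0..R} s *\<^sub>R h' s)"
      using borel_integrable_atLeastAtMost'[OF cR] by (simp add: set_integrable_def)
    have "\<bar>h R - h 0\<bar> = \<bar>\<integral>s. indicator {0..R} s *\<^sub>R h' s \<partial>lborel\<bar>"
      using integral_FTC_Icc[OF R _ cR, of h] has_field_derivative_at_within[OF der]
      by (simp add: has_real_derivative_iff_has_vector_derivative)
    then have "ennreal \<bar>h R - h 0\<bar> \<le> (\<integral>\<^sup>+s. ennreal \<bar>indicator {0..R} s *\<^sub>R h' s\<bar> \<partial>lborel)"
      using integral_norm_bound_ennreal[OF i] by simp
    also have "\<dots> \<le> (\<integral>\<^sup>+s. ennreal \<bar>h' s\<bar> \<partial>lborel)"
      by (intro nn_integral_mono ennreal_leI) (auto simp: indicator_def)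
    finally have "\<bar>h R - h 0\<bar> \<le> I"
      using real by simp
    then show ?thesis by linarith
  qed
  have "((\<lambda>R. \<bar>h R\<bar> + I) \<longlongrightarrow> \<bar>0\<bar> + I) at_top"
    by (intro tendsto_add tendsto_rabs lim tendsto_const)
  then have "\<bar>h 0\<bar> \<le> \<bar>0\<bar> + I"
    by (rule tendsto_lowerbound) (use le in \<open>auto intro!: eventually_at_top_linorderI[of 0]\<close>)
  then show ?thesis using real by (simp add: ennreal_leI)
qed simp

lemma decay_tendsto_0_along_line:
  fixes g :: "'a::real_normed_vector \<Rightarrow> real"
  assumes "decay 1 g" "d \<noteq> 0"
  shows "((\<lambda>s. g (z + s *\<^sub>R d)) \<longlongrightarrow> 0) at_top"
proof -
  obtain A where A: "\<And>z. \<bar>g z\<bar> * (1 + norm z) \<le> A" using assms(1) by (auto simp: decay_def)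
  have "filterlim (\<lambda>s. - norm z + norm d * s) at_top at_top"
    by (rule filterlim_tendsto_add_at_top[OF tendsto_const],
        rule filterlim_tendsto_pos_mult_at_top[OF tendsto_const _ filterlim_ident]) (use assms(2) in simp)
  then have "filterlim (\<lambda>s. s * norm d - norm z) at_top at_top"
    by (simp add: mult.commute)
  moreover have "s * norm d - norm z \<le> norm (z + s *\<^sub>R d)" if "0 \<le> s" for s
    using norm_triangle_ineq4[of "z + s *\<^sub>R d" z] that by simp
  then have "eventually (\<lambda>s. s * norm d - norm z \<le> 1 + norm (z + s *\<^sub>R d)) at_top"
    by (intro eventually_at_top_linorderI[of 0]) (auto simp: add_increasing)
  ultimately have "filterlim (\<lambda>s. 1 + norm (z + s *\<^sub>R d)) at_top at_top"
    by (rule filterlim_at_top_mono)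
  then have lim: "((\<lambda>s. A / (1 + norm (z + s *\<^sub>R d))) \<longlongrightarrow> 0) at_top"
    by (intro tendsto_divide_0[OF tendsto_const] filterlim_at_top_imp_at_infinity)
  show ?thesis
  proof (rule Lim_null_comparison[OF _ lim])
    have "norm (g (z + s *\<^sub>R d)) \<le> A / (1 + norm (z + s *\<^sub>R d))" for s
      using A[of "z + s *\<^sub>R d"] by (simp add: pos_le_divide_eq add_pos_nonneg)
    then show "eventually (\<lambda>s. norm (g (z + s *\<^sub>R d)) \<le> A / (1 + norm (z + s *\<^sub>R d))) at_top"
      by simp
  qed
qed

text \<open>The one-dimensional bound is applied to one direction after the other. Since it holds for the
absolute value of the integrand at every point, it can be inserted under the integrals already
present.\<close>

lemma abs_le_iterated_line_integrals:
  fixes g :: "'n::finite phase \<Rightarrow> real" and V :: "'i \<Rightarrow> 'n vfield" and d :: "'i \<Rightarrow> 'n phase"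
  assumes V: "\<And>i h z. (\<And>z. h differentiable (at z)) \<Longrightarrow> Zf t (V i) h z = pd (d i) h z"
    and d: "\<And>i. i \<in> set is \<Longrightarrow> d i \<noteq> 0"
    and "distinct is" "Ck_decay (length is) (length is) g"
  shows "ennreal \<bar>g z\<bar> \<le>
    (\<integral>\<^sup>+y. ennreal \<bar>Zf_pow t (map V is) g (z + (\<Sum>i\<in>set is. y i *\<^sub>R d i))\<bar> \<partial>(\<Pi>\<^sub>M i\<in>set is. lborel))"
  using assms(2-)
proof (induction "is")
  case Nil
  show ?case by (simp add: Zf_pow_simps PiM_empty)
next
  case (Cons i "is")
  interpret product_sigma_finite "\<lambda>_::'i. lborel :: real measure" ..
  let ?G = "Zf_pow t (map V is) g" and ?H = "Zf_pow t (map V (i # is)) g"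
  have G: "Ck_decay (Suc 0) (Suc 0) ?G" and H: "Ck_decay 0 0 ?H"
    using Cons.prems by (auto intro!: Ck_decay_Zf_pow simp del: Ck_decay.simps)
  have cH: "continuous_on UNIV ?H" using H by simp
  have HG: "?H z = pd (d i) ?G z" for z
    using V[OF Ck_decay_differentiable[OF G]] by (simp add: Zf_pow_simps)
  have line: "ennreal \<bar>?G z\<bar> \<le> (\<integral>\<^sup>+s. ennreal \<bar>?H (z + s *\<^sub>R d i)\<bar> \<partial>lborel)" for z
  proof -
    have "ennreal \<bar>?G (z + 0 *\<^sub>R d i)\<bar> \<le> (\<integral>\<^sup>+s. ennreal \<bar>?H (z + s *\<^sub>R d i)\<bar> \<partial>lborel)"
    proof (rule abs_le_nn_integral_derivative)
      show "((\<lambda>s. ?G (z + s *\<^sub>R d i)) has_real_derivative ?H (z + s *\<^sub>R d i)) (at s)" for s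
        unfolding HG by (rule pd_line_derivative[OF Ck_decay_differentiable[OF G]])
      show "continuous_on UNIV (\<lambda>s. ?H (z + s *\<^sub>R d i))"
        by (rule continuous_on_compose2[OF cH]) (auto intro!: continuous_intros)
      show "((\<lambda>s. ?G (z + s *\<^sub>R d i)) \<longlongrightarrow> 0) at_top"
        using G Cons.prems(1) by (intro decay_tendsto_0_along_line) auto
    qed
    then show ?thesis by simp
  qed
  have [measurable]: "?H \<in> borel_measurable borel" by (rule borel_measurable_continuous_onI[OF cH])
  have "ennreal \<bar>g z\<bar> \<le> (\<integral>\<^sup>+y. ennreal \<bar>?G (z + (\<Sum>j\<in>set is. y j *\<^sub>R d j))\<bar> \<partial>(\<Pi>\<^sub>M i\<in>set is. lborel))"
    by (rule Cons.IH) (use Cons.prems in \<open>auto intro: Ck_decay_mono simp del: Ck_decay.simps\<close>)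
  also have "\<dots> \<le> (\<integral>\<^sup>+y. \<integral>\<^sup>+s. ennreal \<bar>?H (z + (\<Sum>j\<in>set is. y j *\<^sub>R d j) + s *\<^sub>R d i)\<bar> \<partial>lborel \<partial>(\<Pi>\<^sub>M i\<in>set is. lborel))"
    by (intro nn_integral_mono line)
  also have "\<dots> = (\<integral>\<^sup>+y. \<integral>\<^sup>+s. ennreal \<bar>?H (z + (\<Sum>j\<in>insert i (set is). (y(i := s)) j *\<^sub>R d j))\<bar> \<partial>lborel \<partial>(\<Pi>\<^sub>M i\<in>set is. lborel))"
  proof (intro nn_integral_cong)
    fix y :: "'i \<Rightarrow> real" and s :: real
    have i: "i \<notin> set is" using Cons.prems by simp
    then have "(\<Sum>j\<in>set is. (y(i := s)) j *\<^sub>R d j) = (\<Sum>j\<in>set is. y j *\<^sub>R d j)"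
      by (intro sum.cong) auto
    with i have "(\<Sum>j\<in>insert i (set is). (y(i := s)) j *\<^sub>R d j) = s *\<^sub>R d i + (\<Sum>j\<in>set is. y j *\<^sub>R d j)"
      by simp
    then show "ennreal \<bar>?H (z + (\<Sum>j\<in>set is. y j *\<^sub>R d j) + s *\<^sub>R d i)\<bar> =
       ennreal \<bar>?H (z + (\<Sum>j\<in>insert i (set is). (y(i := s)) j *\<^sub>R d j))\<bar>"
      by (simp add: add_ac)
  qed
  also have "\<dots> = (\<integral>\<^sup>+y. ennreal \<bar>?H (z + (\<Sum>j\<in>insert i (set is). y j *\<^sub>R d j))\<bar> \<partial>(\<Pi>\<^sub>M i\<in>insert i (set is). lborel))"
  proof (rule product_nn_integral_insert[symmetric])
    have "(\<lambda>y. z + (\<Sum>j\<in>insert i (set is). y j *\<^sub>R d j)) \<in> borel_measurable (\<Pi>\<^sub>M i\<in>insert i (set is). lborel)"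
      by (intro borel_measurable_add borel_measurable_const borel_measurable_sum borel_measurable_scaleR)
         (rule measurable_component_singleton[THEN measurable_compose, of _ _ _ _ borel, unfolded measurable_lborel1]; simp)
    from measurable_compose[OF this borel_measurable_continuous_onI[OF cH]]
    show "(\<lambda>y. ennreal \<bar>?H (z + (\<Sum>j\<in>insert i (set is). y j *\<^sub>R d j))\<bar>)
        \<in> borel_measurable (\<Pi>\<^sub>M i\<in>insert i (set is). lborel)"
      by (intro measurable_compose[OF _ measurable_ennreal] borel_measurable_abs)
  qed (use Cons.prems in auto)
  finally show ?case by simp
qed

lemma fibre_abs_measurable:
  assumes "continuous_on UNIV (g :: 'n::finite phase \<Rightarrow> real)"
  shows "(\<lambda>x. \<integral>\<^sup>+v. ennreal \<bar>g (x, v)\<bar> \<partial>lborel) \<in> borel_measurable borel"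
proof -
  have "(\<lambda>z. ennreal \<bar>g z\<bar>) \<in> borel_measurable (lborel \<Otimes>\<^sub>M lborel)"
    unfolding lborel_prod using borel_measurable_continuous_onI[OF assms] by simp
  then have "(\<lambda>(x, v). ennreal \<bar>g (x, v)\<bar>) \<in> borel_measurable (lborel \<Otimes>\<^sub>M lborel)"
    by (simp add: split_beta')
  from lborel.borel_measurable_nn_integral[OF this] show ?thesis by simp
qed

lemma L1norm_phase:
  assumes "continuous_on UNIV (g :: 'n::finite phase \<Rightarrow> real)"
  shows "L1norm g = (\<integral>\<^sup>+x. \<integral>\<^sup>+v. ennreal \<bar>g (x, v)\<bar> \<partial>lborel \<partial>lborel)"
proof -
  have "(\<lambda>z. ennreal \<bar>g z\<bar>) \<in> borel_measurable (lborel \<Otimes>\<^sub>M lborel)"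
    unfolding lborel_prod using borel_measurable_continuous_onI[OF assms] by simp
  from lborel.nn_integral_fst[OF this] show ?thesis
    by (simp add: L1norm_def lborel_prod)
qed

text \<open>For fields \<open>V i\<close> that generate the flows \<open>z \<mapsto> z + D (s e\<^sub>i)\<close> of a linear map \<open>D\<close>, the iterated line
integrals combine to an integral over \<open>real ^ 'n\<close>.\<close>

lemma abs_le_nn_integral_over_translates:
  fixes g :: "'n::finite phase \<Rightarrow> real" and V :: "'n \<Rightarrow> 'n vfield" and D :: "real ^ 'n \<Rightarrow> 'n phase"
  assumes g: "Ck_decay CARD('n) CARD('n) g" and D: "linear D" "\<And>i. D (axis i 1) \<noteq> 0"
    and V: "\<And>i h z. (\<And>z. h differentiable (at z)) \<Longrightarrow> Zf t (V i) h z = pd (D (axis i 1)) h z"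
  obtains \<delta> where "set \<delta> \<subseteq> range V" "length \<delta> = CARD('n)" "continuous_on UNIV (Zf_pow t \<delta> g)"
    "\<And>z. ennreal \<bar>g z\<bar> \<le> (\<integral>\<^sup>+w. ennreal \<bar>Zf_pow t \<delta> g (z + D w)\<bar> \<partial>lborel)"
proof -
  obtain bs :: "(real ^ 'n) list" where bs: "set bs = Basis" "distinct bs"
    using finite_distinct_list[OF finite_Basis] by blast
  have len: "length bs = CARD('n)" using distinct_card[OF bs(2)] bs(1) by simp
  define ix where "ix = (\<lambda>b :: real^'n. SOME i. b = axis i 1)"
  define \<delta> where "\<delta> = map (\<lambda>b. V (ix b)) bs"
  let ?G = "Zf_pow t \<delta> g"
  have "Ck_decay 0 0 ?G"
    using g by (intro Ck_decay_Zf_pow) (simp add: \<delta>_def len del: Ck_decay.simps)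
  then have cG: "continuous_on UNIV ?G" by simp
  have le: "ennreal \<bar>g z\<bar> \<le> (\<integral>\<^sup>+w. ennreal \<bar>?G (z + D w)\<bar> \<partial>lborel)" for z
  proof -
    have "continuous_on UNIV D"
      using D(1) by (simp add: linear_continuous_on linear_conv_bounded_linear)
    then have [measurable]: "(\<lambda>w. ?G (z + D w)) \<in> borel_measurable borel"
      by (intro borel_measurable_continuous_onI continuous_on_compose2[OF cG] continuous_intros) auto
    have "ennreal \<bar>g z\<bar> \<le>
      (\<integral>\<^sup>+y. ennreal \<bar>?G (z + (\<Sum>b\<in>set bs. y b *\<^sub>R D (axis (ix b) 1)))\<bar> \<partial>(\<Pi>\<^sub>M b\<in>set bs. lborel))"
      unfolding \<delta>_def
      by (rule abs_le_iterated_line_integrals[where V = "\<lambda>b. V (ix b)"])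
         (use bs g len V D(2) in \<open>auto simp del: Ck_decay.simps\<close>)
    also have "\<dots> = (\<integral>\<^sup>+y. ennreal \<bar>?G (z + D (\<Sum>b\<in>Basis. y b *\<^sub>R b))\<bar> \<partial>(\<Pi>\<^sub>M b\<in>Basis. lborel))"
    proof (unfold bs(1), intro nn_integral_cong)
      fix y :: "real^'n \<Rightarrow> real"
      have "axis (ix b) 1 = b" if "b \<in> Basis" for b
        unfolding ix_def using that by (rule_tac someI2_ex) (auto simp: Basis_vec_def)
      then have "(\<Sum>b\<in>Basis. y b *\<^sub>R D (axis (ix b) 1)) = D (\<Sum>b\<in>Basis. y b *\<^sub>R b)"
        by (simp add: linear_sum[OF D(1)] linear_cmul[OF D(1)])
      then show "ennreal \<bar>?G (z + (\<Sum>b\<in>Basis. y b *\<^sub>R D (axis (ix b) 1)))\<bar> =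
          ennreal \<bar>?G (z + D (\<Sum>b\<in>Basis. y b *\<^sub>R b))\<bar>"
        by simp
    qed
    also have "\<dots> = (\<integral>\<^sup>+w. ennreal \<bar>?G (z + D w)\<bar> \<partial>lborel)"
      by (subst lborel_eq, subst nn_integral_distr) auto
    finally show ?thesis .
  qed
  have "set \<delta> \<subseteq> range V" "length \<delta> = CARD('n)"
    using len by (auto simp: \<delta>_def)
  then show ?thesis using that cG le by blast
qed

lemma fibre_le_L1norm_translations:
  fixes g :: "'n::finite phase \<Rightarrow> real"
  assumes g: "Ck_decay CARD('n) CARD('n) g"
  obtains \<delta> where "set \<delta> \<subseteq> range Translation" "length \<delta> = CARD('n)"
    "(\<integral>\<^sup>+v. ennreal \<bar>g (x, v)\<bar> \<partial>lborel) \<le> L1norm (Zf_pow t \<delta> g)"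
proof -
  have "linear (\<lambda>w :: real^'n. (w, 0 :: real^'n))"
    by (rule linearI) auto
  from abs_le_nn_integral_over_translates[OF g this, of t Translation]
  obtain \<delta> where \<delta>: "set \<delta> \<subseteq> range Translation" "length \<delta> = CARD('n)"
    and cG: "continuous_on UNIV (Zf_pow t \<delta> g)"
    and le: "\<And>z. ennreal \<bar>g z\<bar> \<le> (\<integral>\<^sup>+w. ennreal \<bar>Zf_pow t \<delta> g (z + (w, 0))\<bar> \<partial>lborel)"
    by (auto simp: zero_prod_def)
  let ?G = "Zf_pow t \<delta> g"
  note [measurable] = borel_measurable_continuous_onI[OF cG]
  have "ennreal \<bar>g (x, v)\<bar> \<le> (\<integral>\<^sup>+w. ennreal \<bar>?G (w, v)\<bar> \<partial>lborel)" for v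
  proof -
    have "(\<lambda>w. ennreal \<bar>?G (w, v)\<bar>) \<in> borel_measurable borel" by measurable
    from nn_integral_lborel_translate[OF this, of x] le[of "(x, v)"] show ?thesis
      by (simp add: add.commute)
  qed
  then have "(\<integral>\<^sup>+v. ennreal \<bar>g (x, v)\<bar> \<partial>lborel) \<le> (\<integral>\<^sup>+v. \<integral>\<^sup>+w. ennreal \<bar>?G (w, v)\<bar> \<partial>lborel \<partial>lborel)"
    by (intro nn_integral_mono)
  also have "\<dots> = L1norm ?G"
    unfolding L1norm_phase[OF cG]
  proof (rule lborel_pair.Fubini')
    show "(\<lambda>(w, v). ennreal \<bar>?G (w, v)\<bar>) \<in> borel_measurable (lborel \<Otimes>\<^sub>M lborel)"
      unfolding lborel_prod split_beta' by simp
  qed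
  finally show ?thesis using that \<delta> by blast
qed

text \<open>After the translation \<open>v + w \<mapsto> v\<close> in the inner integral, \<open>w\<close> survives only in \<open>x + t w\<close>, and
this substitution has Jacobian \<open>t ^ n\<close>.\<close>

lemma fibre_le_L1norm_galilean:
  fixes g :: "'n::finite phase \<Rightarrow> real"
  assumes g: "Ck_decay CARD('n) CARD('n) g" and t: "0 < t"
  obtains \<delta> where "set \<delta> \<subseteq> range Galilean" "length \<delta> = CARD('n)"
    "(\<integral>\<^sup>+v. ennreal \<bar>g (x, v)\<bar> \<partial>lborel) \<le> ennreal (1 / t ^ CARD('n)) * L1norm (Zf_pow t \<delta> g)"
proof -
  have lin: "linear (\<lambda>w :: real^'n. (t *\<^sub>R w, w))"
    by (rule linearI) (auto simp: algebra_simps)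
  have V: "Zf t (Galilean i) h z = pd (t *\<^sub>R axis i 1, axis i 1) h z" if "\<And>z. h differentiable (at z)"
    for i z and h :: "'n phase \<Rightarrow> real"
    using pd_linear_direction[OF that, of t "(axis i 1, 0)" "(0, axis i 1)" z] by simp
  from abs_le_nn_integral_over_translates[OF g lin _ V]
  obtain \<delta> where \<delta>: "set \<delta> \<subseteq> range Galilean" "length \<delta> = CARD('n)"
    and cG: "continuous_on UNIV (Zf_pow t \<delta> g)"
    and le: "\<And>z. ennreal \<bar>g z\<bar> \<le> (\<integral>\<^sup>+w. ennreal \<bar>Zf_pow t \<delta> g (z + (t *\<^sub>R w, w))\<bar> \<partial>lborel)"
    by (auto simp: zero_prod_def)
  let ?G = "Zf_pow t \<delta> g"
  note [measurable] = borel_measurable_continuous_onI[OF cG]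
  let ?B = "\<lambda>x. \<integral>\<^sup>+v. ennreal \<bar>?G (x, v)\<bar> \<partial>lborel"
  note [measurable] = fibre_abs_measurable[OF cG]
  have "ennreal \<bar>g (x, v)\<bar> \<le> (\<integral>\<^sup>+w. ennreal \<bar>?G (x + t *\<^sub>R w, v + w)\<bar> \<partial>lborel)" for v
    using le[of "(x, v)"] by simp
  then have "(\<integral>\<^sup>+v. ennreal \<bar>g (x, v)\<bar> \<partial>lborel) \<le> (\<integral>\<^sup>+v. \<integral>\<^sup>+w. ennreal \<bar>?G (x + t *\<^sub>R w, v + w)\<bar> \<partial>lborel \<partial>lborel)"
    by (intro nn_integral_mono)
  also have "\<dots> = (\<integral>\<^sup>+w. \<integral>\<^sup>+v. ennreal \<bar>?G (x + t *\<^sub>R w, v + w)\<bar> \<partial>lborel \<partial>lborel)"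
  proof (rule lborel_pair.Fubini')
    have "(\<lambda>p. ?G (x + t *\<^sub>R fst p, snd p + fst p)) \<in> borel_measurable borel"
      by (intro borel_measurable_continuous_onI continuous_on_compose2[OF cG] continuous_intros) auto
    then show "(\<lambda>(w, v). ennreal \<bar>?G (x + t *\<^sub>R w, v + w)\<bar>) \<in> borel_measurable (lborel \<Otimes>\<^sub>M lborel)"
      unfolding lborel_prod split_beta' by simp
  qed
  also have "\<dots> = (\<integral>\<^sup>+w. ?B (x + t *\<^sub>R w) \<partial>lborel)"
  proof (rule nn_integral_cong)
    fix w :: "real ^ 'n"
    have "(\<lambda>v. ennreal \<bar>?G (x + t *\<^sub>R w, v)\<bar>) \<in> borel_measurable borel" by measurable
    from nn_integral_lborel_translate[OF this, of w]
    show "(\<integral>\<^sup>+v. ennreal \<bar>?G (x + t *\<^sub>R w, v + w)\<bar> \<partial>lborel) = ?B (x + t *\<^sub>R w)" by simp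
  qed
  also have "\<dots> = ennreal (1 / t ^ CARD('n)) * (\<integral>\<^sup>+x. ?B x \<partial>lborel)"
  proof -
    have "(\<integral>\<^sup>+x. ?B x \<partial>lborel) = (\<integral>\<^sup>+w. ennreal (t ^ CARD('n)) * ?B (x + t *\<^sub>R w) \<partial>lborel)"
      using t by (subst lborel_affine[of t x]) (auto simp: nn_integral_density nn_integral_distr)
    also have "\<dots> = ennreal (t ^ CARD('n)) * (\<integral>\<^sup>+w. ?B (x + t *\<^sub>R w) \<partial>lborel)"
      by (rule nn_integral_cmult) measurable
    finally have "ennreal (1 / t ^ CARD('n)) * (\<integral>\<^sup>+x. ?B x \<partial>lborel) =
        (ennreal (1 / t ^ CARD('n)) * ennreal (t ^ CARD('n))) * (\<integral>\<^sup>+w. ?B (x + t *\<^sub>R w) \<partial>lborel)"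
      by (simp add: mult.assoc)
    also have "ennreal (1 / t ^ CARD('n)) * ennreal (t ^ CARD('n)) = 1"
      using t by (subst ennreal_mult[symmetric]) auto
    finally show ?thesis by simp
  qed
  also have "(\<integral>\<^sup>+x. ?B x \<partial>lborel) = L1norm ?G"
    by (rule L1norm_phase[OF cG, symmetric])
  finally show ?thesis using that \<delta> by blast
qed

text \<open>Translations are used for \<open>t \<le> 1\<close> and Galilean boosts for \<open>t > 1\<close>; the factor \<open>2 ^ n\<close> converts \<open>1\<close>
and \<open>t ^ -n\<close> into \<open>(1 + t) ^ -n\<close>.\<close>

lemma velocity_average_decay:
  fixes g :: "'n::{finite,linorder} phase \<Rightarrow> real"
  assumes g: "Ck_decay CARD('n) CARD('n) g" and t: "0 \<le> t"
  obtains \<delta> where "set \<delta> \<subseteq> vfields" "length \<delta> = CARD('n)"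
    "(\<integral>\<^sup>+v. ennreal \<bar>g (x, v)\<bar> \<partial>lborel) \<le> ennreal (2 ^ CARD('n) / (1 + t) ^ CARD('n)) * L1norm (Zf_pow t \<delta> g)"
proof (cases "t \<le> 1")
  case True
  obtain \<delta> where \<delta>: "set \<delta> \<subseteq> range Translation" "length \<delta> = CARD('n)"
    "(\<integral>\<^sup>+v. ennreal \<bar>g (x, v)\<bar> \<partial>lborel) \<le> L1norm (Zf_pow t \<delta> g)"
    using fibre_le_L1norm_translations[OF g, of x t] by blast
  have "(1 + t) ^ CARD('n) \<le> 2 ^ CARD('n)" using True t by (intro power_mono) auto
  then have "ennreal 1 \<le> ennreal (2 ^ CARD('n) / (1 + t) ^ CARD('n))"
    using t by (intro ennreal_leI) auto
  from mult_right_mono[OF this, of "L1norm (Zf_pow t \<delta> g)"]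
  have "L1norm (Zf_pow t \<delta> g) \<le> ennreal (2 ^ CARD('n) / (1 + t) ^ CARD('n)) * L1norm (Zf_pow t \<delta> g)" by simp
  from order_trans[OF \<delta>(3) this] show ?thesis
  proof (intro that[of \<delta>])
    show "set \<delta> \<subseteq> vfields" using \<delta>(1) by (auto simp: vfields_def)
  qed (use \<delta>(2) in auto)
next
  case False
  obtain \<delta> where \<delta>: "set \<delta> \<subseteq> range Galilean" "length \<delta> = CARD('n)"
    "(\<integral>\<^sup>+v. ennreal \<bar>g (x, v)\<bar> \<partial>lborel) \<le> ennreal (1 / t ^ CARD('n)) * L1norm (Zf_pow t \<delta> g)"
    using fibre_le_L1norm_galilean[OF g, of t] False by auto
  have "(1 + t) ^ CARD('n) \<le> (2 * t) ^ CARD('n)" using False by (intro power_mono) auto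
  then have "ennreal (1 / t ^ CARD('n)) \<le> ennreal (2 ^ CARD('n) / (1 + t) ^ CARD('n))"
    using False by (intro ennreal_leI inverse_le_divide) (auto simp: power_mult_distrib)
  from mult_right_mono[OF this, of "L1norm (Zf_pow t \<delta> g)"]
  have "ennreal (1 / t ^ CARD('n)) * L1norm (Zf_pow t \<delta> g) \<le> ennreal (2 ^ CARD('n) / (1 + t) ^ CARD('n)) * L1norm (Zf_pow t \<delta> g)" by simp
  from order_trans[OF \<delta>(3) this] show ?thesis
  proof (intro that[of \<delta>])
    show "set \<delta> \<subseteq> vfields" using \<delta>(1) by (auto simp: vfields_def)
  qed (use \<delta>(2) in auto)
qed

section \<open>Riesz potentials and the product estimate\<close>

definition riesz_potential :: "(real ^ 'n::finite \<Rightarrow> ennreal) \<Rightarrow> real ^ 'n \<Rightarrow> ennreal" where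
  "riesz_potential B x = (\<integral>\<^sup>+y. ennreal (1 / norm (x - y) ^ (CARD('n) - 1)) * B y \<partial>lborel)"

lemma riesz_kernel_measurable:
  "(\<lambda>(x, y). ennreal (1 / norm (x - y :: real^'n::finite) ^ (CARD('n) - 1))) \<in> borel_measurable (lborel \<Otimes>\<^sub>M lborel)"
proof -
  have "(\<lambda>p. norm (fst p - snd p :: real^'n)) \<in> borel_measurable borel"
    by (intro borel_measurable_continuous_onI continuous_intros)
  then show ?thesis unfolding lborel_prod split_beta' by simp
qed

lemma riesz_potential_measurable:
  assumes [measurable]: "B \<in> borel_measurable borel"
  shows "riesz_potential B \<in> borel_measurable (borel :: (real ^ 'n::finite) measure)"
proof -
  note [measurable] = riesz_kernel_measurable[unfolded split_beta']
  have "(\<lambda>(x, y). ennreal (1 / norm (x - y :: real^'n) ^ (CARD('n) - 1)) * B y) \<in> borel_measurable (lborel \<Otimes>\<^sub>M lborel)"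
    unfolding split_beta' by measurable
  from lborel.borel_measurable_nn_integral[OF this] show ?thesis
    by (simp add: riesz_potential_def[abs_def])
qed

lemma riesz_potential_symmetric:
  fixes A B :: "real ^ 'n::finite \<Rightarrow> ennreal"
  assumes [measurable]: "A \<in> borel_measurable borel" "B \<in> borel_measurable borel"
  shows "(\<integral>\<^sup>+x. A x * riesz_potential B x \<partial>lborel) = (\<integral>\<^sup>+x. B x * riesz_potential A x \<partial>lborel)"
proof -
  let ?k = "\<lambda>x y :: real^'n. ennreal (1 / norm (x - y) ^ (CARD('n) - 1))"
  note [measurable] = riesz_kernel_measurable[unfolded split_beta']
  have "(\<integral>\<^sup>+x. A x * riesz_potential B x \<partial>lborel) = (\<integral>\<^sup>+x. \<integral>\<^sup>+y. A x * (?k x y * B y) \<partial>lborel \<partial>lborel)"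
    unfolding riesz_potential_def by (intro nn_integral_cong nn_integral_cmult[symmetric]) measurable
  also have "\<dots> = (\<integral>\<^sup>+y. \<integral>\<^sup>+x. A x * (?k x y * B y) \<partial>lborel \<partial>lborel)"
  proof (rule lborel_pair.Fubini'[symmetric])
    show "(\<lambda>(x, y). A x * (?k x y * B y)) \<in> borel_measurable (lborel \<Otimes>\<^sub>M lborel)"
      unfolding split_beta' by measurable
  qed
  also have "\<dots> = (\<integral>\<^sup>+y. \<integral>\<^sup>+x. B y * (?k y x * A x) \<partial>lborel \<partial>lborel)"
    by (simp add: norm_minus_commute mult_ac)
  also have "\<dots> = (\<integral>\<^sup>+x. B x * riesz_potential A x \<partial>lborel)"
    unfolding riesz_potential_def by (intro nn_integral_cong nn_integral_cmult) measurable
  finally show ?thesis .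
qed

text \<open>The first summand belongs to the ball \<open>|x - y| \<le> R\<close>, the second to its complement.\<close>

definition riesz_bound :: "'n::finite itself \<Rightarrow> real" where
  "riesz_bound _ = 2 ^ (CARD('n) + 1) * unit_ball_vol (real CARD('n)) + 1"

lemma riesz_bound_pos: "0 < riesz_bound TYPE('n::finite)"
  by (simp add: riesz_bound_def add_nonneg_pos)

text \<open>On \<open>|x - y| \<le> R\<close> the supremum bound on \<open>B\<close> is paired with the kernel, whose integral over a ball
is of order \<open>R\<close>; outside, the kernel is at most \<open>R ^ (1 - n)\<close> and is paired with the
integral of \<open>B\<close>. Both contributions are of order \<open>a / R ^ (n - 1)\<close>.\<close>

lemma riesz_potential_le:
  fixes B :: "real ^ 'n::finite \<Rightarrow> ennreal"
  assumes n: "2 \<le> CARD('n)" and [measurable]: "B \<in> borel_measurable borel" and R: "0 < R"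
    and sup: "\<And>y. B y \<le> ennreal (1 / R ^ CARD('n)) * a" and int: "(\<integral>\<^sup>+y. B y \<partial>lborel) \<le> a"
  shows "riesz_potential B x \<le> ennreal (riesz_bound TYPE('n) / R ^ (CARD('n) - 1)) * a"
proof -
  let ?n = "CARD('n)"
  let ?k = "\<lambda>z :: real^'n. ennreal (1 / norm z ^ (?n - 1))"
  let ?near = "\<lambda>z :: real^'n. ?k z * indicator (cball 0 R) z"
  have [measurable]: "cball (0 :: real^'n) R \<in> sets borel" by simp
  have le: "?k (x - y) * B y \<le> ?near (x - y) * (ennreal (1 / R ^ ?n) * a) + ennreal (1 / R ^ (?n - 1)) * B y" for y
  proof (cases "norm (x - y) \<le> R")
    case True
    have "?k (x - y) * B y \<le> ?k (x - y) * (ennreal (1 / R ^ ?n) * a)"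
      by (intro mult_left_mono sup) simp
    then show ?thesis using True by (simp add: add_increasing2)
  next
    case False
    have "1 / norm (x - y) ^ (?n - 1) \<le> 1 / R ^ (?n - 1)"
      using False R by (intro divide_left_mono power_mono mult_pos_pos zero_less_power) auto
    then have "?k (x - y) * B y \<le> ennreal (1 / R ^ (?n - 1)) * B y"
      by (intro mult_right_mono ennreal_leI) auto
    then show ?thesis by (simp add: add_increasing)
  qed
  have m: "(\<lambda>y. ?near (x - y)) \<in> borel_measurable lborel"
    "(\<lambda>y. ?near (x - y) * (ennreal (1 / R ^ ?n) * a)) \<in> borel_measurable lborel"
    "(\<lambda>y. ennreal (1 / R ^ (?n - 1)) * B y) \<in> borel_measurable lborel" "B \<in> borel_measurable lborel"
    by measurable
  have "riesz_potential B x \<le>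
      (\<integral>\<^sup>+y. ?near (x - y) * (ennreal (1 / R ^ ?n) * a) + ennreal (1 / R ^ (?n - 1)) * B y \<partial>lborel)"
    unfolding riesz_potential_def by (intro nn_integral_mono le)
  also have "\<dots> = (\<integral>\<^sup>+y. ?near (x - y) \<partial>lborel) * (ennreal (1 / R ^ ?n) * a) + ennreal (1 / R ^ (?n - 1)) * (\<integral>\<^sup>+y. B y \<partial>lborel)"
    by (simp only: nn_integral_add[OF m(2,3)] nn_integral_multc[OF m(1)] nn_integral_cmult[OF m(4)])
  also have "(\<integral>\<^sup>+y. ?near (x - y) \<partial>lborel) = (\<integral>\<^sup>+y. ?near y \<partial>lborel)"
    by (rule nn_integral_lborel_reflect) measurable
  also have "(\<integral>\<^sup>+y. ?near y \<partial>lborel) * (ennreal (1 / R ^ ?n) * a) + ennreal (1 / R ^ (?n - 1)) * (\<integral>\<^sup>+y. B y \<partial>lborel)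
     \<le> ennreal (2 ^ (?n + 1) * unit_ball_vol (real ?n) * R) * (ennreal (1 / R ^ ?n) * a) + ennreal (1 / R ^ (?n - 1)) * a"
    using nn_integral_riesz_kernel_cball[of R, where 'a = "real^'n"] n R int
    by (intro add_mono mult_right_mono mult_left_mono) auto
  also have "\<dots> = (ennreal (2 ^ (?n + 1) * unit_ball_vol (real ?n) * R) * ennreal (1 / R ^ ?n) + ennreal (1 / R ^ (?n - 1))) * a"
    by (simp add: distrib_right mult.assoc)
  also have "ennreal (2 ^ (?n + 1) * unit_ball_vol (real ?n) * R) * ennreal (1 / R ^ ?n) =
      ennreal (2 ^ (?n + 1) * unit_ball_vol (real ?n) / R ^ (?n - 1))"
    using R n power_dim_split(2)[of ?n R]
    by (subst ennreal_mult[symmetric]) auto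
  also have "\<dots> + ennreal (1 / R ^ (?n - 1)) = ennreal (riesz_bound TYPE('n) / R ^ (?n - 1))"
    using R by (subst ennreal_plus[symmetric]) (auto simp: riesz_bound_def add_divide_distrib)
  finally show ?thesis .
qed

definition grad_bound :: "'n::finite itself \<Rightarrow> real" where
  "grad_bound _ = real CARD('n) * \<bar>green_coeff TYPE('n) * (real CARD('n) - 2)\<bar>"

lemma norm_grad_pot_le:
  fixes w :: "'n::finite phase \<Rightarrow> real"
  assumes n: "4 \<le> CARD('n)" and w: "Ck_decay 0 (2 * CARD('n) + 1) w"
  shows "ennreal (norm (grad (pot w) x)) \<le>
    ennreal (grad_bound TYPE('n)) * riesz_potential (\<lambda>y. \<integral>\<^sup>+v. ennreal \<bar>w (y, v)\<bar> \<partial>lborel) x"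
proof -
  let ?c = "\<bar>green_coeff TYPE('n) * (real CARD('n) - 2)\<bar>"
  let ?B = "\<lambda>y. \<integral>\<^sup>+v. ennreal \<bar>w (y, v)\<bar> \<partial>lborel"
  let ?k = "\<lambda>z :: real^'n. ennreal (1 / norm z ^ (CARD('n) - 1))"
  have cw: "continuous_on UNIV w" using w by simp
  note [measurable] = fibre_abs_measurable[OF cw]
  have u: "Ck_decay 0 CARD('n) (rho w)" by (rule Ck_decay_rho[OF w])
  have ds: "ennreal \<bar>ds i (pot w) x\<bar> \<le> ennreal ?c * riesz_potential ?B x" for i
  proof -
    have "ennreal \<bar>ds i (pot w) x\<bar> \<le> (\<integral>\<^sup>+y. ennreal \<bar>dgreen i y * rho w (x - y)\<bar> \<partial>lborel)"
      unfolding pot_derivative[OF n w] conv_def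
      using integral_norm_bound_ennreal[OF conv_integrable[OF riesz_dgreen[OF n, of i] u n, of x]] by simp
    also have "\<dots> \<le> (\<integral>\<^sup>+y. ennreal ?c * (?k y * ?B (x - y)) \<partial>lborel)"
    proof (intro nn_integral_mono)
      fix y :: "real^'n"
      have "\<bar>dgreen i y\<bar> \<le> ?c * (1 / norm y ^ (CARD('n) - 1))"
      proof (cases "y = 0")
        case False
        then show ?thesis using dgreen_times_norm_power[OF n False, of i] by (simp add: pos_le_divide_eq)
      qed (simp add: dgreen_0[OF n])
      then have "ennreal \<bar>dgreen i y\<bar> \<le> ennreal ?c * ?k y"
        by (subst ennreal_mult[symmetric]) (auto intro: ennreal_leI)
      moreover have "ennreal \<bar>rho w (x - y)\<bar> \<le> ?B (x - y)"
        using integral_norm_bound_ennreal[OF fibre_integrable[OF w, of "x - y"]] by (simp add: rho_def)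
      ultimately have "ennreal \<bar>dgreen i y\<bar> * ennreal \<bar>rho w (x - y)\<bar> \<le> ennreal ?c * ?k y * ?B (x - y)"
        by (intro mult_mono) auto
      then show "ennreal \<bar>dgreen i y * rho w (x - y)\<bar> \<le> ennreal ?c * (?k y * ?B (x - y))"
        by (simp add: abs_mult ennreal_mult mult.assoc)
    qed
    also have "\<dots> = ennreal ?c * (\<integral>\<^sup>+y. ?k y * ?B (x - y) \<partial>lborel)"
      by (rule nn_integral_cmult) measurable
    also have "(\<integral>\<^sup>+y. ?k y * ?B (x - y) \<partial>lborel) = riesz_potential ?B x"
      unfolding riesz_potential_def
      by (subst nn_integral_lborel_reflect[of "\<lambda>y. ?k y * ?B (x - y)" x, symmetric]) auto
    finally show ?thesis .
  qed
  have "ennreal (norm (grad (pot w) x)) \<le> ennreal (\<Sum>i\<in>UNIV. \<bar>ds i (pot w) x\<bar>)"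
    using norm_le_l1_cart[of "grad (pot w) x"] by (intro ennreal_leI) (simp add: grad_def)
  also have "\<dots> = (\<Sum>i\<in>UNIV. ennreal \<bar>ds i (pot w) x\<bar>)"
    by (rule sum_ennreal[symmetric]) simp
  also have "\<dots> \<le> (\<Sum>i\<in>(UNIV :: 'n set). ennreal ?c * riesz_potential ?B x)"
    by (intro sum_mono ds)
  also have "\<dots> = ennreal (grad_bound TYPE('n)) * riesz_potential ?B x"
    by (simp add: grad_bound_def ennreal_mult ennreal_of_nat_eq_real_of_nat mult.assoc)
  finally show ?thesis .
qed

lemma L1norm_grad_pot_product_le:
  fixes g w :: "'n::finite phase \<Rightarrow> real"
  assumes n: "4 \<le> CARD('n)" and g: "continuous_on UNIV g" and w: "Ck_decay 0 (2 * CARD('n) + 1) w"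
  shows "L1norm (\<lambda>(x, v). g (x, v) *\<^sub>R grad (pot w) x) \<le> ennreal (grad_bound TYPE('n)) *
    (\<integral>\<^sup>+x. (\<integral>\<^sup>+v. ennreal \<bar>g (x, v)\<bar> \<partial>lborel) *
       riesz_potential (\<lambda>y. \<integral>\<^sup>+v. ennreal \<bar>w (y, v)\<bar> \<partial>lborel) x \<partial>lborel)"
proof -
  let ?B = "\<lambda>y. \<integral>\<^sup>+v. ennreal \<bar>w (y, v)\<bar> \<partial>lborel" and ?c = "ennreal (grad_bound TYPE('n))"
  have cw: "continuous_on UNIV w" using w by simp
  note [measurable] = fibre_abs_measurable[OF cw] fibre_abs_measurable[OF g] riesz_potential_measurable
    fibre_measurable[OF g]
  have [measurable]: "g \<in> borel_measurable (lborel \<Otimes>\<^sub>M lborel)"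
    unfolding lborel_prod using borel_measurable_continuous_onI[OF g] by simp
  have "L1norm (\<lambda>(x, v). g (x, v) *\<^sub>R grad (pot w) x) =
      (\<integral>\<^sup>+z. ennreal \<bar>g z\<bar> * ennreal (norm (grad (pot w) (fst z))) \<partial>(lborel \<Otimes>\<^sub>M lborel))"
    unfolding L1norm_def lborel_prod by (intro nn_integral_cong) (auto simp: ennreal_mult)
  also have "\<dots> \<le> (\<integral>\<^sup>+z. ennreal \<bar>g z\<bar> * (?c * riesz_potential ?B (fst z)) \<partial>(lborel \<Otimes>\<^sub>M lborel))"
    by (intro nn_integral_mono mult_left_mono norm_grad_pot_le n w) simp
  also have "\<dots> = (\<integral>\<^sup>+x. \<integral>\<^sup>+v. ennreal \<bar>g (x, v)\<bar> * (?c * riesz_potential ?B x) \<partial>lborel \<partial>lborel)"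
    by (subst lborel.nn_integral_fst[symmetric]) auto
  also have "\<dots> = (\<integral>\<^sup>+x. ?c * ((\<integral>\<^sup>+v. ennreal \<bar>g (x, v)\<bar> \<partial>lborel) * riesz_potential ?B x) \<partial>lborel)"
    by (intro nn_integral_cong, subst nn_integral_multc) (auto simp: mult_ac)
  also have "\<dots> = ?c * (\<integral>\<^sup>+x. (\<integral>\<^sup>+v. ennreal \<bar>g (x, v)\<bar> \<partial>lborel) * riesz_potential ?B x \<partial>lborel)"
    by (rule nn_integral_cmult) measurable
  finally show ?thesis .
qed

lemma nn_integral_mult_riesz_potential_le:
  fixes A B :: "real ^ 'n::finite \<Rightarrow> ennreal"
  assumes n: "2 \<le> CARD('n)" and A: "A \<in> borel_measurable borel" and B: "B \<in> borel_measurable borel" and R: "0 < R"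
    and sup: "\<And>y. B y \<le> ennreal (1 / R ^ CARD('n)) * a" and intB: "(\<integral>\<^sup>+y. B y \<partial>lborel) \<le> a"
    and intA: "(\<integral>\<^sup>+x. A x \<partial>lborel) \<le> b"
  shows "(\<integral>\<^sup>+x. A x * riesz_potential B x \<partial>lborel) \<le> ennreal (riesz_bound TYPE('n) / R ^ (CARD('n) - 1)) * (a * b)"
proof -
  have "(\<integral>\<^sup>+x. A x * riesz_potential B x \<partial>lborel) \<le>
      (\<integral>\<^sup>+x. A x * (ennreal (riesz_bound TYPE('n) / R ^ (CARD('n) - 1)) * a) \<partial>lborel)"
    by (intro nn_integral_mono mult_left_mono riesz_potential_le n B R sup intB) simp
  also have "\<dots> = (\<integral>\<^sup>+x. A x \<partial>lborel) * (ennreal (riesz_bound TYPE('n) / R ^ (CARD('n) - 1)) * a)"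
    using A by (intro nn_integral_multc) simp
  also have "\<dots> \<le> b * (ennreal (riesz_bound TYPE('n) / R ^ (CARD('n) - 1)) * a)"
    by (intro mult_right_mono intA) simp
  finally show ?thesis by (simp add: mult_ac)
qed

text \<open>The case distinction decides which factor is estimated in the supremum norm. If \<open>\<gamma>\<close> has order at
most \<open>N - n\<close> this is the density \<open>w\<close> that generates \<open>Z\<^sup>\<gamma> \<phi>\<close>. Otherwise \<open>|\<beta>| \<le> N + 1 - |\<gamma>| \<le> n \<le> N - n\<close>,
and the symmetry of the Riesz kernel exchanges the roles of the two factors.\<close>

lemma L1norm_product_le_energy_squared:
  fixes f :: "'n::{finite,linorder} phase \<Rightarrow> real"
  assumes n: "4 \<le> CARD('n)" and N: "2 * CARD('n) \<le> N" and t: "0 \<le> t"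
    and f: "Ck_decay N (2 * CARD('n) + N + 1) f"
    and \<gamma>: "set \<gamma> \<subseteq> vfields" "length \<gamma> \<le> N" and \<beta>: "set \<beta> \<subseteq> vfields" "length \<beta> \<le> N"
    and sum: "length \<gamma> + length \<beta> \<le> N + 1"
  shows "L1norm (\<lambda>(x, v). Zf_pow t \<beta> f (x, v) *\<^sub>R grad (Zs_pow t \<gamma> (pot f)) x) \<le>
    ennreal (grad_bound TYPE('n)) * (ennreal (riesz_bound TYPE('n) / (1 + t) ^ (CARD('n) - 1)) *
      (ennreal (2 ^ CARD('n) * (real CARD('n) + 3) ^ N) * (energy N t f * energy N t f)))"
proof -
  let ?n = "CARD('n)" and ?q = "real CARD('n) + 3" and ?E = "energy N t f"
  define g where "g = Zf_pow t \<beta> f"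
  define w where "w = corrected t \<gamma> f"
  let ?A = "\<lambda>x. \<integral>\<^sup>+v. ennreal \<bar>g (x, v)\<bar> \<partial>lborel" and ?B = "\<lambda>x. \<integral>\<^sup>+v. ennreal \<bar>w (x, v)\<bar> \<partial>lborel"
  have g: "Ck_decay (N - length \<beta>) (2 * ?n + 1) g"
    unfolding g_def by (rule Ck_decay_Zf_pow, rule Ck_decay_mono[OF f]) (use \<beta> in auto)
  have w: "Ck_decay (N - length \<gamma>) (2 * ?n + 1) w"
    unfolding w_def by (rule Ck_decay_corrected, rule Ck_decay_mono[OF f]) (use \<gamma> in auto)
  have cg: "continuous_on UNIV g" by (rule Ck_decay_continuous[OF g])
  have w0: "Ck_decay 0 (2 * ?n + 1) w" by (rule Ck_decay_mono[OF w]) auto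
  have cw: "continuous_on UNIV w" by (rule Ck_decay_continuous[OF w])
  note A = fibre_abs_measurable[OF cg] and B = fibre_abs_measurable[OF cw]
  have intA: "(\<integral>\<^sup>+x. ?A x \<partial>lborel) \<le> ?E"
  proof -
    have "L1norm g \<le> ?E"
      unfolding g_def by (rule L1norm_le_energy) (use \<beta> in \<open>simp add: multi_indices_def\<close>)
    then show ?thesis by (simp only: L1norm_phase[OF cg])
  qed
  have Zw: "L1norm (Zf_pow t \<delta> w) \<le> ennreal (?q ^ N) * ?E"
    if "set \<delta> \<subseteq> vfields" "length \<delta> + length \<gamma> \<le> N" for \<delta>
  proof -
    have "L1norm (Zf_pow t \<delta> w) \<le> ennreal (?q ^ length \<gamma>) * energy (length \<delta> + length \<gamma>) t f"
      unfolding w_def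
      by (rule L1norm_Zf_pow_corrected, rule Ck_decay_mono[OF f]) (use that \<gamma> in auto)
    also have "\<dots> \<le> ennreal (?q ^ N) * ?E"
      using that \<gamma> by (intro mult_mono energy_mono ennreal_leI power_increasing) auto
    finally show ?thesis .
  qed
  have intB: "(\<integral>\<^sup>+x. ?B x \<partial>lborel) \<le> ennreal (?q ^ N) * ?E"
    unfolding L1norm_phase[OF cw, symmetric] using Zw[of "[]"] \<gamma> by (simp add: Zf_pow_simps)
  have "(\<integral>\<^sup>+x. ?A x * riesz_potential ?B x \<partial>lborel) \<le>
      ennreal (riesz_bound TYPE('n) / (1 + t) ^ (?n - 1)) * (ennreal (2 ^ ?n * ?q ^ N) * (?E * ?E))"
  proof (cases "length \<gamma> + ?n \<le> N")
    case True
    have "(\<integral>\<^sup>+x. ?A x * riesz_potential ?B x \<partial>lborel) \<le>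
      ennreal (riesz_bound TYPE('n) / (1 + t) ^ (?n - 1)) * ((ennreal (2 ^ ?n * ?q ^ N) * ?E) * ?E)"
    proof (rule nn_integral_mult_riesz_potential_le[OF _ A B])
      have "ennreal (?q ^ N) * ?E \<le> ennreal (2 ^ ?n * ?q ^ N) * ?E"
        by (intro mult_right_mono ennreal_leI) (auto simp: mult_le_cancel_right1)
      then show "(\<integral>\<^sup>+x. ?B x \<partial>lborel) \<le> ennreal (2 ^ ?n * ?q ^ N) * ?E" using intB by (rule order_trans[rotated])
      fix x
      have "Ck_decay ?n ?n w" by (rule Ck_decay_mono[OF w]) (use True in auto)
      from velocity_average_decay[OF this t, of x] obtain \<delta> where \<delta>: "set \<delta> \<subseteq> vfields" "length \<delta> = ?n"
        "?B x \<le> ennreal (2 ^ ?n / (1 + t) ^ ?n) * L1norm (Zf_pow t \<delta> w)" by blast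
      have "?B x \<le> ennreal (2 ^ ?n / (1 + t) ^ ?n) * (ennreal (?q ^ N) * ?E)"
        using \<delta> True by (intro order_trans[OF \<delta>(3)] mult_left_mono Zw) auto
      also have "\<dots> = ennreal (1 / (1 + t) ^ ?n) * (ennreal (2 ^ ?n * ?q ^ N) * ?E)"
        using t by (simp add: mult.assoc[symmetric] ennreal_mult[symmetric])
      finally show "?B x \<le> ennreal (1 / (1 + t) ^ ?n) * (ennreal (2 ^ ?n * ?q ^ N) * ?E)" .
    qed (use n t intA in auto)
    then show ?thesis by (simp add: mult.assoc)
  next
    case False
    have \<beta>n: "length \<beta> + ?n \<le> N" using False sum N by linarith
    have "(\<integral>\<^sup>+x. ?A x * riesz_potential ?B x \<partial>lborel) = (\<integral>\<^sup>+x. ?B x * riesz_potential ?A x \<partial>lborel)"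
      by (rule riesz_potential_symmetric[OF A B])
    also have "\<dots> \<le> ennreal (riesz_bound TYPE('n) / (1 + t) ^ (?n - 1)) * ((ennreal (2 ^ ?n) * ?E) * (ennreal (?q ^ N) * ?E))"
    proof (rule nn_integral_mult_riesz_potential_le[OF _ B A])
      have "1 * ?E \<le> ennreal (2 ^ ?n) * ?E"
        by (intro mult_right_mono) (auto simp: one_le_power)
      then show "(\<integral>\<^sup>+x. ?A x \<partial>lborel) \<le> ennreal (2 ^ ?n) * ?E" using intA by simp
      fix x
      have "Ck_decay ?n ?n g" by (rule Ck_decay_mono[OF g]) (use \<beta>n in auto)
      from velocity_average_decay[OF this t, of x] obtain \<delta> where \<delta>: "set \<delta> \<subseteq> vfields" "length \<delta> = ?n"
        "?A x \<le> ennreal (2 ^ ?n / (1 + t) ^ ?n) * L1norm (Zf_pow t \<delta> g)" by blast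
      have "L1norm (Zf_pow t \<delta> g) \<le> ?E"
        unfolding g_def Zf_pow_append[symmetric]
        by (rule L1norm_le_energy) (use \<delta> \<beta> \<beta>n in \<open>auto simp: multi_indices_def\<close>)
      then have "?A x \<le> ennreal (2 ^ ?n / (1 + t) ^ ?n) * ?E"
        by (intro order_trans[OF \<delta>(3)] mult_left_mono) auto
      also have "\<dots> = ennreal (1 / (1 + t) ^ ?n) * (ennreal (2 ^ ?n) * ?E)"
        using t by (simp add: mult.assoc[symmetric] ennreal_mult[symmetric] del: ennreal_power)
      finally show "?A x \<le> ennreal (1 / (1 + t) ^ ?n) * (ennreal (2 ^ ?n) * ?E)" .
    qed (use n t intB in auto)
    also have "(ennreal (2 ^ ?n) * ?E) * (ennreal (?q ^ N) * ?E) = ennreal (2 ^ ?n * ?q ^ N) * (?E * ?E)"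
      by (subst ennreal_mult) (auto simp: mult_ac)
    finally show ?thesis .
  qed
  then have *: "ennreal (grad_bound TYPE('n)) * (\<integral>\<^sup>+x. ?A x * riesz_potential ?B x \<partial>lborel) \<le>
      ennreal (grad_bound TYPE('n)) * (ennreal (riesz_bound TYPE('n) / (1 + t) ^ (?n - 1)) * (ennreal (2 ^ ?n * ?q ^ N) * (?E * ?E)))"
    by (intro mult_left_mono) auto
  have "Zs_pow t \<gamma> (pot f) = pot w"
    unfolding w_def by (rule Zs_pow_pot[OF n], rule Ck_decay_mono[OF f]) (use \<gamma> in auto)
  with order_trans[OF L1norm_grad_pot_product_le[OF n cg w0] *] show ?thesis
    by (simp add: g_def)
qed

theorem lemma3p3:
  fixes N :: nat
  assumes "CARD('n::{finite,linorder}) \<ge> 4" and "N \<ge> 2 * CARD('n::{finite,linorder})"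
  shows "\<exists>C::real. C > 0 \<and>
    (\<forall>(\<mu>::real) (T::real) (\<epsilon>::real) (f :: real \<Rightarrow> 'n::{finite,linorder} phase \<Rightarrow> real) (\<phi> :: real \<Rightarrow> real ^ 'n::{finite,linorder} \<Rightarrow> real).
      \<mu> \<in> {1, -1} \<and> T > 0 \<and> \<epsilon> > 0 \<and>
      vp_solution \<mu> T f \<phi> \<and> (\<forall>t\<in>{0..T}. regular N (f t)) \<and>
      (\<forall>t\<in>{0..T}. energy N t (f t) \<le> ennreal (2 * \<epsilon>)) \<longrightarrow>
      (\<forall>\<gamma>\<in>multi_indices N. \<forall>\<beta>\<in>multi_indices N. length \<gamma> + length \<beta> \<le> N + 1 \<longrightarrow>
        (\<forall>t\<in>{0..T}.
          L1norm (\<lambda>(x, v). Zf_pow t \<beta> (f t) (x, v) *\<^sub>R grad (Zs_pow t \<gamma> (\<phi> t)) x)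
            \<le> ennreal C * (\<Sum>\<beta>'\<in>multi_indices N.
                 ennreal (\<epsilon> / (1 + t) ^ (CARD('n::{finite,linorder}) - 1)) * L1norm (Zf_pow t \<beta>' (f t))))))"
proof -
  let ?n = "CARD('n)"
  \<comment> \<open>the last factor \<open>2\<close> is that of the energy bound \<open>2 \<epsilon>\<close>\<close>
  define K where "K = grad_bound TYPE('n) * riesz_bound TYPE('n) * (2 ^ ?n * (real ?n + 3) ^ N) * 2"
  have G: "0 \<le> grad_bound TYPE('n)" by (simp add: grad_bound_def)
  have R: "0 \<le> riesz_bound TYPE('n)" using riesz_bound_pos by (rule less_imp_le)
  have K0: "0 \<le> K" unfolding K_def using G R by (intro mult_nonneg_nonneg) auto
  have bound: "L1norm (\<lambda>(x, v). Zf_pow t \<beta> (f t) (x, v) *\<^sub>R grad (Zs_pow t \<gamma> (\<phi> t)) x) \<le>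
      ennreal (K + 1) * (\<Sum>\<beta>'\<in>multi_indices N. ennreal (\<epsilon> / (1 + t) ^ (?n - 1)) * L1norm (Zf_pow t \<beta>' (f t)))"
    if \<epsilon>: "\<epsilon> > 0" and sol: "vp_solution \<mu> T f \<phi>" and reg: "\<forall>t\<in>{0..T}. regular N (f t)"
      and en: "\<forall>t\<in>{0..T}. energy N t (f t) \<le> ennreal (2 * \<epsilon>)"
      and \<gamma>: "\<gamma> \<in> multi_indices N" and \<beta>: "\<beta> \<in> multi_indices N"
      and len: "length \<gamma> + length \<beta> \<le> N + 1" and t: "t \<in> {0..T}"
    for \<mu> T \<epsilon> t :: real and f :: "real \<Rightarrow> 'n phase \<Rightarrow> real" and \<phi> and \<gamma> \<beta>
  proof -
    let ?E = "energy N t (f t)"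
    have f: "Ck_decay N (2 * ?n + N + 1) (f t)"
      using reg t by (intro regular_imp_Ck_decay) auto
    have "\<phi> t = pot (f t)"
    proof
      fix x
      have "Ck_decay 0 ?n (rho (f t))"
        by (rule Ck_decay_rho, rule Ck_decay_mono[OF f]) auto
      then have "rho (f t) \<in> borel_measurable borel"
        by (intro borel_measurable_continuous_onI) simp
      then show "\<phi> t x = pot (f t) x"
        using sol t by (simp add: vp_solution_def pot_def conv_commute)
    qed
    then have "L1norm (\<lambda>(x, v). Zf_pow t \<beta> (f t) (x, v) *\<^sub>R grad (Zs_pow t \<gamma> (\<phi> t)) x) \<le>
      ennreal (grad_bound TYPE('n)) * (ennreal (riesz_bound TYPE('n) / (1 + t) ^ (?n - 1)) *
      (ennreal (2 ^ ?n * (real ?n + 3) ^ N) * (?E * ?E)))"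
      using L1norm_product_le_energy_squared[OF assms _ f, of t \<gamma> \<beta>] \<gamma> \<beta> len t
      by (simp add: multi_indices_def)
    also have "\<dots> \<le> ennreal (grad_bound TYPE('n)) * (ennreal (riesz_bound TYPE('n) / (1 + t) ^ (?n - 1)) *
      (ennreal (2 ^ ?n * (real ?n + 3) ^ N) * (ennreal (2 * \<epsilon>) * ?E)))"
      using en t by (intro mult_left_mono mult_right_mono) auto
    also have "\<dots> = ennreal (grad_bound TYPE('n) * (riesz_bound TYPE('n) / (1 + t) ^ (?n - 1)) *
      (2 ^ ?n * (real ?n + 3) ^ N) * (2 * \<epsilon>)) * ?E"
      using G R t \<epsilon> by (subst ennreal_mult, simp, simp)+ (simp add: mult.assoc)
    also have "\<dots> = ennreal (K * (\<epsilon> / (1 + t) ^ (?n - 1))) * ?E"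
      by (simp add: K_def mult_ac)
    also have "\<dots> \<le> ennreal ((K + 1) * (\<epsilon> / (1 + t) ^ (?n - 1))) * ?E"
      using \<epsilon> t by (intro mult_right_mono ennreal_leI) auto
    also have "\<dots> = ennreal (K + 1) * (ennreal (\<epsilon> / (1 + t) ^ (?n - 1)) * ?E)"
      using K0 \<epsilon> t by (subst ennreal_mult) (auto simp: mult.assoc)
    also have "ennreal (\<epsilon> / (1 + t) ^ (?n - 1)) * ?E =
        (\<Sum>\<beta>'\<in>multi_indices N. ennreal (\<epsilon> / (1 + t) ^ (?n - 1)) * L1norm (Zf_pow t \<beta>' (f t)))"
      by (simp add: energy_def sum_distrib_left)
    finally show ?thesis .
  qed
  show ?thesis
    by (rule exI[of _ "K + 1"]) (use K0 bound in auto)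
qed

end
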